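(* Let $f=f(\rho,u)$ be smooth and let $(\rho_0,u_0)\in C^1_b(\mathbb{R})\times C^2_b(\mathbb{R})$ with $\rho_0\ge 0$. Then there exists $T>0$ and a classical solution $(\rho,u)$ of system $(S_f)$ on $[0,T)$. Moreover $e=u_x+\rho\in C^1([0,T)\times\mathbb{R})$. Finally, the solution can be continued (as a classical solution with $u_x+\rho\in C^1$) beyond any time $T_1<\infty$ up to which $\|(\rho,u)(t,\cdot)\|_\infty$ and $\|\partial_x(\rho,u)(t,\cdot)\|_\infty$ stay bounded; equivalently, if $T^*<\infty$ is the maximal existence time then $\sup_{t<T^*}\big(\|\rho(t,\cdot)\|_\infty+\|u(t,\cdot)\|_\infty+\|\rho_x(t,\cdot)\|_\infty+\|u_x(t,\cdot)\|_\infty\big)=\infty$.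
   Context: Let $f$ be a smooth real function of $(\rho,u)\in\mathbb{R}^2$. System $(S_f)$ is: $\rho_t+(\rho f(\rho,u))_x=0$, $u_t+uu_x=\rho\,(f(\rho,u)-u)$ for $x\in\mathbb{R}$, $t>0$, with initial data $\rho(0,x)=\rho_0(x)\ge 0$, $u(0,x)=u_0(x)$. A classical solution on $[0,T)$ is a pair $\rho,u\in C^1([0,T)\times\mathbb{R})$ satisfying the equations pointwise and the initial data, such that $\rho,u,\rho_x,u_x$ are bounded on $[0,t]\times\mathbb{R}$ for every $t<T$. $C^k_b(\mathbb{R})$ denotes the bounded $C^k$ functions whose derivatives up to order $k$ are all bounded; $\|g\|_\infty=\sup_{x\in\mathbb{R}}|g(x)|$. We write $e:=u_x+\rho$ and $e_0:=u_0'+\rho_0$. The system may be only weakly hyperbolic (the eigenvalues $\rho f_\rho+f$ and $u$ of its coefficient matrix may coincide). *)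

theory Defs
  imports "HOL-Analysis.Analysis"
begin

coinductive smooth2 :: "(real \<Rightarrow> real \<Rightarrow> real) \<Rightarrow> bool" where
  "(\<And>a b. ((\<lambda>(x,y). f x y) has_derivative (\<lambda>(h,k). fr a b * h + fu a b * k)) (at (a,b)))
   \<Longrightarrow> smooth2 fr \<Longrightarrow> smooth2 fu \<Longrightarrow> smooth2 f"

definition Ckb :: "nat \<Rightarrow> (real \<Rightarrow> real) \<Rightarrow> bool" where
  "Ckb k g \<longleftrightarrow>
     (\<forall>j<k. \<forall>x. ((deriv ^^ j) g) differentiable (at x)) \<and>
     continuous_on UNIV ((deriv ^^ k) g) \<and>
     (\<forall>j\<le>k. bounded (range ((deriv ^^ j) g)))"

definition strip :: "real \<Rightarrow> (real \<times> real) set" where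
  "strip T = {0..<T} \<times> UNIV"

definition C1_strip_with ::
  "real \<Rightarrow> (real \<Rightarrow> real \<Rightarrow> real) \<Rightarrow> (real \<Rightarrow> real \<Rightarrow> real) \<Rightarrow> (real \<Rightarrow> real \<Rightarrow> real) \<Rightarrow> bool" where
  "C1_strip_with T g gt gx \<longleftrightarrow>
     continuous_on (strip T) (\<lambda>(t,x). gt t x) \<and>
     continuous_on (strip T) (\<lambda>(t,x). gx t x) \<and>
     (\<forall>t x. 0 \<le> t \<and> t < T \<longrightarrow>
        ((\<lambda>(s,y). g s y) has_derivative (\<lambda>(h,k). gt t x * h + gx t x * k)) (at (t,x) within strip T))"

definition C1_strip :: "real \<Rightarrow> (real \<Rightarrow> real \<Rightarrow> real) \<Rightarrow> bool" where
  "C1_strip T g \<longleftrightarrow> (\<exists>gt gx. C1_strip_with T g gt gx)"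

definition classical_sol ::
  "(real \<Rightarrow> real \<Rightarrow> real) \<Rightarrow> (real \<Rightarrow> real) \<Rightarrow> (real \<Rightarrow> real) \<Rightarrow> real
   \<Rightarrow> (real \<Rightarrow> real \<Rightarrow> real) \<Rightarrow> (real \<Rightarrow> real \<Rightarrow> real) \<Rightarrow> bool" where
  "classical_sol f rho0 u0 T rho u \<longleftrightarrow>
     (\<exists>rhot rhox ut ux.
        C1_strip_with T rho rhot rhox \<and> C1_strip_with T u ut ux \<and>
        (\<forall>t x. 0 \<le> t \<and> t < T \<longrightarrow>
           ((\<lambda>y. rho t y * f (rho t y) (u t y)) has_real_derivative (- rhot t x)) (at x) \<and>
           ut t x + u t x * ux t x = rho t x * (f (rho t x) (u t x) - u t x)) \<and>
        (\<forall>x. rho 0 x = rho0 x \<and> u 0 x = u0 x) \<and>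
        (\<forall>t'. 0 \<le> t' \<and> t' < T \<longrightarrow> (\<exists>M. \<forall>t x. 0 \<le> t \<and> t \<le> t' \<longrightarrow>
           \<bar>rho t x\<bar> \<le> M \<and> \<bar>u t x\<bar> \<le> M \<and> \<bar>rhox t x\<bar> \<le> M \<and> \<bar>ux t x\<bar> \<le> M)))"

definition e_of :: "(real \<Rightarrow> real \<Rightarrow> real) \<Rightarrow> (real \<Rightarrow> real \<Rightarrow> real) \<Rightarrow> real \<Rightarrow> real \<Rightarrow> real" where
  "e_of rho u t x = deriv (\<lambda>y. u t y) x + rho t x"

end

theory Submission
  imports Defs
begin

text \<open>
  Since \<open>u\<^sub>x = e - \<rho>\<close> and \<open>e\<^sub>t + (u e)\<^sub>x = 0\<close>, the triple \<open>(\<rho>, u, e)\<close> solves a diagonal system with smooth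
  speeds \<open>\<rho> f\<^sub>\<rho> + f, u, u\<close> and sources of order zero, so coinciding eigenvalues are harmless. A diagonal
  system with \<open>C\<^sup>1\<^sub>b\<close> data is solved by characteristics for a time that depends only on the \<open>C\<^sup>1\<close> bounds
  of the data; conversely the constraint \<open>u\<^sub>x + \<rho> = e\<close> is propagated because its defect satisfies a linear
  conservation law. Bounds on \<open>\<rho>, u, \<rho>\<^sub>x, u\<^sub>x\<close> also bound \<open>e\<close>, and the transport equation of \<open>e\<close> then bounds
  \<open>e\<^sub>x\<close>. Hence one can restart shortly before \<open>T\<^sub>1\<close> with a uniform lifespan, and by uniqueness the two
  solutions glue.
\<close>

section \<open>Preliminaries\<close>

text \<open>The equation of e comes from differentiating the velocity equation in x: since (\<rho>
  f)_x = - \<rho>_t, one gets u_xt + (u u_x)_x = - \<rho>_t - (\<rho> u)_x, that is e_t + (u e)_x =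
  0. Two losses of derivative shape the proof. Comparing two candidate solutions costs one
  x-derivative of the unknown, so the iteration contracts in the sup norm among uniformly Lipschitz
  functions, and continuous differentiability is recovered afterwards from the oscillation of
  difference quotients. Moreover, the differentiation above presupposes a mixed derivative of u. For
  a given solution it exists because u_x = e - \<rho> is C^1; for the constructed triple u is a
  priori merely C^1, so the defect u_x + \<rho> - e is only continuous and its conservation law has
  to be used in averaged form. Gronwall's inequality is replaced by absorption
  (\<open>le_double_if_half_improving\<close>) on short times or under exponential weights.\<close>

lemma contraction_fixpoint:
  fixes F :: "('a \<Rightarrow> real) \<Rightarrow> 'a \<Rightarrow> real" and S :: "('a \<Rightarrow> real) \<Rightarrow> bool"
  assumes S0: "S f0" and SF: "\<And>f. S f \<Longrightarrow> S (F f)"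
    and contr: "\<And>f g d. S f \<Longrightarrow> S g \<Longrightarrow> (\<And>z. z \<in> D \<Longrightarrow> \<bar>f z - g z\<bar> \<le> d) \<Longrightarrow>
                  (\<And>z. z \<in> D \<Longrightarrow> \<bar>F f z - F g z\<bar> \<le> d / 2)"
    and K: "\<And>z. z \<in> D \<Longrightarrow> \<bar>F f0 z - f0 z\<bar> \<le> K"
    and closed: "\<And>fs f. (\<And>n::nat. S (fs n)) \<Longrightarrow> (\<And>z. z \<in> D \<Longrightarrow> (\<lambda>n. fs n z) \<longlonglongrightarrow> f z) \<Longrightarrow> S f"
  shows "\<exists>f. S f \<and> (\<forall>z\<in>D. F f z = f z)"
proof -
  \<comment> \<open>No metric on functions is set up: uniform distances on \<open>D\<close> suffice.
    As nothing is known off \<open>D\<close>, the class \<open>S\<close> has to be closed under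
    limits taken on \<open>D\<close> alone.\<close>
  define fs where "fs n = (F ^^ n) f0" for n
  have fsS: "S (fs n)" for n
    by (induction n) (auto simp: fs_def S0 SF)
  have step: "\<bar>fs (Suc n) z - fs n z\<bar> \<le> K / 2 ^ n" if "z \<in> D" for n z
    using that
  proof (induction n arbitrary: z)
    case 0 then show ?case using K by (simp add: fs_def)
  next
    case (Suc n)
    have "\<bar>F (fs (Suc n)) z - F (fs n) z\<bar> \<le> (K / 2 ^ n) / 2"
      by (rule contr[OF fsS fsS Suc.IH]) (use Suc.prems in auto)
    then show ?case by (simp add: fs_def mult.commute)
  qed
  \<comment> \<open>The subtracted term is the remaining tail of the geometric series; carrying it
    along makes the induction on \<open>m\<close> close.\<close>
  have far: "\<bar>fs (n + m) z - fs n z\<bar> \<le> 2 * K / 2 ^ n - 2 * K / 2 ^ (n + m)" if "z \<in> D" for n m z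
  proof (induction m)
    case (Suc m)
    have "\<bar>fs (n + Suc m) z - fs n z\<bar> \<le> \<bar>fs (Suc (n + m)) z - fs (n + m) z\<bar> + \<bar>fs (n + m) z - fs n z\<bar>" by simp
    also have "\<dots> \<le> K / 2 ^ (n + m) + (2 * K / 2 ^ n - 2 * K / 2 ^ (n + m))"
      using step[OF that, of "n + m"] Suc by linarith
    finally show ?case by (simp add: field_simps)
  qed simp
  have far': "\<bar>fs (n + m) z - fs n z\<bar> \<le> 2 * K / 2 ^ n" if "z \<in> D" for n m z
  proof -
    have "K \<ge> 0" using K[OF that] by linarith
    then have "2 * K / 2 ^ (n + m) \<ge> 0" by simp
    then show ?thesis using far[OF that, of n m] by linarith
  qed
  have geo: "(\<lambda>n. c / 2 ^ n) \<longlonglongrightarrow> 0" for c :: real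
    using tendsto_mult[OF tendsto_const[of c] LIMSEQ_power_zero[of "1/2::real"]]
    by (simp add: power_divide)
  have conv: "convergent (\<lambda>n. fs n z)" if "z \<in> D" for z
  proof -
    have "Cauchy (\<lambda>n. fs n z)"
    proof (rule metric_CauchyI)
      fix e :: real assume "e > 0"
      then obtain n0 where n0: "4 * K / 2 ^ n0 < e"
        using order_tendstoD(2)[OF geo[of "4 * K"], of e] by (auto simp: eventually_sequentially)
      have "dist (fs m z) (fs n z) < e" if mn: "m \<ge> n0" "n \<ge> n0" for m n
        using far'[OF \<open>z \<in> D\<close>, of n0 "m - n0"] far'[OF \<open>z \<in> D\<close>, of n0 "n - n0"] mn n0
        by (simp add: dist_real_def)
      then show "\<exists>M. \<forall>m\<ge>M. \<forall>n\<ge>M. dist (fs m z) (fs n z) < e" by blast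
    qed
    then show ?thesis by (simp add: Cauchy_convergent)
  qed
  define f where "f z = lim (\<lambda>n. fs n z)" for z
  have lim: "(\<lambda>n. fs n z) \<longlonglongrightarrow> f z" if "z \<in> D" for z
    using conv[OF that] by (simp add: f_def convergent_LIMSEQ_iff)
  have Sf: "S f" by (rule closed[OF fsS lim])
  have dist: "\<bar>f z - fs n z\<bar> \<le> 2 * K / 2 ^ n" if "z \<in> D" for n z
  proof (rule tendsto_upperbound)
    show "(\<lambda>m. \<bar>fs (n + m) z - fs n z\<bar>) \<longlonglongrightarrow> \<bar>f z - fs n z\<bar>"
      using LIMSEQ_ignore_initial_segment[OF lim[OF that], of n]
      by (intro tendsto_intros) (simp add: add.commute)
  qed (use far'[OF that] in auto)
  have "F f z = f z" if z: "z \<in> D" for z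
  proof -
    have "\<bar>F f z - fs (Suc n) z\<bar> \<le> K / 2 ^ n" for n
      using contr[OF Sf fsS dist z] by (simp add: fs_def)
    then have "(\<lambda>n. F f z - fs (Suc n) z) \<longlonglongrightarrow> 0"
      by (intro Lim_null_comparison[OF _ geo[of K]]) auto
    moreover have "(\<lambda>n. F f z - fs (Suc n) z) \<longlonglongrightarrow> F f z - f z"
      using LIMSEQ_Suc[OF lim[OF z]] by (intro tendsto_intros)
    ultimately show ?thesis using LIMSEQ_unique by fastforce
  qed
  then show ?thesis using Sf by blast
qed

text \<open>Absorption in place of Gronwall: the supremum is itself an admissible \<open>M\<close>,
  hence at most \<open>K\<close> plus half of itself. The a priori bound \<open>M0\<close> makes it
  finite, which is what permits subtracting that half.\<close>

lemma le_double_if_half_improving: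
  fixes \<phi> :: "'a \<Rightarrow> real"
  assumes bd: "\<And>s. s \<in> S \<Longrightarrow> \<phi> s \<le> M0"
    and step: "\<And>M s. (\<And>s. s \<in> S \<Longrightarrow> \<phi> s \<le> M) \<Longrightarrow> s \<in> S \<Longrightarrow> \<phi> s \<le> K + M / 2"
    and s: "s \<in> S"
  shows "\<phi> s \<le> 2 * K"
proof -
  define M where "M = (SUP s\<in>S. \<phi> s)"
  have bdd: "bdd_above (\<phi> ` S)" using bd by (auto intro!: bdd_aboveI2)
  have le: "\<phi> s \<le> M" if "s \<in> S" for s
    unfolding M_def using bdd that by (rule cSUP_upper2) auto
  have "M \<le> K + M / 2"
    unfolding M_def[of] by (rule cSUP_least) (use s step[OF le] M_def in auto)
  then show ?thesis using le[OF s] by linarith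
qed

lemma integral_abs_bound:
  fixes g :: "real \<Rightarrow> real"
  assumes "continuous_on {a..b} g" "a \<le> b" "\<And>s. s \<in> {a..b} \<Longrightarrow> \<bar>g s\<bar> \<le> K"
  shows "\<bar>integral {a..b} g\<bar> \<le> K * (b - a)"
  using integral_bound[of a b g K] assms by simp

lemma integral_diff_bound:
  fixes g h :: "real \<Rightarrow> real"
  assumes "continuous_on {a..b} g" "continuous_on {a..b} h" "a \<le> b"
    "\<And>s. s \<in> {a..b} \<Longrightarrow> \<bar>g s - h s\<bar> \<le> K"
  shows "\<bar>integral {a..b} g - integral {a..b} h\<bar> \<le> K * (b - a)"
proof -
  have "integral {a..b} g - integral {a..b} h = integral {a..b} (\<lambda>s. g s - h s)"
    by (simp add: Henstock_Kurzweil_Integration.integral_diff integrable_continuous_real assms)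
  then show ?thesis
    using integral_abs_bound[of a b "\<lambda>s. g s - h s" K] assms by (auto intro: continuous_intros)
qed

lemma abs_prod_diff_le:
  fixes a b a' b' :: real
  assumes "\<bar>a - a'\<bar> \<le> p" "\<bar>b\<bar> \<le> q" "\<bar>a'\<bar> \<le> r" "\<bar>b - b'\<bar> \<le> s"
  shows "\<bar>a * b - a' * b'\<bar> \<le> p * q + r * s"
proof -
  have "a * b - a' * b' = (a - a') * b + a' * (b - b')" by (simp add: algebra_simps)
  moreover have "\<bar>(a - a') * b\<bar> \<le> p * q" "\<bar>a' * (b - b')\<bar> \<le> r * s"
    unfolding abs_mult using mult_mono'[OF assms(1,2)] mult_mono'[OF assms(3,4)] by auto
  ultimately show ?thesis by linarith
qed

lemma inverse_Suc_le:
  assumes "\<delta> > (0::real)" shows "\<forall>\<^sub>F n in sequentially. inverse (real (Suc n)) \<le> \<delta>"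
  using order_tendstoD(2)[OF LIMSEQ_inverse_real_of_nat assms] by (rule eventually_mono) simp

lemma lipschitz_imp_deriv_bound:
  fixes F :: "real \<Rightarrow> real"
  assumes "(F has_real_derivative D) (at x)" "\<And>y. \<bar>F y - F x\<bar> \<le> L * \<bar>y - x\<bar>"
  shows "\<bar>D\<bar> \<le> L"
proof (rule tendsto_upperbound)
  show "((\<lambda>h. \<bar>(F (x + h) - F x) / h\<bar>) \<longlongrightarrow> \<bar>D\<bar>) (at 0)"
    using assms(1) unfolding DERIV_def by (intro tendsto_rabs)
  have "\<bar>(F (x + h) - F x) / h\<bar> \<le> L" if "h \<noteq> 0" for h
    using assms(2)[of "x + h"] that by (simp add: abs_divide divide_le_eq)
  then show "\<forall>\<^sub>F h in at 0. \<bar>(F (x + h) - F x) / h\<bar> \<le> L"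
    by (auto simp: eventually_at intro!: exI[of _ 1])
qed simp

lemma vec_norm_le_of_components:
  fixes v :: "real ^ 'n::finite"
  assumes "\<And>i. \<bar>v $ i\<bar> \<le> d"
  shows "norm v \<le> real CARD('n) * d"
proof -
  have "norm v \<le> (\<Sum>i\<in>UNIV. \<bar>v $ i\<bar>)" by (rule norm_le_l1_cart)
  also have "\<dots> \<le> (\<Sum>i\<in>(UNIV::'n set). d)" by (rule sum_mono) (use assms in auto)
  finally show ?thesis by simp
qed

section \<open>Functions with locally Lipschitz gradient\<close>

text \<open>Differences are what the proofs manipulate, so \<open>C\<^sup>1\<^sup>,\<^sup>1\<close> regularity is encoded by a
  second-order Taylor remainder with a locally bounded and Lipschitz gradient \<open>D\<close>.\<close>

definition c11_with :: "('a::real_inner \<Rightarrow> real) \<Rightarrow> ('a \<Rightarrow> 'a) \<Rightarrow> real \<Rightarrow> real \<Rightarrow> bool" where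
  "c11_with F D A C \<longleftrightarrow> (\<forall>v w. norm v \<le> A \<longrightarrow> norm w \<le> A \<longrightarrow>
      \<bar>F v\<bar> \<le> C \<and> \<bar>F w - F v\<bar> \<le> C * norm (w - v) \<and> norm (D v) \<le> C \<and>
      norm (D w - D v) \<le> C * norm (w - v) \<and>
      \<bar>F w - F v - D v \<bullet> (w - v)\<bar> \<le> C * (norm (w - v))\<^sup>2)"

definition c11 :: "('a::real_inner \<Rightarrow> real) \<Rightarrow> bool" where
  "c11 F \<longleftrightarrow> (\<exists>D. \<forall>A. \<exists>C. c11_with F D A C)"

lemma c11_with_mono: "c11_with F D A C \<Longrightarrow> C \<le> C' \<Longrightarrow> c11_with F D A C'"
  unfolding c11_with_def by (blast intro: mult_right_mono norm_ge_zero order_trans zero_le_power2)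

lemma c11_withD:
  assumes "c11_with F D A C" "norm v \<le> A" "norm w \<le> A"
  shows "\<bar>F v\<bar> \<le> C" "\<bar>F w - F v\<bar> \<le> C * norm (w - v)" "norm (D v) \<le> C"
      "norm (D w - D v) \<le> C * norm (w - v)" "\<bar>F w - F v - D v \<bullet> (w - v)\<bar> \<le> C * (norm (w - v))\<^sup>2"
  using assms unfolding c11_with_def by blast+

text \<open>Two estimates generate the others on a ball: the Lipschitz gradient is bounded through
  its value at 0, the Taylor remainder together with |w - v| \<le> 2 A then makes \<open>F\<close>
  Lipschitz, and \<open>F 0\<close> makes it bounded.\<close>

lemma c11I:
  assumes "\<And>A. A \<ge> 0 \<Longrightarrow> \<exists>C. \<forall>v w. norm v \<le> A \<longrightarrow> norm w \<le> A \<longrightarrow>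
     norm (D w - D v) \<le> C * norm (w - v) \<and> \<bar>F w - F v - D v \<bullet> (w - v)\<bar> \<le> C * (norm (w - v))\<^sup>2"
  shows "c11 F"
  unfolding c11_def
proof (intro exI[of _ D] allI)
  fix A :: real
  show "\<exists>C. c11_with F D A C"
  proof (cases "A \<ge> 0")
    case False
    then show ?thesis by (auto simp: c11_with_def) (meson norm_ge_zero order_trans)
  next
    case True
    then obtain C0 where C0: "\<And>v w. norm v \<le> A \<Longrightarrow> norm w \<le> A \<Longrightarrow>
        norm (D w - D v) \<le> C0 * norm (w - v) \<and> \<bar>F w - F v - D v \<bullet> (w - v)\<bar> \<le> C0 * (norm (w - v))\<^sup>2"
      using assms by meson
    define C1 where "C1 = \<bar>C0\<bar>"
    have C1: "norm (D w - D v) \<le> C1 * norm (w - v)" "\<bar>F w - F v - D v \<bullet> (w - v)\<bar> \<le> C1 * (norm (w - v))\<^sup>2"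
      if "norm v \<le> A" "norm w \<le> A" for v w
    proof -
      have "C0 * norm (w - v) \<le> C1 * norm (w - v)" "C0 * (norm (w - v))\<^sup>2 \<le> C1 * (norm (w - v))\<^sup>2"
        by (auto simp: C1_def intro!: mult_right_mono)
      then show "norm (D w - D v) \<le> C1 * norm (w - v)" "\<bar>F w - F v - D v \<bullet> (w - v)\<bar> \<le> C1 * (norm (w - v))\<^sup>2"
        using C0[OF that] by linarith+
    qed
    have C1pos: "C1 \<ge> 0" by (simp add: C1_def)
    define C2 where "C2 = norm (D 0) + C1 * A"
    have D: "norm (D v) \<le> C2" if "norm v \<le> A" for v
    proof -
      have "norm (D v) \<le> norm (D 0) + norm (D v - D 0)" by (rule norm_triangle_sub)
      also have "norm (D v - D 0) \<le> C1 * norm (v - 0)" using C1(1)[of 0 v] that True by simp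
      also have "\<dots> \<le> C1 * A" using that C1pos by (simp add: mult_left_mono)
      finally show ?thesis by (simp add: C2_def)
    qed
    have C2pos: "C2 \<ge> 0" by (simp add: C2_def True C1pos)
    define C3 where "C3 = C2 + C1 * (2 * A)"
    have Lip: "\<bar>F w - F v\<bar> \<le> C3 * norm (w - v)" if "norm v \<le> A" "norm w \<le> A" for v w
    proof -
      have n: "norm (w - v) \<le> 2 * A" using norm_triangle_ineq4[of w v] that by linarith
      have "\<bar>F w - F v\<bar> \<le> \<bar>D v \<bullet> (w - v)\<bar> + C1 * (norm (w - v))\<^sup>2" using C1(2)[OF that] by linarith
      also have "\<bar>D v \<bullet> (w - v)\<bar> \<le> norm (D v) * norm (w - v)" by (rule Cauchy_Schwarz_ineq2)
      also have "\<dots> \<le> C2 * norm (w - v)" by (simp add: D that mult_right_mono)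
      also have "C1 * (norm (w - v))\<^sup>2 \<le> C1 * (2 * A) * norm (w - v)"
        using mult_right_mono[OF mult_left_mono[OF n C1pos], of "norm (w - v)"] by (simp add: power2_eq_square mult.assoc)
      finally show ?thesis by (simp add: C3_def algebra_simps)
    qed
    have C3: "C3 \<ge> C2" "C3 \<ge> 0" by (auto simp: C3_def True C1pos C2pos)
    define C where "C = C1 + C2 + C3 + \<bar>F 0\<bar> + C3 * A"
    have CC: "C1 \<le> C" "C2 \<le> C" "C3 \<le> C" using C1pos C2pos C3 True by (auto simp: C_def)
    have "\<bar>F v\<bar> \<le> C" if "norm v \<le> A" for v
    proof -
      have "\<bar>F v\<bar> \<le> \<bar>F 0\<bar> + \<bar>F v - F 0\<bar>" by linarith
      also have "\<bar>F v - F 0\<bar> \<le> C3 * norm (v - 0)" using Lip[of 0 v] that True by simp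
      also have "\<dots> \<le> C3 * A" using that C3 by (simp add: mult_left_mono)
      finally show ?thesis using C1pos C2pos C3 by (simp add: C_def)
    qed
    then have "c11_with F D A C"
      unfolding c11_with_def using C1 D Lip CC
      by (blast intro: order_trans[OF _ mult_right_mono[OF CC(1)]] order_trans[OF _ mult_right_mono[OF CC(3)]]
            order_trans[OF _ CC(2)] norm_ge_zero zero_le_power2)
    then show ?thesis by blast
  qed
qed

lemma c11_obtain:
  assumes "c11 F"
  obtains D where "\<And>A. \<exists>C\<ge>0. c11_with F D A C"
proof -
  obtain D where D: "\<And>A. \<exists>C. c11_with F D A C" using assms unfolding c11_def by blast
  have "\<exists>C\<ge>0. c11_with F D A C" for A
  proof -
    obtain C where "c11_with F D A C" using D by blast
    then have "c11_with F D A (max C 0)" by (rule c11_with_mono) simp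
    then show ?thesis by (intro exI[of _ "max C 0"]) simp
  qed
  then show thesis using that by blast
qed

lemma c11_family:
  fixes F :: "'n::finite \<Rightarrow> 'a::real_inner \<Rightarrow> real"
  assumes "\<And>i. c11 (F i)"
  shows "\<exists>D. \<forall>R. \<exists>C\<ge>0. \<forall>i. c11_with (F i) (D i) R C"
proof -
  have "\<forall>i. \<exists>D. \<forall>R. \<exists>C\<ge>0. c11_with (F i) D R C" using c11_obtain[OF assms] by metis
  then obtain D where D: "\<And>i R. \<exists>C\<ge>0. c11_with (F i) (D i) R C" by metis
  have "\<exists>C\<ge>0. \<forall>i. c11_with (F i) (D i) R C" for R
  proof -
    define c where "c i = (SOME C. C \<ge> 0 \<and> c11_with (F i) (D i) R C)" for i
    have c: "c i \<ge> 0 \<and> c11_with (F i) (D i) R (c i)" for i unfolding c_def by (rule someI_ex[OF D])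
    have "c11_with (F i) (D i) R (sum c UNIV)" for i
    proof (rule c11_with_mono)
      show "c11_with (F i) (D i) R (c i)" using c by blast
      show "c i \<le> sum c UNIV" using c by (intro member_le_sum) auto
    qed
    moreover have "sum c UNIV \<ge> 0" using c by (auto intro!: sum_nonneg)
    ultimately show ?thesis by blast
  qed
  then show ?thesis by blast
qed

lemma c11_continuous:
  fixes F :: "'a::real_inner \<Rightarrow> real"
  assumes "c11 F" shows "continuous_on UNIV F"
proof -
  obtain D where D: "\<And>A. \<exists>C\<ge>0. c11_with F D A C" using c11_obtain[OF assms] by blast
  have "isCont F x" for x
  proof -
    obtain C where C: "C \<ge> 0" "c11_with F D (norm x + 1) C" using D by blast
    have "((\<lambda>w. F w - F x) \<longlongrightarrow> 0) (at x)"
    proof (rule Lim_null_comparison)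
      show "\<forall>\<^sub>F w in at x. norm (F w - F x) \<le> C * norm (w - x)"
        unfolding eventually_at
      proof (intro exI[of _ 1] conjI ballI impI)
        fix w assume "w \<noteq> x \<and> dist w x < 1"
        then have "norm w \<le> norm x + 1" using norm_triangle_sub[of w x] by (simp add: dist_norm)
        then show "norm (F w - F x) \<le> C * norm (w - x)"
          using c11_withD(2)[OF C(2), of x w] by simp
      qed simp
      have "((\<lambda>w. C * norm (w - x)) \<longlongrightarrow> C * norm (x - x)) (at x)" by (intro tendsto_intros)
      then show "((\<lambda>w. C * norm (w - x)) \<longlongrightarrow> 0) (at x)" by simp
    qed
    then show ?thesis by (simp add: isCont_def LIM_zero_iff)
  qed
  then show ?thesis by (simp add: continuous_at_imp_continuous_on)
qed

lemma c11_const: "c11 (\<lambda>_. c)"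
  by (rule c11I[of "\<lambda>_. 0"]) (auto intro!: exI[of _ 0])

lemma c11_inner: "c11 (\<lambda>v. v \<bullet> a)"
  by (rule c11I[of "\<lambda>_. a"]) (auto intro!: exI[of _ 0] simp: inner_diff_left inner_diff_right inner_commute)

lemma c11_nth: "c11 (\<lambda>v::real^'n. v $ i)"
  using c11_inner[of "axis i 1 :: real^'n"] by (simp add: inner_axis)

lemma c11_add:
  fixes F G :: "'a::real_inner \<Rightarrow> real"
  assumes "c11 F" "c11 G" shows "c11 (\<lambda>v. F v + G v)"
proof -
  obtain D E where D: "\<And>A. \<exists>C\<ge>0. c11_with F D A C" and E: "\<And>A. \<exists>C\<ge>0. c11_with G E A C"
    using c11_obtain assms by metis
  show ?thesis
  proof (rule c11I[of "\<lambda>v. D v + E v"])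
    fix A :: real
    obtain C K where C: "c11_with F D A C" and K: "c11_with G E A K" using D E by meson
    show "\<exists>C. \<forall>v w. norm v \<le> A \<longrightarrow> norm w \<le> A \<longrightarrow>
     norm (D w + E w - (D v + E v)) \<le> C * norm (w - v) \<and>
     \<bar>F w + G w - (F v + G v) - (D v + E v) \<bullet> (w - v)\<bar> \<le> C * (norm (w - v))\<^sup>2"
    proof (intro exI[of _ "C + K"] allI impI conjI)
      fix v w :: 'a assume A: "norm v \<le> A" "norm w \<le> A"
      have "norm (D w + E w - (D v + E v)) \<le> norm (D w - D v) + norm (E w - E v)"
        by (rule norm_diff_triangle_ineq)
      then show "norm (D w + E w - (D v + E v)) \<le> (C + K) * norm (w - v)"
        using c11_withD(4)[OF C A] c11_withD(4)[OF K A] by (simp add: distrib_right)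
      show "\<bar>F w + G w - (F v + G v) - (D v + E v) \<bullet> (w - v)\<bar> \<le> (C + K) * (norm (w - v))\<^sup>2"
        using c11_withD(5)[OF C A] c11_withD(5)[OF K A] by (simp add: distrib_right inner_add_left)
    qed
  qed
qed

lemma c11_mult:
  fixes F G :: "'a::real_inner \<Rightarrow> real"
  assumes "c11 F" "c11 G" shows "c11 (\<lambda>v. F v * G v)"
proof -
  obtain D E where D: "\<And>A. \<exists>C\<ge>0. c11_with F D A C" and E: "\<And>A. \<exists>C\<ge>0. c11_with G E A C"
    using c11_obtain assms by metis
  show ?thesis
  proof (rule c11I[of "\<lambda>v. G v *\<^sub>R D v + F v *\<^sub>R E v"])
    fix A :: real
    obtain C K where C: "C \<ge> 0" "c11_with F D A C" and K: "K \<ge> 0" "c11_with G E A K" using D E by meson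
    show "\<exists>C. \<forall>v w. norm v \<le> A \<longrightarrow> norm w \<le> A \<longrightarrow>
     norm (G w *\<^sub>R D w + F w *\<^sub>R E w - (G v *\<^sub>R D v + F v *\<^sub>R E v)) \<le> C * norm (w - v) \<and>
     \<bar>F w * G w - F v * G v - (G v *\<^sub>R D v + F v *\<^sub>R E v) \<bullet> (w - v)\<bar> \<le> C * (norm (w - v))\<^sup>2"
    proof (intro exI[of _ "4 * C * K"] allI impI conjI)
      fix v w :: 'a assume A: "norm v \<le> A" "norm w \<le> A"
      let ?n = "norm (w - v)"
      note c = c11_withD[OF C(2) A] and k = c11_withD[OF K(2) A]
      note cw = c11_withD[OF C(2) A(2) A(1)] and kw = c11_withD[OF K(2) A(2) A(1)]
      have eq: "G w *\<^sub>R D w + F w *\<^sub>R E w - (G v *\<^sub>R D v + F v *\<^sub>R E v)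
        = G w *\<^sub>R (D w - D v) + (G w - G v) *\<^sub>R D v + (F w *\<^sub>R (E w - E v) + (F w - F v) *\<^sub>R E v)"
        by (simp add: algebra_simps)
      have mm: "\<bar>x * y\<bar> \<le> p * q" if "\<bar>x\<bar> \<le> p" "\<bar>y\<bar> \<le> q" for x y p q :: real
        unfolding abs_mult by (rule mult_mono') (use that in auto)
      have sm: "norm (x *\<^sub>R y) \<le> p * q" if "\<bar>x\<bar> \<le> p" "norm y \<le> q" for x p q :: real and y :: 'a
        unfolding norm_scaleR by (rule mult_mono') (use that in auto)
      note n4 = sm[OF kw(1) c(4)] sm[OF k(2) c(3)] sm[OF cw(1) k(4)] sm[OF c(2) k(3)]
      have tr: "norm (x + y + (z + t)) \<le> norm x + norm y + (norm z + norm t)" for x y z t :: 'a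
        by (intro norm_triangle_le add_mono norm_triangle_ineq)
      have "norm (G w *\<^sub>R (D w - D v) + (G w - G v) *\<^sub>R D v + (F w *\<^sub>R (E w - E v) + (F w - F v) *\<^sub>R E v))
         \<le> K * (C * ?n) + K * ?n * C + (C * (K * ?n) + C * ?n * K)"
        by (rule order_trans[OF tr]) (intro add_mono n4)
      then show "norm (G w *\<^sub>R D w + F w *\<^sub>R E w - (G v *\<^sub>R D v + F v *\<^sub>R E v)) \<le> 4 * C * K * ?n"
        unfolding eq by (simp add: algebra_simps)
      \<comment> \<open>The remainder of a product is quadratic: two old remainders with bounded
        factors, and a product of two Lipschitz increments.\<close>
      have eq2: "F w * G w - F v * G v - (G v *\<^sub>R D v + F v *\<^sub>R E v) \<bullet> (w - v)
        = G v * (F w - F v - D v \<bullet> (w - v)) + F v * (G w - G v - E v \<bullet> (w - v)) + (F w - F v) * (G w - G v)"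
        by (simp add: algebra_simps inner_add_left)
      note mm[OF k(1) c(5)] mm[OF c(1) k(5)] mm[OF c(2) k(2)]
      then have "\<bar>G v * (F w - F v - D v \<bullet> (w - v))\<bar> \<le> C * K * ?n\<^sup>2"
           "\<bar>F v * (G w - G v - E v \<bullet> (w - v))\<bar> \<le> C * K * ?n\<^sup>2"
           "\<bar>(F w - F v) * (G w - G v)\<bar> \<le> C * K * ?n\<^sup>2"
        by (simp_all only: power2_eq_square ac_simps)
      moreover have tri: "\<bar>a + b + c\<bar> \<le> 4 * k" if "\<bar>a\<bar> \<le> k" "\<bar>b\<bar> \<le> k" "\<bar>c\<bar> \<le> k" for a b c k :: real
        using that by linarith
      ultimately have "\<bar>G v * (F w - F v - D v \<bullet> (w - v)) + F v * (G w - G v - E v \<bullet> (w - v)) + (F w - F v) * (G w - G v)\<bar>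
          \<le> 4 * (C * K * ?n\<^sup>2)" by blast
      then show "\<bar>F w * G w - F v * G v - (G v *\<^sub>R D v + F v *\<^sub>R E v) \<bullet> (w - v)\<bar> \<le> 4 * C * K * ?n\<^sup>2"
        unfolding eq2 by (simp only: mult.assoc)
    qed
  qed
qed

lemma c11_diff:
  assumes "c11 F" "c11 G" shows "c11 (\<lambda>v. F v - G v)"
  using c11_add[OF assms(1) c11_mult[OF c11_const[of "-1"] assms(2)]] by simp

lemma c11_minus: "c11 F \<Longrightarrow> c11 (\<lambda>v. - F v)"
  using c11_mult[OF c11_const[of "-1"]] by fastforce

text \<open>The gradient of the composition is \<open>q (D (p v))\<close>, where \<open>q\<close> is
  the adjoint of \<open>p\<close> by \<open>adj\<close>. Neither map increases norms, so the
  constant of \<open>F\<close> on a ball serves again.\<close>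

lemma c11_compose_isometric:
  fixes F :: "'b::real_inner \<Rightarrow> real" and p :: "'a::real_inner \<Rightarrow> 'b"
  assumes F: "c11 F" and p: "linear p" and adj: "\<And>v w. q v \<bullet> w = v \<bullet> p w" and q: "linear q"
    and np: "\<And>w. norm (p w) \<le> norm w" and nq: "\<And>v. norm (q v) \<le> norm v"
  shows "c11 (\<lambda>v. F (p v))"
proof -
  obtain D where D: "\<And>A. \<exists>C\<ge>0. c11_with F D A C" using c11_obtain F by metis
  show ?thesis
  proof (rule c11I[of "\<lambda>v. q (D (p v))"])
    fix A :: real
    obtain C where C: "C \<ge> 0" "c11_with F D A C" using D by blast
    show "\<exists>C. \<forall>v w. norm v \<le> A \<longrightarrow> norm w \<le> A \<longrightarrow>
            norm (q (D (p w)) - q (D (p v))) \<le> C * norm (w - v) \<and>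
            \<bar>F (p w) - F (p v) - q (D (p v)) \<bullet> (w - v)\<bar> \<le> C * (norm (w - v))\<^sup>2"
    proof (intro exI[of _ C] allI impI conjI)
      fix v w :: 'a assume A: "norm v \<le> A" "norm w \<le> A"
      have A': "norm (p v) \<le> A" "norm (p w) \<le> A" using A np order_trans by blast+
      note c = c11_withD[OF C(2) A']
      have pn: "norm (p w - p v) \<le> norm (w - v)" using np[of "w - v"] by (simp add: linear_diff[OF p])
      have "norm (q (D (p w)) - q (D (p v))) \<le> norm (D (p w) - D (p v))"
        using nq by (simp flip: linear_diff[OF q])
      also have "\<dots> \<le> C * norm (p w - p v)" by (rule c(4))
      also have "\<dots> \<le> C * norm (w - v)" using C pn by (simp add: mult_left_mono)
      finally show "norm (q (D (p w)) - q (D (p v))) \<le> C * norm (w - v)" .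
      have "C * (norm (p w - p v))\<^sup>2 \<le> C * (norm (w - v))\<^sup>2"
        using C pn by (simp add: mult_left_mono power_mono)
      then show "\<bar>F (p w) - F (p v) - q (D (p v)) \<bullet> (w - v)\<bar> \<le> C * (norm (w - v))\<^sup>2"
        using c(5) by (simp add: adj linear_diff[OF p])
    qed
  qed
qed

section \<open>Smooth functions of two variables have locally Lipschitz gradients\<close>

lemma smooth2_obtain:
  assumes "smooth2 f"
  obtains fr fu where "smooth2 fr" "smooth2 fu"
    "\<And>a b. ((\<lambda>(x,y). f x y) has_derivative (\<lambda>(h,k). fr a b * h + fu a b * k)) (at (a,b))"
  using assms by (cases rule: smooth2.cases) blast

lemma smooth2_continuous:
  assumes "smooth2 f" shows "continuous_on UNIV (\<lambda>(x,y). f x y)"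
proof -
  obtain fr fu where
    "\<And>a b. ((\<lambda>(x,y). f x y) has_derivative (\<lambda>(h,k). fr a b * h + fu a b * k)) (at (a,b))"
    using smooth2_obtain[OF assms] by metis
  then show ?thesis
    by (intro continuous_at_imp_continuous_on) (force intro: has_derivative_continuous)
qed

lemma smooth2_lipschitz_ball:
  assumes "smooth2 f"
  shows "\<exists>C\<ge>0. \<forall>v w::real\<times>real. norm v \<le> A \<longrightarrow> norm w \<le> A \<longrightarrow>
           \<bar>f (fst w) (snd w) - f (fst v) (snd v)\<bar> \<le> C * norm (w - v)"
proof -
  obtain fr fu where fr: "smooth2 fr" and fu: "smooth2 fu" and
    d: "\<And>a b. ((\<lambda>(x,y). f x y) has_derivative (\<lambda>(h,k). fr a b * h + fu a b * k)) (at (a,b))"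
    using smooth2_obtain[OF assms] by metis
  have bd: "\<exists>C\<ge>0. \<forall>v\<in>cball 0 A. \<bar>g (fst v) (snd v)\<bar> \<le> C" if "smooth2 g" for g
  proof -
    have "compact ((\<lambda>(x,y). g x y) ` cball 0 A)"
      by (rule compact_continuous_image[OF continuous_on_subset[OF smooth2_continuous[OF that]]]) auto
    then obtain C where "\<forall>v\<in>cball 0 A. \<bar>g (fst v) (snd v)\<bar> \<le> C"
      using compact_imp_bounded bounded_iff by (metis (mono_tags, lifting) case_prod_unfold image_eqI real_norm_def)
    then show ?thesis by (intro exI[of _ "max C 0"]) (auto simp: le_max_iff_disj)
  qed
  obtain C1 C2 where C1: "C1 \<ge> 0" "\<And>v. v \<in> cball 0 A \<Longrightarrow> \<bar>fr (fst v) (snd v)\<bar> \<le> C1"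
    and C2: "C2 \<ge> 0" "\<And>v. v \<in> cball 0 A \<Longrightarrow> \<bar>fu (fst v) (snd v)\<bar> \<le> C2"
    using bd[OF fr] bd[OF fu] by blast
  have "norm ((\<lambda>(x,y). f x y) w - (\<lambda>(x,y). f x y) v) \<le> (C1 + C2) * norm (w - v)"
    if "norm v \<le> A" "norm w \<le> A" for v w
  proof (rule differentiable_bound[of "cball 0 A"])
    show "((\<lambda>(x,y). f x y) has_derivative (\<lambda>(h,k). fr (fst x) (snd x) * h + fu (fst x) (snd x) * k)) (at x within cball 0 A)" for x
      using d[of "fst x" "snd x"] by (auto intro: has_derivative_at_withinI)
    show "onorm (\<lambda>(h,k). fr (fst x) (snd x) * h + fu (fst x) (snd x) * k) \<le> C1 + C2" if x: "x \<in> cball 0 A" for x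
    proof (rule onorm_bound)
      show "norm (case v of (h,k) \<Rightarrow> fr (fst x) (snd x) * h + fu (fst x) (snd x) * k) \<le> (C1 + C2) * norm v" for v
      proof (cases v)
        case (Pair h k)
        have "\<bar>fr (fst x) (snd x) * h\<bar> \<le> C1 * norm (h,k)" "\<bar>fu (fst x) (snd x) * k\<bar> \<le> C2 * norm (h,k)"
          using C1 C2 x norm_fst_le[of h k] norm_snd_le[of k h] by (auto simp: abs_mult intro!: mult_mono)
        then show ?thesis using Pair by (simp add: distrib_right)
      qed
    qed (use C1 C2 in auto)
  qed (use that in auto)
  then show ?thesis using C1(1) C2(1)
    by (intro exI[of _ "C1 + C2"]) (auto simp: case_prod_unfold)
qed

text \<open>The gradient is Lipschitz on balls because its entries \<open>fr\<close> and
  \<open>fu\<close> are again smooth; the Taylor remainder follows from this by the mean value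
  inequality.\<close>

lemma smooth2_c11_pair:
  assumes "smooth2 f" shows "c11 (\<lambda>v::real\<times>real. f (fst v) (snd v))"
proof -
  obtain fr fu where fr: "smooth2 fr" and fu: "smooth2 fu" and
    d: "\<And>a b. ((\<lambda>(x,y). f x y) has_derivative (\<lambda>(h,k). fr a b * h + fu a b * k)) (at (a,b))"
    using smooth2_obtain[OF assms] by metis
  let ?D = "\<lambda>v. (fr (fst v) (snd v), fu (fst v) (snd v))"
  have d': "((\<lambda>v. f (fst v) (snd v)) has_derivative (\<lambda>h. ?D v \<bullet> h)) (at v within S)" for v S
    using d[of "fst v" "snd v"] by (auto intro!: has_derivative_at_withinI simp: case_prod_unfold inner_prod_def)
  show ?thesis
  proof (rule c11I[of ?D])
    fix A :: real
    obtain C1 C2 where C1: "C1 \<ge> 0" and c1: "\<And>v w::real\<times>real. norm v \<le> A \<Longrightarrow> norm w \<le> A \<Longrightarrow>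
           \<bar>fr (fst w) (snd w) - fr (fst v) (snd v)\<bar> \<le> C1 * norm (w - v)"
        and C2: "C2 \<ge> 0" and c2: "\<And>v w::real\<times>real. norm v \<le> A \<Longrightarrow> norm w \<le> A \<Longrightarrow>
           \<bar>fu (fst w) (snd w) - fu (fst v) (snd v)\<bar> \<le> C2 * norm (w - v)"
      using smooth2_lipschitz_ball[OF fr, of A] smooth2_lipschitz_ball[OF fu, of A] by metis
    let ?C = "C1 + C2"
    have Lip: "norm (?D w - ?D v) \<le> ?C * norm (w - v)" if "norm v \<le> A" "norm w \<le> A" for v w
    proof -
      have "norm (?D w - ?D v) \<le> \<bar>fr (fst w) (snd w) - fr (fst v) (snd v)\<bar> + \<bar>fu (fst w) (snd w) - fu (fst v) (snd v)\<bar>"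
        using norm_Pair_le[of "fr (fst w) (snd w) - fr (fst v) (snd v)" "fu (fst w) (snd w) - fu (fst v) (snd v)"] by simp
      then show ?thesis using c1[OF that] c2[OF that] by (simp add: distrib_right)
    qed
    have Tay: "\<bar>f (fst w) (snd w) - f (fst v) (snd v) - ?D v \<bullet> (w - v)\<bar> \<le> ?C * (norm (w - v))\<^sup>2"
      if vw: "norm v \<le> A" "norm w \<le> A" for v w
    proof -
      \<comment> \<open>Subtracting the linearization at \<open>v\<close> leaves the gradient
        \<open>?D z - ?D v\<close>, of size O(|w - v|) along the segment, so the mean value
        inequality yields the square.\<close>
      let ?g = "\<lambda>z. f (fst z) (snd z) - ?D v \<bullet> z"
      have "norm (?g w - ?g v) \<le> (?C * norm (w - v)) * norm (w - v)"
      proof (rule differentiable_bound[of "closed_segment v w"])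
        show "(?g has_derivative (\<lambda>h. ?D z \<bullet> h - ?D v \<bullet> h)) (at z within closed_segment v w)" for z
          by (intro derivative_intros d')
        show "onorm (\<lambda>h. ?D z \<bullet> h - ?D v \<bullet> h) \<le> ?C * norm (w - v)" if z: "z \<in> closed_segment v w" for z
        proof (rule onorm_bound)
          fix h :: "real \<times> real"
          have "norm z \<le> A"
            using z vw closed_segment_subset[of v "cball 0 A" w] by auto
          then have "norm (?D z - ?D v) \<le> ?C * norm (z - v)" using Lip vw by blast
          also have "\<dots> \<le> ?C * norm (w - v)"
            using segment_bound1[OF z] C1 C2 by (intro mult_left_mono) auto
          finally have "norm (?D z - ?D v) * norm h \<le> ?C * norm (w - v) * norm h"
            by (rule mult_right_mono) simp
          then show "norm (?D z \<bullet> h - ?D v \<bullet> h) \<le> ?C * norm (w - v) * norm h"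
            using Cauchy_Schwarz_ineq2[of "?D z - ?D v" h] by (simp only: inner_diff_left real_norm_def)
        qed (use C1 C2 in auto)
      qed auto
      then show ?thesis by (simp only: inner_diff_right real_norm_def power2_eq_square mult.assoc algebra_simps)
    qed
    show "\<exists>C. \<forall>v w :: real \<times> real. norm v \<le> A \<longrightarrow> norm w \<le> A \<longrightarrow>
       norm (?D w - ?D v) \<le> C * norm (w - v) \<and>
       \<bar>f (fst w) (snd w) - f (fst v) (snd v) - ?D v \<bullet> (w - v)\<bar> \<le> C * (norm (w - v))\<^sup>2"
      using Lip Tay by blast
  qed
qed

text \<open>\<open>?q\<close> embeds the plane as the coordinate plane of \<open>i\<close> and
  \<open>j\<close>, and \<open>?p\<close> is its adjoint. As the indices differ,
  \<open>?p (?q z) = z\<close>; hence \<open>?q\<close> preserves norms, and by duality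
  \<open>?p\<close> does not increase them.\<close>

lemma smooth2_c11_nth:
  fixes i j :: "'n::finite"
  assumes "smooth2 f" "i \<noteq> j" shows "c11 (\<lambda>v::real^'n. f (v $ i) (v $ j))"
proof -
  let ?p = "\<lambda>v::real^'n. (v $ i, v $ j)" and ?q = "\<lambda>z::real\<times>real. fst z *\<^sub>R axis i 1 + snd z *\<^sub>R axis j 1 :: real^'n"
  have adj: "?q z \<bullet> w = z \<bullet> ?p w" for z w
    by (simp add: inner_add_left inner_commute[of "axis _ _"] inner_axis inner_prod_def)
  have q2: "(norm (?q z))\<^sup>2 = (norm z)\<^sup>2" for z
  proof -
    have "?p (?q z) = z" using assms(2) by (auto simp: axis_def prod_eq_iff)
    then show ?thesis unfolding power2_norm_eq_inner adj by simp
  qed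
  have nq: "norm (?q z) \<le> norm z" for z using q2[of z] by (simp add: power2_eq_iff_nonneg)
  have np: "norm (?p w) \<le> norm w" for w
  proof -
    have "(norm (?p w))\<^sup>2 = ?q (?p w) \<bullet> w" by (simp only: adj power2_norm_eq_inner)
    also have "\<dots> \<le> norm (?q (?p w)) * norm w" by (rule norm_cauchy_schwarz)
    also have "\<dots> \<le> norm (?p w) * norm w" by (intro mult_right_mono nq) simp
    finally show ?thesis by (cases "norm (?p w) = 0") (auto simp: power2_eq_square)
  qed
  have lp: "linear ?p" by (auto intro!: linearI)
  have lq: "linear ?q" by (auto intro!: linearI simp: algebra_simps)
  show ?thesis
    using c11_compose_isometric[OF smooth2_c11_pair[OF assms(1)] lp adj lq np nq] by simp
qed

section \<open>Characteristics of a diagonal system\<close>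

definition state :: "('n::finite \<Rightarrow> real \<Rightarrow> real \<Rightarrow> real) \<Rightarrow> real \<Rightarrow> real \<Rightarrow> real ^ 'n" where
  "state W t x = (\<chi> i. W i t x)"

lemma state_nth [simp]: "state W t x $ i = W i t x"
  by (simp add: state_def)

text \<open>\<open>A\<close> bounds the data and their slopes, \<open>A + 1\<close> the unknowns
  during the whole time span. \<open>N\<close> converts componentwise bounds into Euclidean ones, so
  \<open>N * (A + 1)\<close> is the radius on which one constant \<open>C\<close> serves all speeds
  and sources. \<open>B\<close> bounds the slope of the unknowns: the slope \<open>A\<close> of the
  data times the Lipschitz constant 2 of the characteristics, plus 1 for the source. The 1 / 8 in
  \<open>small\<close> leaves room to absorb the errors that carry a factor
  \<open>T\<close>.\<close>

locale diagonal_cauchy_problem =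
  fixes lam G :: "'n::finite \<Rightarrow> real ^ 'n \<Rightarrow> real" and Dl DG :: "'n \<Rightarrow> real ^ 'n \<Rightarrow> real ^ 'n"
    and W0 W0' :: "'n \<Rightarrow> real \<Rightarrow> real" and A B C N T :: real
  assumes A: "A \<ge> 0" and C: "C \<ge> 0" and N: "N = real CARD('n)" and B: "B = 2 * A + 1"
    and T: "T > 0" and small: "T * C * N * (1 + B) * (A + 1) \<le> 1 / 8"
    and lam: "c11_with (lam i) (Dl i) (N * (A + 1)) C" and lam_cont: "continuous_on UNIV (lam i)"
    and G: "c11_with (G i) (DG i) (N * (A + 1)) C" and G_cont: "continuous_on UNIV (G i)"
    and W0: "\<bar>W0 i x\<bar> \<le> A" and W0_deriv: "(W0 i has_real_derivative W0' i x) (at x)"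
    and W0': "\<bar>W0' i x\<bar> \<le> A" and W0'_cont: "continuous_on UNIV (W0' i)"
begin

lemma N1: "N \<ge> 1" using N by (simp add: Suc_leI)

lemma small_consequences:
  "T * C * N * (1 + B) \<le> 1 / 8" "T * (C * N * B) \<le> 1 / 8" "T * C \<le> 1 / 8" "C * N * B \<ge> 0" "B \<ge> 1"
proof -
  show B1: "B \<ge> 1" using A B by simp
  then show "C * N * B \<ge> 0" using C N1 by simp
  have p: "T * C * N \<ge> 0" "T * C \<ge> 0" using T C N1 by auto
  have "T * C * N * (1 + B) * 1 \<le> T * C * N * (1 + B) * (A + 1)"
    using p B1 A by (intro mult_left_mono) auto
  then show 1: "T * C * N * (1 + B) \<le> 1 / 8" using small by simp
  have "T * C * N * B \<le> T * C * N * (1 + B)" using p by (intro mult_left_mono) auto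
  then have "T * C * N * B \<le> 1 / 8" using 1 by linarith
  then show "T * (C * N * B) \<le> 1 / 8" by (simp only: mult.assoc)
  have "T * C * 1 \<le> T * C * N" using p N1 by (intro mult_left_mono) auto
  also have "\<dots> * 1 \<le> T * C * N * (1 + B)" using p B1 by (intro mult_left_mono) auto
  finally show "T * C \<le> 1 / 8" using 1 by linarith
qed

lemma W0_lipschitz: "\<bar>W0 i x - W0 i y\<bar> \<le> A * \<bar>x - y\<bar>"
  using field_differentiable_bound[of UNIV "W0 i" "W0' i" A x y] W0_deriv W0' by auto

text \<open>Lipschitz bounds instead of continuous derivatives: every clause is a non-strict
  inequality between values and survives pointwise limits. In the time modulus,
  \<open>2 * A * C\<close> is the slope of the data times the displacement of the foot of the
  characteristic, and \<open>2 * C\<close> pays for the source.\<close>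

definition adm_W :: "('n \<Rightarrow> real \<Rightarrow> real \<Rightarrow> real) \<Rightarrow> bool" where
  "adm_W W \<longleftrightarrow> (\<forall>i t x. 0 \<le> t \<longrightarrow> t \<le> T \<longrightarrow> \<bar>W i t x\<bar> \<le> A + 1) \<and>
     (\<forall>i t x y. 0 \<le> t \<longrightarrow> t \<le> T \<longrightarrow> \<bar>W i t x - W i t y\<bar> \<le> B * \<bar>x - y\<bar>) \<and>
     (\<forall>i t t' x. 0 \<le> t \<longrightarrow> t \<le> t' \<longrightarrow> t' \<le> T \<longrightarrow> \<bar>W i t x - W i t' x\<bar> \<le> (2 * A * C + 2 * C) * (t' - t))"

text \<open>\<open>X i s t x\<close> is the position at time s of the i-th characteristic through
  (t, x). Moving the end time may cost twice the speed bound: once for the extra stretch, the rest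
  for the spatial shift it causes.\<close>

definition adm_X :: "('n \<Rightarrow> real \<Rightarrow> real \<Rightarrow> real \<Rightarrow> real) \<Rightarrow> bool" where
  "adm_X X \<longleftrightarrow>
     (\<forall>i s t x y. 0 \<le> s \<longrightarrow> s \<le> t \<longrightarrow> t \<le> T \<longrightarrow> \<bar>X i s t x - X i s t y\<bar> \<le> 2 * \<bar>x - y\<bar>) \<and>
     (\<forall>i s s' t x. 0 \<le> s \<longrightarrow> s \<le> s' \<longrightarrow> s' \<le> t \<longrightarrow> t \<le> T \<longrightarrow> \<bar>X i s t x - X i s' t x\<bar> \<le> C * (s' - s)) \<and>
     (\<forall>i s t t' x. 0 \<le> s \<longrightarrow> s \<le> t \<longrightarrow> t \<le> t' \<longrightarrow> t' \<le> T \<longrightarrow> \<bar>X i s t x - X i s t' x\<bar> \<le> 2 * C * (t' - t))"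

lemma adm_WD:
  assumes "adm_W W" "0 \<le> t" "t \<le> T"
  shows "\<bar>W i t x\<bar> \<le> A + 1" "\<bar>W i t x - W i t y\<bar> \<le> B * \<bar>x - y\<bar>"
    "t \<le> t' \<Longrightarrow> t' \<le> T \<Longrightarrow> \<bar>W i t x - W i t' x\<bar> \<le> (2 * A * C + 2 * C) * (t' - t)"
  using assms unfolding adm_W_def by blast+

lemma adm_XD:
  assumes "adm_X X" "0 \<le> s"
  shows "s \<le> t \<Longrightarrow> t \<le> T \<Longrightarrow> \<bar>X i s t x - X i s t y\<bar> \<le> 2 * \<bar>x - y\<bar>"
    "s \<le> s' \<Longrightarrow> s' \<le> t \<Longrightarrow> t \<le> T \<Longrightarrow> \<bar>X i s t x - X i s' t x\<bar> \<le> C * (s' - s)"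
    "s \<le> t \<Longrightarrow> t \<le> t' \<Longrightarrow> t' \<le> T \<Longrightarrow> \<bar>X i s t x - X i s t' x\<bar> \<le> 2 * C * (t' - t)"
  using assms unfolding adm_X_def by blast+

lemma state_norm: "adm_W W \<Longrightarrow> 0 \<le> t \<Longrightarrow> t \<le> T \<Longrightarrow> norm (state W t x) \<le> N * (A + 1)"
  unfolding N by (rule vec_norm_le_of_components) (simp add: adm_WD)

lemma state_diff:
  assumes "adm_W W" "0 \<le> t" "t \<le> T"
  shows "norm (state W t x - state W t y) \<le> N * B * \<bar>x - y\<bar>"
  using vec_norm_le_of_components[of "state W t x - state W t y" "B * \<bar>x - y\<bar>"] adm_WD[OF assms]
  by (simp add: N)

lemma state_diff2:
  assumes "adm_W W" "0 \<le> t" "t \<le> T" "\<And>i. \<bar>W i t y - W' i t y\<bar> \<le> d"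
  shows "norm (state W t x - state W' t y) \<le> N * (d + B * \<bar>x - y\<bar>)"
  unfolding N
proof (rule vec_norm_le_of_components)
  fix i
  show "\<bar>(state W t x - state W' t y) $ i\<bar> \<le> d + B * \<bar>x - y\<bar>"
    using assms(4)[of i] adm_WD(2)[OF assms(1-3), of i x y] by simp
qed

text \<open>Speeds and sources obey the same estimates along characteristics, so both are handled as
  instances of one notion.\<close>

definition coeff :: "(real ^ 'n \<Rightarrow> real) \<Rightarrow> (real ^ 'n \<Rightarrow> real ^ 'n) \<Rightarrow> bool" where
  "coeff F D \<longleftrightarrow> c11_with F D (N * (A + 1)) C \<and> continuous_on UNIV F"

lemma coeff_lam: "coeff (lam i) (Dl i)" and coeff_G: "coeff (G i) (DG i)"
  using lam lam_cont G G_cont by (auto simp: coeff_def)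

lemma coeff_bound:
  assumes "coeff F D" "adm_W W" "0 \<le> t" "t \<le> T"
  shows "\<bar>F (state W t x)\<bar> \<le> C"
  using assms state_norm[OF assms(2-4)] unfolding coeff_def by (blast dest: c11_withD(1))

lemma coeff_diff2:
  assumes "coeff F D" "adm_W W" "adm_W W'" "0 \<le> t" "t \<le> T" "\<And>i. \<bar>W i t y - W' i t y\<bar> \<le> d"
  shows "\<bar>F (state W t x) - F (state W' t y)\<bar> \<le> C * N * (d + B * \<bar>x - y\<bar>)"
proof -
  have "\<bar>F (state W t x) - F (state W' t y)\<bar> \<le> C * norm (state W t x - state W' t y)"
    using assms state_norm unfolding coeff_def by (blast intro: c11_withD(2))
  also have "\<dots> \<le> C * (N * (d + B * \<bar>x - y\<bar>))"
    using state_diff2[OF assms(2,4,5), of y W' d x] assms(6) C by (simp add: mult_left_mono)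
  finally show ?thesis by (simp add: mult.assoc)
qed

lemma coeff_diff:
  assumes "coeff F D" "adm_W W" "0 \<le> t" "t \<le> T"
  shows "\<bar>F (state W t x) - F (state W t y)\<bar> \<le> C * N * B * \<bar>x - y\<bar>"
  using coeff_diff2[OF assms(1,2,2,3,4), of y 0 x] by (simp add: mult.assoc)

lemma adm_W_continuous:
  assumes "adm_W W" shows "continuous_on ({0..T} \<times> UNIV) (\<lambda>(t,x). W i t x)"
proof -
  let ?M = "2 * A * C + 2 * C"
  have M: "?M \<ge> 0" using A C by simp
  have lip: "\<bar>W i t x - W i t' x'\<bar> \<le> B * \<bar>x - x'\<bar> + ?M * \<bar>t - t'\<bar>" if t: "t \<in> {0..T}" "t' \<in> {0..T}" for t t' x x'
  proof -
    have "\<bar>W i t x' - W i t' x'\<bar> \<le> ?M * \<bar>t - t'\<bar>"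
    proof (cases "t \<le> t'")
      case True then show ?thesis using adm_WD(3)[OF assms, of t t' i x'] t by simp
    next
      case False
      then show ?thesis using adm_WD(3)[OF assms, of t' t i x'] t by (simp add: abs_minus_commute)
    qed
    moreover have "\<bar>W i t x - W i t x'\<bar> \<le> B * \<bar>x - x'\<bar>" using adm_WD(2)[OF assms] t by simp
    ultimately show ?thesis by linarith
  qed
  have "(B + ?M)-lipschitz_on ({0..T} \<times> UNIV) (\<lambda>(t,x). W i t x)"
  proof (rule lipschitz_onI)
    fix p q :: "real \<times> real" assume pq: "p \<in> {0..T} \<times> UNIV" "q \<in> {0..T} \<times> UNIV"
    obtain t x t' x' where p: "p = (t,x)" "q = (t',x')" by (cases p, cases q) auto
    have "\<bar>x - x'\<bar> \<le> dist p q" "\<bar>t - t'\<bar> \<le> dist p q"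
      using p dist_snd_le[of p q] dist_fst_le[of p q] by (auto simp: dist_real_def)
    then have "B * \<bar>x - x'\<bar> + ?M * \<bar>t - t'\<bar> \<le> B * dist p q + ?M * dist p q"
      using M small_consequences(5) by (intro add_mono mult_left_mono) auto
    then show "dist (case p of (t,x) \<Rightarrow> W i t x) (case q of (t,x) \<Rightarrow> W i t x) \<le> (B + ?M) * dist p q"
      using lip[of t t' x x'] pq p by (simp add: dist_real_def distrib_right)
  qed (use M small_consequences(5) in auto)
  then show ?thesis by (rule lipschitz_on_continuous_on)
qed

lemma coeff_continuous:
  assumes "coeff F D" "adm_W W" "continuous_on S y" "S \<subseteq> {0..T}"
  shows "continuous_on S (\<lambda>s. F (state W s (y s)))"
proof (rule continuous_on_compose2[of UNIV F])
  show "continuous_on UNIV F" using assms by (simp add: coeff_def)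
  have "continuous_on S (\<lambda>s. W i s (y s))" for i
  proof -
    have "continuous_on S (\<lambda>s. (s, y s))" using assms(3) by (intro continuous_intros)
    moreover have "(\<lambda>s. (s, y s)) ` S \<subseteq> {0..T} \<times> UNIV" using assms(4) by auto
    ultimately show ?thesis
      using continuous_on_compose2[OF adm_W_continuous[OF assms(2), of i], of S "\<lambda>s. (s, y s)"] by simp
  qed
  then show "continuous_on S (\<lambda>s. state W s (y s))"
    unfolding state_def by (intro continuous_on_vec_lambda)
qed auto

lemma adm_X_continuous:
  assumes "adm_X X" "t \<le> T" shows "continuous_on {0..t} (\<lambda>s. X i s t x)"
proof -
  have "C-lipschitz_on {0..t} (\<lambda>s. X i s t x)"
  proof (rule lipschitz_onI)
    fix s s' assume "s \<in> {0..t}" "s' \<in> {0..t}"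
    then show "dist (X i s t x) (X i s' t x) \<le> C * dist s s'"
      using adm_XD(2)[OF assms(1), of s s' t i x] adm_XD(2)[OF assms(1), of s' s t i x] assms(2)
      by (cases "s \<le> s'") (auto simp: dist_real_def abs_minus_commute)
  qed (rule C)
  then show ?thesis by (rule lipschitz_on_continuous_on)
qed

lemma along_continuous:
  assumes "coeff F D" "adm_W W" "adm_X X" "t \<le> T" "0 \<le> s" "t' \<le> t"
  shows "continuous_on {s..t'} (\<lambda>s. F (state W s (X i s t x)))"
  by (rule coeff_continuous[OF assms(1,2)])
     (use assms continuous_on_subset[OF adm_X_continuous[OF assms(3,4)]] in auto)

text \<open>The characteristics and the unknowns are constructed together as one fixed point; feeding
  the updated characteristics into \<open>FW\<close> makes the contraction factor proportional to \<open>T\<close>.\<close>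

definition FX where
  "FX X W i s t x = x - integral {s..t} (\<lambda>r. lam i (state W r (X i r t x)))"

definition FW where
  "FW X W i t x = W0 i (X i 0 t x) + integral {0..t} (\<lambda>r. G i (state W r (X i r t x)))"

text \<open>One estimate for three purposes: equal unknowns and end times give Lipschitz bounds in
  x, different end times the modulus in t, different unknowns the contraction. The factor
  \<open>T\<close> is a bound for the length of the time interval.\<close>

lemma along_diff:
  assumes F: "coeff F D" and W: "adm_W W" "adm_W W'" and X: "adm_X X" "adm_X X'"
    and t: "0 \<le> s" "s \<le> r" "r \<le> t" "t \<le> T" "r \<le> t'" "t' \<le> T"
    and dW: "\<And>i t x. 0 \<le> t \<Longrightarrow> t \<le> T \<Longrightarrow> \<bar>W i t x - W' i t x\<bar> \<le> d"
    and dX: "\<And>q. s \<le> q \<Longrightarrow> q \<le> r \<Longrightarrow> \<bar>X i q t x - X' i q t' y\<bar> \<le> d'"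
  shows "\<bar>integral {s..r} (\<lambda>q. F (state W q (X i q t x))) - integral {s..r} (\<lambda>q. F (state W' q (X' i q t' y)))\<bar>
      \<le> T * C * N * (d + B * d')"
proof -
  have dd: "0 \<le> d" using dW[of 0] T by (meson abs_ge_zero order_trans less_imp_le order_refl)
  have dd': "0 \<le> d'" using dX[of s] t by (meson abs_ge_zero order_trans order_refl)
  have K: "C * N * (d + B * d') \<ge> 0" using C N1 dd dd' small_consequences(5) by simp
  have "\<bar>integral {s..r} (\<lambda>q. F (state W q (X i q t x))) - integral {s..r} (\<lambda>q. F (state W' q (X' i q t' y)))\<bar>
     \<le> C * N * (d + B * d') * (r - s)"
  proof (rule integral_diff_bound)
    show "continuous_on {s..r} (\<lambda>q. F (state W q (X i q t x)))"
      "continuous_on {s..r} (\<lambda>q. F (state W' q (X' i q t' y)))"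
      using along_continuous[OF F W(1) X(1)] along_continuous[OF F W(2) X(2)] t by auto
    fix q assume q: "q \<in> {s..r}"
    have "\<bar>F (state W q (X i q t x)) - F (state W' q (X' i q t' y))\<bar> \<le> C * N * (d + B * \<bar>X i q t x - X' i q t' y\<bar>)"
      by (rule coeff_diff2[OF F W]) (use q t dW in auto)
    also have "\<dots> \<le> C * N * (d + B * d')"
      using dX[of q] q C N1 small_consequences(5) by (intro mult_left_mono add_left_mono) auto
    finally show "\<bar>F (state W q (X i q t x)) - F (state W' q (X' i q t' y))\<bar> \<le> C * N * (d + B * d')" .
  qed (use t in auto)
  also have "\<dots> \<le> C * N * (d + B * d') * T" using K t by (intro mult_left_mono) auto
  finally show ?thesis by (simp add: mult_ac)
qed

lemma along_bound:
  assumes F: "coeff F D" and W: "adm_W W" and X: "adm_X X" and t: "0 \<le> s" "s \<le> r" "r \<le> t" "t \<le> T"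
  shows "\<bar>integral {s..r} (\<lambda>q. F (state W q (X i q t x)))\<bar> \<le> C * (r - s)"
  by (rule integral_abs_bound[OF along_continuous[OF F W X]]) (use t coeff_bound[OF F W] in auto)

lemma along_combine:
  assumes F: "coeff F D" and W: "adm_W W" and X: "adm_X X" and t: "0 \<le> s" "s \<le> r" "r \<le> r'" "r' \<le> t" "t \<le> T"
  shows "integral {s..r'} (\<lambda>q. F (state W q (X i q t x))) =
     integral {s..r} (\<lambda>q. F (state W q (X i q t x))) + integral {r..r'} (\<lambda>q. F (state W q (X i q t x)))"
  by (rule Henstock_Kurzweil_Integration.integral_combine[symmetric])
     (use t along_continuous[OF F W X] in \<open>auto intro!: integrable_continuous_real\<close>)

text \<open>By smallness \<open>T * (C * N * B)\<close> is at most 1 / 8, so a deviation of the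
  characteristics returns as an eighth of itself. This keeps the Lipschitz constant 2 of
  \<open>adm_X\<close> stable, as 1 + 2 / 8 \<le> 2.\<close>

lemma along_diff_same:
  assumes F: "coeff F D" and W: "adm_W W" and X: "adm_X X"
    and t: "0 \<le> s" "s \<le> r" "r \<le> t" "t \<le> T" "r \<le> t'" "t' \<le> T"
    and dX: "\<And>q. s \<le> q \<Longrightarrow> q \<le> r \<Longrightarrow> \<bar>X i q t x - X i q t' y\<bar> \<le> d'"
  shows "\<bar>integral {s..r} (\<lambda>q. F (state W q (X i q t x))) - integral {s..r} (\<lambda>q. F (state W q (X i q t' y)))\<bar>
      \<le> d' / 8"
proof -
  have dd': "0 \<le> d'" using dX[of s] t by (meson abs_ge_zero order_trans order_refl)
  have "T * C * N * (0 + B * d') \<le> 1/8 * d'"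
    using mult_right_mono[OF small_consequences(2) dd'] by (simp add: mult_ac)
  then show ?thesis using along_diff[OF F W W X X t, of 0 i x y d'] dX by auto
qed

lemma adm_FX:
  assumes W: "adm_W W" and X: "adm_X X"
  shows "adm_X (FX X W)"
  unfolding adm_X_def
proof (intro conjI allI impI)
  fix i s t x y assume t: "(0::real) \<le> s" "s \<le> t" "t \<le> T"
  have "\<bar>integral {s..t} (\<lambda>q. lam i (state W q (X i q t x))) - integral {s..t} (\<lambda>q. lam i (state W q (X i q t y)))\<bar> \<le> 2 * \<bar>x - y\<bar> / 8"
    by (rule along_diff_same[OF coeff_lam W X]) (use t adm_XD(1)[OF X] in auto)
  moreover have "\<bar>x - p - (y - q)\<bar> \<le> 2 * \<bar>x - y\<bar>" if "\<bar>p - q\<bar> \<le> 2 * \<bar>x - y\<bar> / 8" for p q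
    using that by argo
  ultimately show "\<bar>FX X W i s t x - FX X W i s t y\<bar> \<le> 2 * \<bar>x - y\<bar>" unfolding FX_def by blast
next
  fix i s s' t x assume t: "(0::real) \<le> s" "s \<le> s'" "s' \<le> t" "t \<le> T"
  show "\<bar>FX X W i s t x - FX X W i s' t x\<bar> \<le> C * (s' - s)"
    using along_combine[OF coeff_lam W X, of s s' t t i i x] along_bound[OF coeff_lam W X, of s s' t i i x] t
    unfolding FX_def by auto
next
  fix i s t t' x assume t: "(0::real) \<le> s" "s \<le> t" "t \<le> t'" "t' \<le> T"
  have h1: "\<bar>integral {s..t} (\<lambda>q. lam i (state W q (X i q t x))) - integral {s..t} (\<lambda>q. lam i (state W q (X i q t' x)))\<bar> \<le> 2 * C * (t' - t) / 8"
    by (rule along_diff_same[OF coeff_lam W X]) (use t adm_XD(3)[OF X] in auto)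
  \<comment> \<open>Up to time \<open>t\<close> both integrals run over the same interval and differ
    through the curves only; the stretch from \<open>t\<close> to \<open>t'\<close> costs at most
    its length times \<open>C\<close>.\<close>
  have h2: "integral {s..t'} (\<lambda>q. lam i (state W q (X i q t' x))) =
     integral {s..t} (\<lambda>q. lam i (state W q (X i q t' x))) + integral {t..t'} (\<lambda>q. lam i (state W q (X i q t' x)))"
    by (rule along_combine[OF coeff_lam W X]) (use t in auto)
  have h3: "\<bar>integral {t..t'} (\<lambda>q. lam i (state W q (X i q t' x)))\<bar> \<le> C * (t' - t)"
    by (rule along_bound[OF coeff_lam W X]) (use t in auto)
  have h4: "C * (t' - t) \<ge> 0" using C t by simp
  have gen: "\<bar>x - p - (x - (q + r))\<bar> \<le> 2 * C * (t' - t)"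
    if "\<bar>p - q\<bar> \<le> 2 * C * (t' - t) / 8" "\<bar>r\<bar> \<le> C * (t' - t)" "C * (t' - t) \<ge> 0" for p q r
    using that by linarith
  show "\<bar>FX X W i s t x - FX X W i s t' x\<bar> \<le> 2 * C * (t' - t)" using gen[OF h1 h3 h4] unfolding FX_def h2 .
qed

lemma adm_FW:
  assumes W: "adm_W W" and X: "adm_X X"
  shows "adm_W (FW X W)"
  unfolding adm_W_def
proof (intro conjI allI impI)
  fix i t x assume t: "(0::real) \<le> t" "t \<le> T"
  have "\<bar>integral {0..t} (\<lambda>q. G i (state W q (X i q t x)))\<bar> \<le> C * (t - 0)"
    by (rule along_bound[OF coeff_G W X]) (use t in auto)
  also have "\<dots> \<le> C * T" using t C by (intro mult_left_mono) auto
  also have "\<dots> \<le> 1" using small_consequences(3) by (simp add: mult.commute)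
  finally show "\<bar>FW X W i t x\<bar> \<le> A + 1" using W0[of i "X i 0 t x"] unfolding FW_def by linarith
next
  fix i t x y assume t: "(0::real) \<le> t" "t \<le> T"
  have "\<bar>integral {0..t} (\<lambda>q. G i (state W q (X i q t x))) - integral {0..t} (\<lambda>q. G i (state W q (X i q t y)))\<bar> \<le> 2 * \<bar>x - y\<bar> / 8"
    by (rule along_diff_same[OF coeff_G W X]) (use t adm_XD(1)[OF X] in auto)
  moreover have "\<bar>W0 i (X i 0 t x) - W0 i (X i 0 t y)\<bar> \<le> A * (2 * \<bar>x - y\<bar>)"
    using order_trans[OF W0_lipschitz mult_left_mono[OF adm_XD(1)[OF X] A]] t by auto
  moreover have "\<bar>a + p - (b + q)\<bar> \<le> B * \<bar>x - y\<bar>"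
    if "\<bar>p - q\<bar> \<le> 2 * \<bar>x - y\<bar> / 8" "\<bar>a - b\<bar> \<le> A * (2 * \<bar>x - y\<bar>)" for a b p q
    using that unfolding B distrib_right mult.assoc mult.left_commute[of A] by argo
  ultimately show "\<bar>FW X W i t x - FW X W i t y\<bar> \<le> B * \<bar>x - y\<bar>"
    unfolding FW_def by blast
next
  fix i t t' x assume t: "(0::real) \<le> t" "t \<le> t'" "t' \<le> T"
  have h1: "\<bar>integral {0..t} (\<lambda>q. G i (state W q (X i q t x))) - integral {0..t} (\<lambda>q. G i (state W q (X i q t' x)))\<bar> \<le> 2 * C * (t' - t) / 8"
    by (rule along_diff_same[OF coeff_G W X]) (use t adm_XD(3)[OF X] in auto)
  have h2: "integral {0..t'} (\<lambda>q. G i (state W q (X i q t' x))) =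
     integral {0..t} (\<lambda>q. G i (state W q (X i q t' x))) + integral {t..t'} (\<lambda>q. G i (state W q (X i q t' x)))"
    by (rule along_combine[OF coeff_G W X]) (use t in auto)
  have h3: "\<bar>integral {t..t'} (\<lambda>q. G i (state W q (X i q t' x)))\<bar> \<le> C * (t' - t)"
    by (rule along_bound[OF coeff_G W X]) (use t in auto)
  have h5: "\<bar>W0 i (X i 0 t x) - W0 i (X i 0 t' x)\<bar> \<le> A * (2 * C * (t' - t))"
    using order_trans[OF W0_lipschitz mult_left_mono[OF adm_XD(3)[OF X] A]] t by auto
  have h4: "C * (t' - t) \<ge> 0" using C t by simp
  have gen: "\<bar>a + p - (b + (q + r))\<bar> \<le> (2 * A * C + 2 * C) * (t' - t)"
    if "\<bar>p - q\<bar> \<le> 2 * C * (t' - t) / 8" "\<bar>r\<bar> \<le> C * (t' - t)" "C * (t' - t) \<ge> 0"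
       "\<bar>a - b\<bar> \<le> A * (2 * C * (t' - t))" for a b p q r
  proof -
    have "(2 * A * C + 2 * C) * (t' - t) = A * (2 * C * (t' - t)) + 2 * (C * (t' - t))" by (simp add: algebra_simps)
    then show ?thesis using that by linarith
  qed
  show "\<bar>FW X W i t x - FW X W i t' x\<bar> \<le> (2 * A * C + 2 * C) * (t' - t)"
    using gen[OF h1 h3 h4 h5] unfolding FW_def h2 .
qed

lemma FX_contraction:
  assumes W: "adm_W W" "adm_W W'" and X: "adm_X X" "adm_X X'" and d: "d \<ge> 0"
    and dW: "\<And>i t x. 0 \<le> t \<Longrightarrow> t \<le> T \<Longrightarrow> \<bar>W i t x - W' i t x\<bar> \<le> d"
    and dX: "\<And>i s t x. 0 \<le> s \<Longrightarrow> s \<le> t \<Longrightarrow> t \<le> T \<Longrightarrow> \<bar>X i s t x - X' i s t x\<bar> \<le> d"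
    and t: "0 \<le> s" "s \<le> t" "t \<le> T"
  shows "\<bar>FX X W i s t x - FX X' W' i s t x\<bar> \<le> T * C * N * (1 + B) * d"
proof -
  have h: "\<bar>integral {s..t} (\<lambda>q. lam i (state W q (X i q t x))) - integral {s..t} (\<lambda>q. lam i (state W' q (X' i q t x)))\<bar> \<le> T * C * N * (d + B * d)"
    by (rule along_diff[OF coeff_lam W X]) (use t dW dX in auto)
  have gen: "\<bar>x - p - (x - q)\<bar> \<le> T * C * N * (1 + B) * d" if "\<bar>p - q\<bar> \<le> T * C * N * (d + B * d)" for p q
    using that by (simp add: algebra_simps)
  show ?thesis unfolding FX_def by (rule gen[OF h])
qed

lemma FW_contraction:
  assumes W: "adm_W W" "adm_W W'" and X: "adm_X X" "adm_X X'" and d: "d \<ge> 0"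
    and dW: "\<And>i t x. 0 \<le> t \<Longrightarrow> t \<le> T \<Longrightarrow> \<bar>W i t x - W' i t x\<bar> \<le> d"
    and dX: "\<And>i s t x. 0 \<le> s \<Longrightarrow> s \<le> t \<Longrightarrow> t \<le> T \<Longrightarrow> \<bar>X i s t x - X' i s t x\<bar> \<le> T * C * N * (1 + B) * d"
    and t: "0 \<le> t" "t \<le> T"
  shows "\<bar>FW X W i t x - FW X' W' i t x\<bar> \<le> d / 2"
proof -
  let ?k = "T * C * N * (1 + B)"
  have kd: "?k * d \<le> d" using mult_right_mono[OF small_consequences(1) d] d by simp
  have "\<bar>integral {0..t} (\<lambda>q. G i (state W q (X i q t x))) - integral {0..t} (\<lambda>q. G i (state W' q (X' i q t x)))\<bar> \<le> T * C * N * (d + B * d)"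
    by (rule along_diff[OF coeff_G W X]) (use t dW order_trans[OF dX kd] in auto)
  moreover have "\<bar>W0 i (X i 0 t x) - W0 i (X' i 0 t x)\<bar> \<le> A * (?k * d)"
    using order_trans[OF W0_lipschitz mult_left_mono[OF dX A]] t by auto
  \<comment> \<open>The source contributes \<open>?k * d\<close> and the data
    \<open>A * (?k * d)\<close>; this is the origin of the factor \<open>A + 1\<close> in
    \<open>small\<close>.\<close>
  moreover have "T * C * N * (d + B * d) + A * (?k * d) = ?k * (A + 1) * d" by (simp add: algebra_simps)
  moreover have "?k * (A + 1) * d \<le> 1 / 8 * d" by (rule mult_right_mono[OF small d])
  ultimately show ?thesis unfolding FW_def using d by linarith
qed

lemma adm_start: "adm_X (\<lambda>i s t x. x)" "adm_W (\<lambda>i t x. W0 i x)"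
proof -
  show "adm_X (\<lambda>i s t x. x)" using C by (auto simp: adm_X_def)
  have 1: "\<bar>W0 i x\<bar> \<le> A + 1" for i x using W0[of i x] by linarith
  have 2: "\<bar>W0 i x - W0 i y\<bar> \<le> B * \<bar>x - y\<bar>" for i x y
    by (rule order_trans[OF W0_lipschitz]) (use A B in \<open>auto intro!: mult_right_mono\<close>)
  show "adm_W (\<lambda>i t x. W0 i x)" using 1 2 A C by (auto simp: adm_W_def)
qed

lemma fixpoint_exists:
  "\<exists>X W. adm_X X \<and> adm_W W \<and>
    (\<forall>i s t x. 0 \<le> s \<longrightarrow> s \<le> t \<longrightarrow> t \<le> T \<longrightarrow> X i s t x = FX X W i s t x) \<and>
    (\<forall>i t x. 0 \<le> t \<longrightarrow> t \<le> T \<longrightarrow> W i t x = FW X W i t x)"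
proof -
  \<comment> \<open>Characteristics and unknowns are packed into one real function on a sum type, so
    that \<open>contraction_fixpoint\<close> iterates both at once. \<open>D\<close> keeps ordered
    times within the time span, where \<open>FX\<close> and \<open>FW\<close> are
    controlled.\<close>
  let ?X = "\<lambda>f i s t x. f (Inl (i, s, t, x) :: ('n \<times> real \<times> real \<times> real) + ('n \<times> real \<times> real)) :: real"
  let ?W = "\<lambda>f i t x. f (Inr (i, t, x) :: ('n \<times> real \<times> real \<times> real) + ('n \<times> real \<times> real)) :: real"
  define F where "F f = case_sum (\<lambda>(i,s,t,x). FX (?X f) (?W f) i s t x) (\<lambda>(i,t,x). FW (FX (?X f) (?W f)) (?W f) i t x)" for f
  define D :: "(('n \<times> real \<times> real \<times> real) + ('n \<times> real \<times> real)) set"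
    where "D = {Inl (i,s,t,x) | i s t x. 0 \<le> s \<and> s \<le> t \<and> t \<le> T} \<union> {Inr (i,t,x) | i t x. 0 \<le> t \<and> t \<le> T}"
  define S where "S f \<longleftrightarrow> adm_X (?X f) \<and> adm_W (?W f)" for f
  define f0 where "f0 = case_sum (\<lambda>(i::'n,s::real,t::real,x::real). x) (\<lambda>(i::'n,t::real,x::real). W0 i x)"
  have DI: "Inl (i,s,t,x) \<in> D" if "0 \<le> s" "s \<le> t" "t \<le> T" for i s t x using that by (auto simp: D_def)
  have DI2: "Inr (i,t,x) \<in> D" if "0 \<le> t" "t \<le> T" for i t x using that by (auto simp: D_def)
  have FXeq: "?X (F f) = FX (?X f) (?W f)" for f by (intro ext) (simp add: F_def)
  have FWeq: "?W (F f) = FW (FX (?X f) (?W f)) (?W f)" for f by (intro ext) (simp add: F_def)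
  have SFX: "adm_X (FX (?X f) (?W f))" if "S f" for f using that adm_FX unfolding S_def by blast
  have "\<exists>f. S f \<and> (\<forall>z\<in>D. F f z = f z)"
  proof (rule contraction_fixpoint[of S f0 F D "A * C * T + 2 * A + C * T + C * T + 1"])
    show "S f0" using adm_start by (simp add: S_def f0_def)
    show "S (F f)" if "S f" for f
      using adm_FW[OF _ SFX[OF that], of "?W f"] SFX[OF that] that unfolding S_def FXeq FWeq by blast
  next
    fix f g d z assume S: "S f" "S g" and d: "\<And>z. z \<in> D \<Longrightarrow> \<bar>f z - g z\<bar> \<le> d" and z: "z \<in> D"
    have d0: "d \<ge> 0" using d[OF z] by linarith
    have adm: "adm_W (?W f)" "adm_W (?W g)" "adm_X (?X f)" "adm_X (?X g)" using S by (auto simp: S_def)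
    have X: "\<bar>FX (?X f) (?W f) i s t x - FX (?X g) (?W g) i s t x\<bar> \<le> T * C * N * (1 + B) * d"
      if "0 \<le> s" "s \<le> t" "t \<le> T" for i s t x
      by (rule FX_contraction[OF adm d0]) (use that d DI DI2 in auto)
    from z consider i s t x where "z = Inl (i,s,t,x)" "0 \<le> s" "s \<le> t" "t \<le> T"
      | i t x where "z = Inr (i,t,x)" "0 \<le> t" "t \<le> T" by (auto simp: D_def)
    then show "\<bar>F f z - F g z\<bar> \<le> d / 2"
    proof cases
      case 1
      have "T * C * N * (1 + B) * d \<le> 1/8 * d" by (rule mult_right_mono[OF small_consequences(1) d0])
      then show ?thesis using X[of s t i x] 1 d0 by (simp add: F_def)
    next
      case 2
      have "\<bar>FW (FX (?X f) (?W f)) (?W f) i t x - FW (FX (?X g) (?W g)) (?W g) i t x\<bar> \<le> d / 2"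
        by (rule FW_contraction[OF adm(1,2) SFX[OF S(1)] SFX[OF S(2)] d0]) (use 2 d DI2 X in auto)
      then show ?thesis using 2 by (simp add: F_def)
    qed
  next
    fix z assume z: "z \<in> D"
    have S0: "S f0" using adm_start by (simp add: S_def f0_def)
    have adm: "adm_W (?W f0)" "adm_X (?X f0)" "adm_X (FX (?X f0) (?W f0))" using S0 SFX by (auto simp: S_def)
    have ac: "A * C * T \<ge> 0" "C * T \<ge> 0" using A C T by auto
    from z consider i s t x where "z = Inl (i,s,t,x)" "0 \<le> s" "s \<le> t" "t \<le> T"
      | i t x where "z = Inr (i,t,x)" "0 \<le> t" "t \<le> T" by (auto simp: D_def)
    then show "\<bar>F f0 z - f0 z\<bar> \<le> A * C * T + 2 * A + C * T + C * T + 1"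
    proof cases
      case 1
      have "C * (t - s) \<le> C * T" using 1 C by (intro mult_left_mono) auto
      moreover have "\<bar>integral {s..t} (\<lambda>q. lam i (state (?W f0) q (?X f0 i q t x)))\<bar> \<le> C * (t - s)"
        by (rule along_bound[OF coeff_lam adm(1,2)]) (use 1 in auto)
      ultimately have "\<bar>FX (?X f0) (?W f0) i s t x - x\<bar> \<le> C * T" unfolding FX_def by linarith
      moreover have "F f0 z - f0 z = FX (?X f0) (?W f0) i s t x - x" using 1 by (simp add: F_def f0_def)
      ultimately show ?thesis using ac A by linarith
    next
      case 2
      have "\<bar>FW (FX (?X f0) (?W f0)) (?W f0) i t x\<bar> \<le> A + 1"
        using adm_WD(1)[OF adm_FW[OF adm(1,3)]] 2 by blast
      moreover have "\<bar>f0 z\<bar> \<le> A" using 2 W0 by (simp add: f0_def)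
      moreover have "F f0 z = FW (FX (?X f0) (?W f0)) (?W f0) i t x" using 2 by (simp add: F_def)
      ultimately show ?thesis using ac by linarith
    qed
  next
    fix fs :: "nat \<Rightarrow> _" and f assume Sn: "\<And>n. S (fs n)" and lim: "\<And>z. z \<in> D \<Longrightarrow> (\<lambda>n. fs n z) \<longlonglongrightarrow> f z"
    have ad: "adm_X (?X (fs n))" "adm_W (?W (fs n))" for n using Sn by (auto simp: S_def)
    note lX = lim[OF DI] and lW = lim[OF DI2]
    have "adm_X (?X f)" unfolding adm_X_def
    proof (intro conjI allI impI)
      fix i s t x y assume t: "(0::real) \<le> s" "s \<le> t" "t \<le> T"
      show "\<bar>?X f i s t x - ?X f i s t y\<bar> \<le> 2 * \<bar>x - y\<bar>"
        by (rule tendsto_upperbound[OF tendsto_rabs[OF tendsto_diff[OF lX lX]]])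
           (use t adm_XD(1)[OF ad(1)] in \<open>auto intro!: always_eventually\<close>)
    next
      fix i s s' t x assume t: "(0::real) \<le> s" "s \<le> s'" "s' \<le> t" "t \<le> T"
      show "\<bar>?X f i s t x - ?X f i s' t x\<bar> \<le> C * (s' - s)"
        by (rule tendsto_upperbound[OF tendsto_rabs[OF tendsto_diff[OF lX lX]]])
           (use t adm_XD(2)[OF ad(1)] in \<open>auto intro!: always_eventually\<close>)
    next
      fix i s t t' x assume t: "(0::real) \<le> s" "s \<le> t" "t \<le> t'" "t' \<le> T"
      show "\<bar>?X f i s t x - ?X f i s t' x\<bar> \<le> 2 * C * (t' - t)"
        by (rule tendsto_upperbound[OF tendsto_rabs[OF tendsto_diff[OF lX lX]]])
           (use t adm_XD(3)[OF ad(1)] in \<open>auto intro!: always_eventually\<close>)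
    qed
    moreover have "adm_W (?W f)" unfolding adm_W_def
    proof (intro conjI allI impI)
      fix i t x assume t: "(0::real) \<le> t" "t \<le> T"
      show "\<bar>?W f i t x\<bar> \<le> A + 1"
        by (rule tendsto_upperbound[OF tendsto_rabs[OF lW]])
           (use t adm_WD(1)[OF ad(2)] in \<open>auto intro!: always_eventually\<close>)
    next
      fix i t x y assume t: "(0::real) \<le> t" "t \<le> T"
      show "\<bar>?W f i t x - ?W f i t y\<bar> \<le> B * \<bar>x - y\<bar>"
        by (rule tendsto_upperbound[OF tendsto_rabs[OF tendsto_diff[OF lW lW]]])
           (use t adm_WD(2)[OF ad(2)] in \<open>auto intro!: always_eventually\<close>)
    next
      fix i t t' x assume t: "(0::real) \<le> t" "t \<le> t'" "t' \<le> T"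
      show "\<bar>?W f i t x - ?W f i t' x\<bar> \<le> (2 * A * C + 2 * C) * (t' - t)"
        by (rule tendsto_upperbound[OF tendsto_rabs[OF tendsto_diff[OF lW lW]]])
           (use t adm_WD(3)[OF ad(2)] in \<open>auto intro!: always_eventually\<close>)
    qed
    ultimately show "S f" by (simp add: S_def)
  qed
  then obtain f where f: "S f" and fp: "\<And>z. z \<in> D \<Longrightarrow> F f z = f z" by blast
  have X: "?X f i s t x = FX (?X f) (?W f) i s t x" if "0 \<le> s" "s \<le> t" "t \<le> T" for i s t x
    using fp[OF DI[OF that]] by (simp add: F_def)
  have W: "?W f i t x = FW (?X f) (?W f) i t x" if t: "0 \<le> t" "t \<le> T" for i t x
  proof -
    have "?W f i t x = FW (FX (?X f) (?W f)) (?W f) i t x"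
      using fp[OF DI2[OF that]] by (simp add: F_def)
    \<comment> \<open>\<open>FW\<close> reads the characteristics at ordered times only, and there
      \<open>FX\<close> returns the same ones, so the updated characteristics may be replaced by the
      old.\<close>
    also have "\<dots> = FW (?X f) (?W f) i t x"
      unfolding FW_def using X[of _ t] t
      by (auto intro!: arg_cong2[of _ _ _ _ "(+)"] Henstock_Kurzweil_Integration.integral_cong)
    finally show ?thesis .
  qed
  show ?thesis using f X W unfolding S_def by blast
qed

end

section \<open>Differentiability along the fixed point\<close>

locale diagonal_fixpoint = diagonal_cauchy_problem +
  fixes X :: "'a \<Rightarrow> real \<Rightarrow> real \<Rightarrow> real \<Rightarrow> real" and W :: "'a \<Rightarrow> real \<Rightarrow> real \<Rightarrow> real"
  assumes X: "adm_X X" and W: "adm_W W"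
    and X_eq: "0 \<le> s \<Longrightarrow> s \<le> t \<Longrightarrow> t \<le> T \<Longrightarrow> X i s t x = FX X W i s t x"
    and W_eq: "0 \<le> t \<Longrightarrow> t \<le> T \<Longrightarrow> W i t x = FW X W i t x"
begin

section \<open>Flow property of the characteristics and transport of the unknowns\<close>

lemma X_refl: "0 \<le> t \<Longrightarrow> t \<le> T \<Longrightarrow> X i t t x = x"
  using X_eq[of t t i x] by (simp add: FX_def)

lemma X_speed: "0 \<le> s \<Longrightarrow> s \<le> t \<Longrightarrow> t \<le> T \<Longrightarrow> \<bar>X i s t x - x\<bar> \<le> C * (t - s)"
  using adm_XD(2)[OF X, of s t t i x] by (simp add: X_refl)

lemma X_split:
  assumes "0 \<le> s" "s \<le> r" "r \<le> t" "t \<le> T"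
  shows "X i s t x = X i r t x - integral {s..r} (\<lambda>q. lam i (state W q (X i q t x)))"
proof -
  have "integral {s..t} (\<lambda>q. lam i (state W q (X i q t x))) =
     integral {s..r} (\<lambda>q. lam i (state W q (X i q t x))) + integral {r..t} (\<lambda>q. lam i (state W q (X i q t x)))"
    by (rule along_combine[OF coeff_lam W X]) (use assms in auto)
  then show ?thesis using X_eq[of s t i x] X_eq[of r t i x] assms by (simp add: FX_def)
qed

text \<open>Both curves solve the same integral equation below \<open>r\<close> with the same value
  at \<open>r\<close>. Their distance is bounded, and at most M / 8 whenever it is at most M, so it
  vanishes by absorption with K = 0.\<close>

lemma X_flow:
  assumes "0 \<le> s" "s \<le> r" "r \<le> t" "t \<le> T"
  shows "X i s r (X i r t x) = X i s t x"
proof -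
  define y where "y = X i r t x"
  have "\<bar>X i q r y - X i q t x\<bar> \<le> 2 * 0" if "q \<in> {0..r}" for q
  proof (rule le_double_if_half_improving[where S = "{0..r}" and \<phi> = "\<lambda>q. \<bar>X i q r y - X i q t x\<bar>"])
    fix q assume q: "q \<in> {0..r}"
    have "\<bar>X i q r y - y\<bar> \<le> C * (r - q)" by (rule X_speed) (use q assms in auto)
    moreover have "\<bar>X i q t x - y\<bar> \<le> C * (r - q)"
      unfolding y_def by (rule adm_XD(2)[OF X]) (use q assms in auto)
    moreover have "C * (r - q) \<le> C * r" using C q by (intro mult_left_mono) auto
    ultimately show "\<bar>X i q r y - X i q t x\<bar> \<le> 2 * (C * r)" by linarith
  next
    fix M q assume M: "\<And>s. s \<in> {0..r} \<Longrightarrow> \<bar>X i s r y - X i s t x\<bar> \<le> M" and q: "q \<in> {0..r}"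
    have M0: "M \<ge> 0" using M[OF q] by linarith
    have "\<bar>integral {q..r} (\<lambda>q. lam i (state W q (X i q r y))) - integral {q..r} (\<lambda>q. lam i (state W q (X i q t x)))\<bar> \<le> M / 8"
      by (rule along_diff_same[OF coeff_lam W X]) (use q assms M in auto)
    moreover have "X i q r y = y - integral {q..r} (\<lambda>q. lam i (state W q (X i q r y)))"
      using X_split[of q r r i y] X_refl[of r i y] q assms by simp
    moreover have "X i q t x = y - integral {q..r} (\<lambda>q. lam i (state W q (X i q t x)))"
      unfolding y_def by (rule X_split) (use q assms in auto)
    ultimately have "\<bar>X i q r y - X i q t x\<bar> \<le> M / 8" by (simp add: abs_minus_commute)
    then show "\<bar>X i q r y - X i q t x\<bar> \<le> 0 + M / 2" using M0 by linarith
  qed (use that in auto)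
  from this[of s] show ?thesis using assms by (simp add: y_def)
qed

text \<open>The flow property restarts the Duhamel formula at an arbitrary intermediate time; the
  time derivative of \<open>W\<close> is computed from this form.\<close>

lemma W_transport:
  assumes "0 \<le> r" "r \<le> t" "t \<le> T"
  shows "W i t x = W i r (X i r t x) + integral {r..t} (\<lambda>q. G i (state W q (X i q t x)))"
proof -
  have "W i r (X i r t x) = W0 i (X i 0 r (X i r t x)) + integral {0..r} (\<lambda>q. G i (state W q (X i q r (X i r t x))))"
    using W_eq[of r i "X i r t x"] assms by (simp add: FW_def)
  also have "integral {0..r} (\<lambda>q. G i (state W q (X i q r (X i r t x)))) = integral {0..r} (\<lambda>q. G i (state W q (X i q t x)))"
    by (rule Henstock_Kurzweil_Integration.integral_cong) (use X_flow assms in auto)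
  also have "X i 0 r (X i r t x) = X i 0 t x" using X_flow assms by simp
  finally have "W i r (X i r t x) = W0 i (X i 0 t x) + integral {0..r} (\<lambda>q. G i (state W q (X i q t x)))" .
  moreover have "integral {0..t} (\<lambda>q. G i (state W q (X i q t x))) =
     integral {0..r} (\<lambda>q. G i (state W q (X i q t x))) + integral {r..t} (\<lambda>q. G i (state W q (X i q t x)))"
    by (rule along_combine[OF coeff_G W X]) (use assms in auto)
  ultimately show ?thesis using W_eq[of t i x] assms by (simp add: FW_def)
qed

lemma W_initial: "W i 0 x = W0 i x"
  using W_eq[of 0 i x] X_refl[of 0 i x] T by (simp add: FW_def)

text \<open>The integral term changes by at most h / 4, so \<open>X i s t\<close> is strictly
  increasing with slopes between 1 / 2 and 2. Difference quotients can therefore be formed again at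
  the feet of characteristics, with positive and comparable increments.\<close>

lemma X_increment:
  assumes "0 \<le> s" "s \<le> t" "t \<le> T" "h > 0"
  shows "X i s t (x + h) - X i s t x \<ge> h / 2" "X i s t (x + h) - X i s t x \<le> 2 * h"
proof -
  have dX: "\<bar>X i q t (x + h) - X i q t x\<bar> \<le> 2 * \<bar>x + h - x\<bar>" if "s \<le> q" "q \<le> t" for q
    by (rule adm_XD(1)[OF X]) (use that assms in auto)
  have "\<bar>integral {s..t} (\<lambda>q. lam i (state W q (X i q t (x + h)))) - integral {s..t} (\<lambda>q. lam i (state W q (X i q t x)))\<bar> \<le> 2 * \<bar>x + h - x\<bar> / 8"
    by (rule along_diff_same[OF coeff_lam W X]) (use assms dX in auto)
  moreover have "X i s t y = y - integral {s..t} (\<lambda>q. lam i (state W q (X i q t y)))" for y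
    using X_eq assms by (simp add: FX_def)
  ultimately have "\<bar>X i s t (x + h) - X i s t x - h\<bar> \<le> h / 4" using assms by (simp add: abs_minus_commute)
  then show "X i s t (x + h) - X i s t x \<ge> h / 2" "X i s t (x + h) - X i s t x \<le> 2 * h"
    using assms by linarith+
qed

text \<open>Differentiability of \<open>W\<close> in \<open>x\<close>: the oscillation of its difference quotients at arbitrarily
  small scales, over the domain of dependence \<open>inside R\<close>, is bounded by \<open>3/4\<close> of itself.\<close>

definition inside :: "real \<Rightarrow> real \<Rightarrow> real \<Rightarrow> bool" where
  "inside R t x \<longleftrightarrow> \<bar>x\<bar> + C * t \<le> R"

definition osc_le :: "real \<Rightarrow> real \<Rightarrow> real \<Rightarrow> bool" where
  "osc_le R \<delta> \<epsilon> \<longleftrightarrow> (\<forall>i t x y h k. 0 \<le> t \<longrightarrow> t \<le> T \<longrightarrow> 0 < h \<longrightarrow> h \<le> \<delta> \<longrightarrow> 0 < k \<longrightarrow> k \<le> \<delta> \<longrightarrow> \<bar>x - y\<bar> \<le> \<delta> \<longrightarrow>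
     inside R t x \<longrightarrow> inside R t (x + h) \<longrightarrow> inside R t y \<longrightarrow> inside R t (y + k) \<longrightarrow>
     \<bar>(W i t (x + h) - W i t x) / h - (W i t (y + k) - W i t y) / k\<bar> \<le> \<epsilon>)"

lemma osc_leD:
  assumes "osc_le R \<delta> \<epsilon>" "0 \<le> t" "t \<le> T" "0 < h" "h \<le> \<delta>" "0 < k" "k \<le> \<delta>" "\<bar>x - y\<bar> \<le> \<delta>"
    "inside R t x" "inside R t (x + h)" "inside R t y" "inside R t (y + k)"
  shows "\<bar>(W i t (x + h) - W i t x) / h - (W i t (y + k) - W i t y) / k\<bar> \<le> \<epsilon>"
  using assms unfolding osc_le_def by blast

text \<open>\<open>C\<close> bounds all speeds, so a backward characteristic stays in the cone. The
  oscillation estimate thus closes on a bounded region, which at time 0 is a compact interval where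
  \<open>W0'\<close> is uniformly continuous.\<close>

lemma inside_X:
  assumes "inside R t x" "0 \<le> s" "s \<le> t" "t \<le> T"
  shows "inside R s (X i s t x)"
proof -
  have "\<bar>X i s t x\<bar> \<le> \<bar>x\<bar> + C * (t - s)" using X_speed[OF assms(2-4), of i x] by linarith
  then show ?thesis using assms(1) unfolding inside_def by (simp add: algebra_simps)
qed

lemma quotient_bound: "0 \<le> t \<Longrightarrow> t \<le> T \<Longrightarrow> h \<noteq> 0 \<Longrightarrow> \<bar>(W i t (x + h) - W i t x) / h\<bar> \<le> B"
  using adm_WD(2)[OF W, of t i "x + h" x] by (simp add: abs_divide divide_le_eq)

lemma initial_osc:
  assumes "\<epsilon> > 0"
  obtains \<delta> where "\<delta> > 0" "\<And>i x y h k. 0 < h \<Longrightarrow> h \<le> \<delta> \<Longrightarrow> 0 < k \<Longrightarrow> k \<le> \<delta> \<Longrightarrow> \<bar>x - y\<bar> \<le> \<delta> \<Longrightarrow>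
     \<bar>x\<bar> \<le> R \<Longrightarrow> \<bar>x + h\<bar> \<le> R \<Longrightarrow> \<bar>y\<bar> \<le> R \<Longrightarrow> \<bar>y + k\<bar> \<le> R \<Longrightarrow>
     \<bar>(W0 i (x + h) - W0 i x) / h - (W0 i (y + k) - W0 i y) / k\<bar> \<le> \<epsilon>"
proof -
  have "\<exists>d>0. \<forall>x\<in>{-R..R}. \<forall>y\<in>{-R..R}. \<bar>x - y\<bar> < d \<longrightarrow> \<bar>W0' i x - W0' i y\<bar> < \<epsilon>" for i
  proof -
    have "uniformly_continuous_on {-R..R} (W0' i)"
      by (intro compact_uniformly_continuous continuous_on_subset[OF W0'_cont]) auto
    then show ?thesis using assms unfolding uniformly_continuous_on_def dist_real_def
      by (metis abs_minus_commute)
  qed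
  then obtain d where d: "\<And>i. d i > 0" "\<And>i x y. x \<in> {-R..R} \<Longrightarrow> y \<in> {-R..R} \<Longrightarrow> \<bar>x - y\<bar> < d i \<Longrightarrow> \<bar>W0' i x - W0' i y\<bar> < \<epsilon>"
    by metis
  \<comment> \<open>The mean value points found below are less than 2 \<delta> apart; the factor 4
    leaves room.\<close>
  define \<delta> where "\<delta> = Min (range d) / 4"
  have \<delta>: "\<delta> > 0" "4 * \<delta> \<le> d i" for i using d(1) by (auto simp: \<delta>_def)
  show thesis
  proof (rule that[OF \<delta>(1)])
    fix i x y h k assume a: "0 < h" "h \<le> \<delta>" "0 < k" "k \<le> \<delta>" "\<bar>x - y\<bar> \<le> \<delta>"
      "\<bar>x\<bar> \<le> R" "\<bar>x + h\<bar> \<le> R" "\<bar>y\<bar> \<le> R" "\<bar>y + k\<bar> \<le> R"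
    have mvt: "\<exists>z. x < z \<and> z < x + h \<and> (W0 i (x + h) - W0 i x) / h = W0' i z" if "h > 0" for x h
      using MVT2[of x "x + h" "W0 i" "W0' i"] W0_deriv that by auto
    obtain z z' where z: "x < z" "z < x + h" "(W0 i (x + h) - W0 i x) / h = W0' i z"
      "y < z'" "z' < y + k" "(W0 i (y + k) - W0 i y) / k = W0' i z'"
      using mvt[of h x] mvt[of k y] a by metis
    have "\<bar>W0' i z - W0' i z'\<bar> < \<epsilon>"
      by (rule d(2)) (use z a \<delta>(1) \<delta>(2)[of i] in auto)
    then show "\<bar>(W0 i (x + h) - W0 i x) / h - (W0 i (y + k) - W0 i y) / k\<bar> \<le> \<epsilon>" using z by simp
  qed
qed

text \<open>Chain rule for difference quotients: a quotient of \<open>F\<close> along the state is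
  the gradient applied to the quotient vector \<open>Q\<close>, up to a Taylor error. The term with
  \<epsilon> is the oscillation of \<open>Q\<close>; the factor 3 counts two Taylor errors and the
  change of the gradient between the base points.\<close>

lemma coeff_osc:
  assumes F: "coeff F D" and o: "osc_le R \<delta> \<epsilon>" and t: "0 \<le> t" "t \<le> T"
    and h: "0 < h" "h \<le> \<delta>" "0 < k" "k \<le> \<delta>" "\<bar>x - y\<bar> \<le> \<delta>"
    and ins: "inside R t x" "inside R t (x + h)" "inside R t y" "inside R t (y + k)"
  shows "\<bar>(F (state W t (x + h)) - F (state W t x)) / h - (F (state W t (y + k)) - F (state W t y)) / k\<bar>
     \<le> C * N * \<epsilon> + 3 * C * (N * B)\<^sup>2 * \<delta>"
proof -
  have c: "c11_with F D (N * (A + 1)) C" using F by (simp add: coeff_def)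
  note nm = state_norm[OF W t]
  define Q where "Q x h = (1 / h) *\<^sub>R (state W t (x + h) - state W t x)" for x h
  have NB: "N * B \<ge> 0" using N1 small_consequences(5) by simp
  have tay: "\<bar>(F (state W t (x + h)) - F (state W t x)) / h - D (state W t x) \<bullet> Q x h\<bar> \<le> C * (N * B)\<^sup>2 * \<delta>"
    if h: "0 < h" "h \<le> \<delta>" for x h
  proof -
    have "\<bar>F (state W t (x + h)) - F (state W t x) - D (state W t x) \<bullet> (state W t (x + h) - state W t x)\<bar>
        \<le> C * (norm (state W t (x + h) - state W t x))\<^sup>2" by (rule c11_withD(5)[OF c nm nm])
    also have "\<dots> \<le> C * (N * B * h)\<^sup>2"
      using state_diff[OF W t, of "x + h" x] h C by (intro mult_left_mono power_mono) auto
    finally have "\<bar>F (state W t (x + h)) - F (state W t x) - D (state W t x) \<bullet> (state W t (x + h) - state W t x)\<bar> / h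
        \<le> C * (N * B * h)\<^sup>2 / h" using h by (simp add: divide_right_mono)
    also have "\<dots> = C * (N * B)\<^sup>2 * h" using h by (simp add: power2_eq_square)
    also have "\<dots> \<le> C * (N * B)\<^sup>2 * \<delta>" using h C by (intro mult_left_mono) auto
    also have "\<bar>F (state W t (x + h)) - F (state W t x) - D (state W t x) \<bullet> (state W t (x + h) - state W t x)\<bar> / h
      = \<bar>(F (state W t (x + h)) - F (state W t x)) / h - D (state W t x) \<bullet> Q x h\<bar>"
    proof -
      have "(F (state W t (x + h)) - F (state W t x) - D (state W t x) \<bullet> (state W t (x + h) - state W t x)) / h
        = (F (state W t (x + h)) - F (state W t x)) / h - D (state W t x) \<bullet> Q x h"
        unfolding Q_def inner_scaleR_right by (simp add: diff_divide_distrib)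
      then show ?thesis using h(1) by (metis abs_divide abs_of_pos)
    qed
    finally show ?thesis .
  qed
  have Qn: "norm (Q x h) \<le> N * B" if "0 < h" for x h
    using state_diff[OF W t, of "x + h" x] that by (simp add: Q_def divide_le_eq)
  have Qd: "norm (Q x h - Q y k) \<le> N * \<epsilon>"
    unfolding N
  proof (rule vec_norm_le_of_components)
    fix i show "\<bar>(Q x h - Q y k) $ i\<bar> \<le> \<epsilon>"
      using osc_leD[OF o t h ins, of i] by (simp add: Q_def)
  qed
  have e1: "D (state W t x) \<bullet> Q x h - D (state W t y) \<bullet> Q y k
     = D (state W t x) \<bullet> (Q x h - Q y k) + (D (state W t x) - D (state W t y)) \<bullet> Q y k"
    by (simp add: inner_diff_left inner_diff_right)
  have b1: "\<bar>D (state W t x) \<bullet> (Q x h - Q y k)\<bar> \<le> C * (N * \<epsilon>)"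
    by (rule order_trans[OF Cauchy_Schwarz_ineq2 mult_mono']) (use c11_withD(3)[OF c nm nm] Qd in auto)
  have b2: "\<bar>(D (state W t x) - D (state W t y)) \<bullet> Q y k\<bar> \<le> (C * (N * B * \<delta>)) * (N * B)"
  proof (rule order_trans[OF Cauchy_Schwarz_ineq2 mult_mono'])
    have "norm (D (state W t x) - D (state W t y)) \<le> C * norm (state W t x - state W t y)"
      by (rule c11_withD(4)[OF c nm nm])
    also have "\<dots> \<le> C * (N * B * \<bar>x - y\<bar>)" using state_diff[OF W t] C by (intro mult_left_mono) auto
    also have "\<dots> \<le> C * (N * B * \<delta>)" using h C NB by (intro mult_left_mono) auto
    finally show "norm (D (state W t x) - D (state W t y)) \<le> C * (N * B * \<delta>)" .
  qed (use Qn h in auto)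
  have e2: "(C * (N * B * \<delta>)) * (N * B) = C * (N * B)\<^sup>2 * \<delta>" by (simp add: power2_eq_square)
  have "\<bar>D (state W t x) \<bullet> Q x h - D (state W t y) \<bullet> Q y k\<bar> \<le> C * N * \<epsilon> + C * (N * B)\<^sup>2 * \<delta>"
    using b1 b2 unfolding e1 e2 mult.assoc[of C N \<epsilon>] by linarith
  then show ?thesis using tay[OF h(1,2), of x] tay[OF h(3,4), of y] by linarith
qed

text \<open>A quotient of \<open>W\<close> is a quotient of the data at the feet times the quotient
  of the characteristic map, plus an integral of quotients of the source. Uniform continuity of
  \<open>W0'\<close> controls the first factor; the other oscillations carry a factor
  \<open>T\<close>, and smallness makes the total less than \<epsilon>.\<close>

lemma osc_improve:
  assumes \<epsilon>: "\<epsilon> > 0" and \<delta>1: "\<delta>1 > 0" "osc_le R \<delta>1 \<epsilon>"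
  shows "\<exists>\<delta>>0. osc_le R \<delta> (3 / 4 * \<epsilon>)"
proof -
  obtain \<delta>0 where \<delta>0: "\<delta>0 > 0" and W0osc: "\<And>i x y h k. 0 < h \<Longrightarrow> h \<le> \<delta>0 \<Longrightarrow> 0 < k \<Longrightarrow> k \<le> \<delta>0 \<Longrightarrow> \<bar>x - y\<bar> \<le> \<delta>0 \<Longrightarrow>
     \<bar>x\<bar> \<le> R \<Longrightarrow> \<bar>x + h\<bar> \<le> R \<Longrightarrow> \<bar>y\<bar> \<le> R \<Longrightarrow> \<bar>y + k\<bar> \<le> R \<Longrightarrow>
     \<bar>(W0 i (x + h) - W0 i x) / h - (W0 i (y + k) - W0 i y) / k\<bar> \<le> \<epsilon> / 32"
    using initial_osc[of "\<epsilon> / 32" R] \<epsilon> by (metis zero_less_divide_iff zero_less_numeral)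
  \<comment> \<open>With \<open>E\<close> as below, \<open>(4 * A + 4) * T * E\<close> covers all
    terms of order \<open>T\<close>: the quotient \<open>p\<close> oscillates by at most
    \<open>4 * T * E\<close>, weighted with the slope \<open>A\<close> of the data, and the source
    adds 5 / 2 times \<open>T * E\<close>. \<open>c\<close> collects the part proportional to the
    scale \<eta>.\<close>
  define c where "c = (4 * A + 4) * T * (3 * C * (N * B)\<^sup>2)"
  have c: "c \<ge> 0" using A T C by (simp add: c_def)
  define \<eta> where "\<eta> = Min {\<delta>0, \<delta>1, \<epsilon> / (8 * (c + 1))}"
  have \<eta>: "\<eta> > 0" "\<eta> \<le> \<delta>0" "\<eta> \<le> \<delta>1" using \<delta>0 \<delta>1 \<epsilon> c by (auto simp: \<eta>_def)
  have c\<eta>: "c * \<eta> \<le> \<epsilon> / 8"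
  proof -
    have "(c + 1) * \<eta> \<le> (c + 1) * (\<epsilon> / (8 * (c + 1)))" using c by (intro mult_left_mono) (auto simp: \<eta>_def)
    moreover have "(c + 1) * (\<epsilon> / (8 * (c + 1))) = \<epsilon> / 8" using c by (simp add: field_simps)
    moreover have "(c + 1) * \<eta> = c * \<eta> + \<eta>" by (simp add: distrib_right)
    ultimately show ?thesis using \<eta> by linarith
  qed
  have osc: "osc_le R \<eta> \<epsilon>" using \<delta>1(2) \<eta>(3) unfolding osc_le_def by (meson order_trans)
  define E where "E = C * N * \<epsilon> + 3 * C * (N * B)\<^sup>2 * \<eta>"
  have E0: "E \<ge> 0" using C N1 \<epsilon> \<eta> by (simp add: E_def)
  have TE: "(4 * A + 4) * T * E \<le> 3 / 8 * \<epsilon>"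
  proof -
    have "T * C * N * (A + 1) * 2 \<le> T * C * N * (A + 1) * (1 + B)"
      using T C N1 A small_consequences(5) by (intro mult_left_mono) auto
    also have "\<dots> = T * C * N * (1 + B) * (A + 1)" by simp
    finally have "T * C * N * (A + 1) \<le> 1 / 16" using small by simp
    then have "4 * (T * C * N * (A + 1)) * \<epsilon> \<le> 4 * (1 / 16) * \<epsilon>"
      using \<epsilon> by (intro mult_right_mono mult_left_mono) auto
    moreover have "(4 * A + 4) * T * E = 4 * (T * C * N * (A + 1)) * \<epsilon> + c * \<eta>"
      unfolding E_def c_def by (simp add: algebra_simps)
    ultimately show ?thesis using c\<eta> by linarith
  qed
  show ?thesis
  proof (intro exI[of _ "\<eta> / 2"] conjI)
    show "\<eta> / 2 > 0" using \<eta> by simp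
    \<comment> \<open>Characteristics stretch distances by at most 2, so scales up to \<eta> / 2 at
      time \<open>t\<close> become scales up to \<eta> at earlier times, where the assumed bound
      applies.\<close>
    show "osc_le R (\<eta> / 2) (3 / 4 * \<epsilon>)"
      unfolding osc_le_def
    proof (intro allI impI)
      fix i t x y h k
      assume t: "0 \<le> t" "t \<le> T" and h: "0 < h" "h \<le> \<eta> / 2" and k: "0 < k" "k \<le> \<eta> / 2" and xy: "\<bar>x - y\<bar> \<le> \<eta> / 2"
        and ins: "inside R t x" "inside R t (x + h)" "inside R t y" "inside R t (y + k)"
      define p where "p z h s = (X i s t (z + h) - X i s t z) / h" for z h s
      have pb: "\<bar>p z h s\<bar> \<le> 2" if "0 \<le> s" "s \<le> t" "h > 0" for z h s
        using X_increment[of s t h i z] that t by (simp add: p_def abs_le_iff divide_le_eq le_divide_eq)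
      define J where "J F z h s = (F (state W s (X i s t (z + h))) - F (state W s (X i s t z))) / h" for F z h s
      have J_int: "(integral {s..t} (\<lambda>s. F (state W s (X i s t (z + h)))) - integral {s..t} (\<lambda>s. F (state W s (X i s t z)))) / h
           = integral {s..t} (J F z h)"
        and J_cont: "continuous_on {s..t} (J F z h)" if F: "coeff F D" and s: "0 \<le> s" "s \<le> t" "0 < h" for F D s z h
      proof -
        have ct: "continuous_on {s..t} (\<lambda>s. F (state W s (X i s t y)))" for y
          by (rule along_continuous[OF F W X]) (use s t in auto)
        show "continuous_on {s..t} (J F z h)"
          unfolding J_def using s by (intro continuous_intros ct) auto
        have "integral {s..t} (J F z h) = integral {s..t} (\<lambda>s. F (state W s (X i s t (z + h))) - F (state W s (X i s t z))) / h"
          unfolding J_def by (rule Henstock_Kurzweil_Integration.integral_divide)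
        then show "(integral {s..t} (\<lambda>s. F (state W s (X i s t (z + h)))) - integral {s..t} (\<lambda>s. F (state W s (X i s t z)))) / h
           = integral {s..t} (J F z h)"
          by (simp add: Henstock_Kurzweil_Integration.integral_diff integrable_continuous_real ct)
      qed
      \<comment> \<open>At time s the gap between two characteristics is again an admissible step.
        So \<open>J\<close> factors into a quotient of \<open>F\<close> at the foot, controlled by
        \<open>coeff_osc\<close>, and the quotient \<open>p\<close>, of size at most 2.\<close>
      have J_diff: "\<bar>J F x h s - J F y k s\<bar> \<le> 2 * E + C * N * B * M"
        if F: "coeff F D" and s: "0 \<le> s" "s \<le> t" and M: "\<bar>p x h s - p y k s\<bar> \<le> M" for F D s M
      proof -
        let ?h = "X i s t (x + h) - X i s t x" and ?k = "X i s t (y + k) - X i s t y"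
        let ?x = "X i s t x" and ?y = "X i s t y"
        let ?d = "\<lambda>x h. (F (state W s (x + h)) - F (state W s x)) / h"
        have hp: "?h > 0" "?h \<le> \<eta>" "?k > 0" "?k \<le> \<eta>"
          using X_increment[of s t h i x] X_increment[of s t k i y] s t h k by auto
        have J: "J F x h s = ?d ?x ?h * p x h s" "J F y k s = ?d ?y ?k * p y k s"
          unfolding J_def p_def using hp by auto
        have "\<bar>?d ?x ?h - ?d ?y ?k\<bar> \<le> E"
          unfolding E_def
        proof (rule coeff_osc[OF F osc])
          show "\<bar>?x - ?y\<bar> \<le> \<eta>" using adm_XD(1)[OF X, of s t i x y] s t xy by auto
        qed (use s t hp inside_X ins in auto)
        moreover have "\<bar>?d ?y ?k\<bar> \<le> C * N * B"
          using coeff_diff[OF F W, of s "?y + ?k" ?y] s t hp by (simp add: abs_divide divide_le_eq)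
        ultimately have "\<bar>?d ?x ?h * p x h s - ?d ?y ?k * p y k s\<bar> \<le> E * 2 + C * N * B * M"
          by (intro abs_prod_diff_le pb M) (use s h in auto)
        then show ?thesis unfolding J by simp
      qed
      have J_int_diff: "\<bar>integral {s..t} (J F x h) - integral {s..t} (J F y k)\<bar> \<le> 2 * T * E + M / 8"
        if F: "coeff F D" and s: "0 \<le> s" "s \<le> t" and M: "\<And>r. r \<in> {0..t} \<Longrightarrow> \<bar>p x h r - p y k r\<bar> \<le> M" for F D s M
      proof -
        have M0: "M \<ge> 0" using M[of s] s by fastforce
        have "\<bar>integral {s..t} (J F x h) - integral {s..t} (J F y k)\<bar> \<le> (2 * E + C * N * B * M) * (t - s)"
        proof (rule integral_diff_bound)
          show "continuous_on {s..t} (J F x h)" "continuous_on {s..t} (J F y k)" using J_cont[OF F s] h k by auto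
          show "\<bar>J F x h r - J F y k r\<bar> \<le> 2 * E + C * N * B * M" if "r \<in> {s..t}" for r
            by (rule J_diff[OF F]) (use that s M in auto)
        qed (use s in auto)
        also have "\<dots> \<le> (2 * E + C * N * B * M) * T"
          using s t E0 M0 small_consequences(4) by (intro mult_left_mono) auto
        also have "\<dots> = 2 * T * E + T * (C * N * B) * M" by (simp add: algebra_simps)
        also have "\<dots> \<le> 2 * T * E + 1 / 8 * M"
          using mult_right_mono[OF small_consequences(2) M0] by linarith
        finally show ?thesis by simp
      qed
      have p_eq: "p z h s = 1 - integral {s..t} (J (lam i) z h)" if "0 \<le> s" "s \<le> t" "h > 0" for z h s
      proof -
        have xe: "X i s t w = w - integral {s..t} (\<lambda>q. lam i (state W q (X i q t w)))" for w
          using X_eq[of s t i w] that t by (simp add: FX_def)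
        have "X i s t (z + h) - X i s t z = h - (integral {s..t} (\<lambda>s. lam i (state W s (X i s t (z + h)))) - integral {s..t} (\<lambda>s. lam i (state W s (X i s t z))))"
          using xe[of "z + h"] xe[of z] by linarith
        then have "p z h s = (h - (integral {s..t} (\<lambda>s. lam i (state W s (X i s t (z + h)))) - integral {s..t} (\<lambda>s. lam i (state W s (X i s t z))))) / h"
          unfolding p_def by (rule arg_cong)
        also have "\<dots> = 1 - integral {s..t} (J (lam i) z h)"
          unfolding diff_divide_distrib[of h] J_int[OF coeff_lam that] using that by simp
        finally show ?thesis .
      qed
      \<comment> \<open>\<open>p\<close> is 1 minus an integral of \<open>J\<close>, and the
        oscillation of that integral contains the oscillation of \<open>p\<close> with factor 1 / 8;
        absorption then costs a factor 2.\<close>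
      have p_diff: "\<bar>p x h s - p y k s\<bar> \<le> 2 * (2 * T * E)" if "s \<in> {0..t}" for s
      proof (rule le_double_if_half_improving[where S = "{0..t}" and \<phi> = "\<lambda>s. \<bar>p x h s - p y k s\<bar>"])
        show "\<bar>p x h s - p y k s\<bar> \<le> 4" if "s \<in> {0..t}" for s
          using pb[of s h x] pb[of s k y] that h k by auto
        fix M s assume M: "\<And>s. s \<in> {0..t} \<Longrightarrow> \<bar>p x h s - p y k s\<bar> \<le> M" and s: "s \<in> {0..t}"
        have M0: "M \<ge> 0" using M[OF s] by linarith
        have "\<bar>integral {s..t} (J (lam i) x h) - integral {s..t} (J (lam i) y k)\<bar> \<le> 2 * T * E + M / 8"
          by (rule J_int_diff[OF coeff_lam]) (use s M in auto)
        then show "\<bar>p x h s - p y k s\<bar> \<le> 2 * T * E + M / 2"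
          using p_eq[of s h x] p_eq[of s k y] s h k M0 by auto
      qed (use that in auto)
      let ?d0 = "\<lambda>x h. (W0 i (x + h) - W0 i x) / h"
      let ?x = "X i 0 t x" and ?y = "X i 0 t y"
      let ?h = "X i 0 t (x + h) - X i 0 t x" and ?k = "X i 0 t (y + k) - X i 0 t y"
      have hp: "?h > 0" "?h \<le> \<eta>" "?k > 0" "?k \<le> \<eta>"
        using X_increment[of 0 t h i x] X_increment[of 0 t k i y] t h k by auto
      have W_eq': "(W i t (z + h) - W i t z) / h = ?d0 (X i 0 t z) (X i 0 t (z + h) - X i 0 t z) * p z h 0 + integral {0..t} (J (G i) z h)"
        if "h > 0" "X i 0 t (z + h) - X i 0 t z > 0" for z h
      proof -
        have "W i t w = W0 i (X i 0 t w) + integral {0..t} (\<lambda>q. G i (state W q (X i q t w)))" for w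
          using W_eq[of t i w] t by (simp add: FW_def)
        note we = this
        have "(W i t (z + h) - W i t z) / h = (W0 i (X i 0 t (z + h)) - W0 i (X i 0 t z)) / h +
           (integral {0..t} (\<lambda>s. G i (state W s (X i s t (z + h)))) - integral {0..t} (\<lambda>s. G i (state W s (X i s t z)))) / h"
          unfolding we[of "z + h"] we[of z] by (simp add: add_divide_distrib diff_divide_distrib)
        also have "(W0 i (X i 0 t (z + h)) - W0 i (X i 0 t z)) / h = ?d0 (X i 0 t z) (X i 0 t (z + h) - X i 0 t z) * p z h 0"
          using that by (simp add: p_def)
        also note J_int[OF coeff_G order_refl t(1) that(1)]
        finally show ?thesis .
      qed
      have "\<bar>?d0 ?x ?h - ?d0 ?y ?k\<bar> \<le> \<epsilon> / 32"
      proof (rule W0osc)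
        show "\<bar>?x - ?y\<bar> \<le> \<delta>0" using adm_XD(1)[OF X, of 0 t i x y] t xy \<eta> by auto
        show "\<bar>?x\<bar> \<le> R" "\<bar>?x + ?h\<bar> \<le> R" "\<bar>?y\<bar> \<le> R" "\<bar>?y + ?k\<bar> \<le> R"
          using inside_X[OF ins(1), of 0 i] inside_X[OF ins(2), of 0 i] inside_X[OF ins(3), of 0 i] inside_X[OF ins(4), of 0 i] t
          by (auto simp: inside_def)
      qed (use hp \<eta> in auto)
      moreover have "\<bar>?d0 ?y ?k\<bar> \<le> A"
        using W0_lipschitz[of i "?y + ?k" ?y] hp by (simp add: abs_divide divide_le_eq)
      ultimately have "\<bar>?d0 ?x ?h * p x h 0 - ?d0 ?y ?k * p y k 0\<bar> \<le> \<epsilon> / 32 * 2 + A * (2 * (2 * T * E))"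
        by (intro abs_prod_diff_le pb p_diff) (use t h in auto)
      moreover have "\<bar>integral {0..t} (J (G i) x h) - integral {0..t} (J (G i) y k)\<bar> \<le> 2 * T * E + 2 * (2 * T * E) / 8"
        by (rule J_int_diff[OF coeff_G]) (use t p_diff in auto)
      ultimately have "\<bar>(W i t (x + h) - W i t x) / h - (W i t (y + k) - W i t y) / k\<bar>
          \<le> \<epsilon> / 32 * 2 + A * (2 * (2 * T * E)) + (2 * T * E + 2 * (2 * T * E) / 8)"
        unfolding W_eq'[OF h(1) hp(1)] W_eq'[OF k(1) hp(3)] by linarith
      moreover have "(4 * A + 4) * T * E = A * (2 * (2 * T * E)) + 4 * (T * E)" by (simp add: algebra_simps)
      moreover have "T * E \<ge> 0" using T E0 by simp
      ultimately show "\<bar>(W i t (x + h) - W i t x) / h - (W i t (y + k) - W i t y) / k\<bar> \<le> 3 / 4 * \<epsilon>"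
        using TE \<epsilon> by linarith
    qed
  qed
qed

text \<open>The Lipschitz constant gives the initial oscillation \<open>2 * B\<close>; each
  improvement multiplies it by 3 / 4 at the price of a smaller scale.\<close>

lemma osc_arbitrarily_small:
  assumes "\<epsilon> > 0" shows "\<exists>\<delta>>0. osc_le R \<delta> \<epsilon>"
proof -
  have B: "B > 0" using small_consequences(5) by simp
  have "\<exists>\<delta>>0. osc_le R \<delta> ((3 / 4) ^ n * (2 * B))" for n
  proof (induction n)
    case 0
    have "osc_le R 1 (2 * B)"
      unfolding osc_le_def
    proof (intro allI impI)
      fix i t x y h k assume a: "0 \<le> t" "t \<le> T" "0 < (h::real)" "0 < (k::real)"
      have "h \<noteq> 0" "k \<noteq> 0" using a by auto
      from quotient_bound[OF a(1,2) this(1), of i x] quotient_bound[OF a(1,2) this(2), of i y] show "\<bar>(W i t (x + h) - W i t x) / h - (W i t (y + k) - W i t y) / k\<bar> \<le> 2 * B"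
        by linarith
    qed
    then show ?case by (intro exI[of _ 1]) simp
  next
    case (Suc n)
    then obtain \<delta> where "\<delta> > 0" "osc_le R \<delta> ((3 / 4) ^ n * (2 * B))" by blast
    then show ?case using osc_improve[of "(3 / 4) ^ n * (2 * B)" \<delta> R] B by (simp add: mult.assoc)
  qed
  moreover obtain n where "(3 / 4 :: real) ^ n < \<epsilon> / (2 * B)"
    using real_arch_pow_inv[of "\<epsilon> / (2 * B)" "3/4"] assms B by auto
  then have "(3 / 4 :: real) ^ n * (2 * B) \<le> \<epsilon>" using B by (simp add: less_divide_eq)
  moreover have "osc_le R \<delta> a \<Longrightarrow> a \<le> b \<Longrightarrow> osc_le R \<delta> b" for \<delta> a b
    unfolding osc_le_def by (meson order_trans)
  ultimately show ?thesis by meson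
qed

end

section \<open>Continuously differentiable functions on a half-open time strip\<close>

lemma C1_strip_withI:
  assumes t: "\<And>t x. 0 \<le> t \<Longrightarrow> t < T \<Longrightarrow> ((\<lambda>s. g s x) has_real_derivative gt t x) (at t within {0..<T})"
    and x: "\<And>t x. 0 \<le> t \<Longrightarrow> t < T \<Longrightarrow> (g t has_real_derivative gx t x) (at x)"
    and ct: "continuous_on (strip T) (\<lambda>(t,x). gt t x)" and cx: "continuous_on (strip T) (\<lambda>(t,x). gx t x)"
  shows "C1_strip_with T g gt gx"
  unfolding C1_strip_with_def
proof (intro conjI allI impI ct cx)
  fix t x :: real assume tT: "0 \<le> t \<and> t < T"
  have "((\<lambda>(s,y). g s y) has_derivative (\<lambda>(h,k). gt t x * h + blinfun_apply (blinfun_mult_right (gx t x)) k))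
      (at (t,x) within {0..<T} \<times> UNIV)"
  proof (rule has_derivative_partialsI)
    show "((\<lambda>s. g s x) has_derivative (*) (gt t x)) (at t within {0..<T})"
      using t tT by (simp add: has_field_derivative_def)
    show "(g t has_derivative blinfun_apply (blinfun_mult_right (gx t y))) (at y within UNIV)" if "t \<in> {0..<T}" for t y
      using x that by (simp add: has_field_derivative_def)
    have "continuous_on ({0..<T} \<times> UNIV) (\<lambda>p. blinfun_mult_right (case p of (t,x) \<Rightarrow> gx t x))"
      using cx unfolding strip_def by (intro continuous_intros)
    then show "continuous (at (t,x) within {0..<T} \<times> UNIV) (\<lambda>(t,x). blinfun_mult_right (gx t x))"
      using tT unfolding continuous_on_eq_continuous_within by (force simp: case_prod_unfold)
  qed auto
  then show "((\<lambda>(s,y). g s y) has_derivative (\<lambda>(h,k). gt t x * h + gx t x * k)) (at (t,x) within strip T)"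
    by (simp add: strip_def)
qed

lemma C1_strip_with_t:
  assumes "C1_strip_with T g gt gx" "0 \<le> t" "t < T"
  shows "((\<lambda>s. g s x) has_real_derivative gt t x) (at t within {0..<T})"
proof -
  have h1: "((\<lambda>(s,y). g s y) has_derivative (\<lambda>(h,k). gt t x * h + gx t x * k)) (at (t,x) within (\<lambda>s. (s,x)) ` {0..<T})"
  proof (rule has_derivative_subset)
    show "((\<lambda>(s,y). g s y) has_derivative (\<lambda>(h,k). gt t x * h + gx t x * k)) (at (t,x) within strip T)"
      using assms unfolding C1_strip_with_def by blast
  qed (use assms in \<open>auto simp: strip_def\<close>)
  have h2: "((\<lambda>s. (s,x)) has_derivative (\<lambda>h. (h,0))) (at t within {0..<T})"
    by (auto intro!: derivative_eq_intros)
  from has_derivative_in_compose[OF h2 h1] show ?thesis unfolding has_field_derivative_def by simp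
qed

lemma C1_strip_with_x:
  assumes "C1_strip_with T g gt gx" "0 \<le> t" "t < T"
  shows "(g t has_real_derivative gx t x) (at x)"
proof -
  have h1: "((\<lambda>(s,y). g s y) has_derivative (\<lambda>(h,k). gt t x * h + gx t x * k)) (at (t,x) within (\<lambda>y. (t,y)) ` UNIV)"
  proof (rule has_derivative_subset)
    show "((\<lambda>(s,y). g s y) has_derivative (\<lambda>(h,k). gt t x * h + gx t x * k)) (at (t,x) within strip T)"
      using assms unfolding C1_strip_with_def by blast
  qed (use assms in \<open>auto simp: strip_def\<close>)
  have h2: "((\<lambda>y. (t,y)) has_derivative (\<lambda>h. (0,h))) (at x)"
    by (auto intro!: derivative_eq_intros)
  from has_derivative_in_compose[OF h2 h1] show ?thesis unfolding has_field_derivative_def by simp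
qed

lemma C1_strip_with_continuous:
  assumes "C1_strip_with T g gt gx"
  shows "continuous_on (strip T) (\<lambda>(t,x). g t x)" "continuous_on (strip T) (\<lambda>(t,x). gt t x)"
    "continuous_on (strip T) (\<lambda>(t,x). gx t x)"
proof -
  have d: "((\<lambda>(s,y). g s y) has_derivative (\<lambda>(h,k). gt t x * h + gx t x * k)) (at (t,x) within strip T)"
    if "(t,x) \<in> strip T" for t x using assms that unfolding C1_strip_with_def strip_def by auto
  show "continuous_on (strip T) (\<lambda>(t,x). g t x)"
    unfolding continuous_on_eq_continuous_within
  proof
    fix p assume "p \<in> strip T"
    then show "continuous (at p within strip T) (\<lambda>(t,x). g t x)"
      using has_derivative_continuous[OF d] by (cases p) auto
  qed
qed (use assms in \<open>auto simp: C1_strip_with_def\<close>)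

definition diagonal_solution ::
  "('n::finite \<Rightarrow> real ^ 'n \<Rightarrow> real) \<Rightarrow> ('n \<Rightarrow> real ^ 'n \<Rightarrow> real) \<Rightarrow> real \<Rightarrow> ('n \<Rightarrow> real \<Rightarrow> real \<Rightarrow> real)
    \<Rightarrow> ('n \<Rightarrow> real \<Rightarrow> real \<Rightarrow> real) \<Rightarrow> ('n \<Rightarrow> real \<Rightarrow> real \<Rightarrow> real) \<Rightarrow> bool" where
  "diagonal_solution lam G T W Wt Wx \<longleftrightarrow> (\<forall>i. C1_strip_with T (W i) (Wt i) (Wx i)) \<and>
     (\<forall>i t x. 0 \<le> t \<longrightarrow> t < T \<longrightarrow> Wt i t x + lam i (state W t x) * Wx i t x = G i (state W t x))"

section \<open>The fixed point is continuously differentiable and solves the system\<close>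

context diagonal_fixpoint
begin

definition "Q i t x h = (W i t (x + h) - W i t x) / h"

lemma Q_osc:
  assumes "\<epsilon> > 0"
  obtains \<delta> where "\<delta> > 0" "\<And>i t x y h k. 0 \<le> t \<Longrightarrow> t \<le> T \<Longrightarrow> 0 < h \<Longrightarrow> h \<le> \<delta> \<Longrightarrow> 0 < k \<Longrightarrow> k \<le> \<delta> \<Longrightarrow>
    \<bar>x - y\<bar> \<le> \<delta> \<Longrightarrow> \<bar>x\<bar> \<le> R \<Longrightarrow> \<bar>y\<bar> \<le> R \<Longrightarrow> \<bar>Q i t x h - Q i t y k\<bar> \<le> \<epsilon>"
proof -
  \<comment> \<open>The cone narrows by \<open>C * t\<close>; the margins \<open>C * T\<close> and 1
    keep all points with |x| \<le> R and all steps up to 1 inside at every time.\<close>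
  obtain \<delta> where \<delta>: "\<delta> > 0" "osc_le (R + 1 + C * T) \<delta> \<epsilon>" using osc_arbitrarily_small[OF assms] by blast
  show thesis
  proof (rule that[of "min \<delta> 1"])
    fix i t x y h k assume a: "0 \<le> t" "t \<le> T" "0 < h" "h \<le> min \<delta> 1" "0 < k" "k \<le> min \<delta> 1"
      "\<bar>x - y\<bar> \<le> min \<delta> 1" "\<bar>x\<bar> \<le> R" "\<bar>y\<bar> \<le> R"
    have "C * t \<le> C * T" using a C by (intro mult_left_mono) auto
    then show "\<bar>Q i t x h - Q i t y k\<bar> \<le> \<epsilon>"
      unfolding Q_def by (intro osc_leD[OF \<delta>(2)]) (use a in \<open>auto simp: inside_def\<close>)
  qed (use \<delta> in auto)
qed

definition "Wx i t x = deriv (W i t) x"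

text \<open>Right quotients with steps 1 / (n + 1) are Cauchy by vanishing oscillation. A left
  quotient at \<open>x\<close> is a right quotient based at \<open>x + h\<close>, so comparing
  quotients with different base points settles the two-sided limit.\<close>

lemma W_deriv:
  assumes t: "0 \<le> t" "t \<le> T"
  shows "(W i t has_real_derivative Wx i t x) (at x)"
proof -
  define a where "a n = Q i t x (inverse (real (Suc n)))" for n
  have "Cauchy a"
  proof (rule metric_CauchyI)
    fix \<epsilon> :: real assume e: "\<epsilon> > 0"
    then obtain \<delta> where \<delta>: "\<delta> > 0" "\<And>h k. 0 < h \<Longrightarrow> h \<le> \<delta> \<Longrightarrow> 0 < k \<Longrightarrow> k \<le> \<delta> \<Longrightarrow> \<bar>Q i t x h - Q i t x k\<bar> \<le> \<epsilon> / 2"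
      using Q_osc[of "\<epsilon> / 2" "\<bar>x\<bar>"] t by (metis abs_zero diff_self half_gt_zero less_imp_le order_refl)
    obtain n0 where n0: "\<And>n. n \<ge> n0 \<Longrightarrow> inverse (real (Suc n)) \<le> \<delta>"
      using inverse_Suc_le[OF \<delta>(1)] unfolding eventually_sequentially by blast
    have "dist (a m) (a n) < \<epsilon>" if "m \<ge> n0" "n \<ge> n0" for m n
    proof -
      have "\<bar>a m - a n\<bar> \<le> \<epsilon> / 2" unfolding a_def by (rule \<delta>(2)) (use n0 that in auto)
      then show ?thesis using e by (simp add: dist_real_def)
    qed
    then show "\<exists>M. \<forall>m\<ge>M. \<forall>n\<ge>M. dist (a m) (a n) < \<epsilon>" by blast
  qed
  then obtain L where L: "a \<longlonglongrightarrow> L" using Cauchy_convergent unfolding convergent_def by blast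
  have "(W i t has_real_derivative L) (at x)"
    unfolding DERIV_def
  proof (rule LIM_I)
    fix \<epsilon> :: real assume e: "\<epsilon> > 0"
    then have e2: "\<epsilon> / 2 > 0" by simp
    obtain \<delta> where \<delta>1: "\<delta> > 0" "\<And>i t x' y h k. 0 \<le> t \<Longrightarrow> t \<le> T \<Longrightarrow> 0 < h \<Longrightarrow> h \<le> \<delta> \<Longrightarrow> 0 < k \<Longrightarrow> k \<le> \<delta> \<Longrightarrow>
      \<bar>x' - y\<bar> \<le> \<delta> \<Longrightarrow> \<bar>x'\<bar> \<le> \<bar>x\<bar> + 1 \<Longrightarrow> \<bar>y\<bar> \<le> \<bar>x\<bar> + 1 \<Longrightarrow> \<bar>Q i t x' h - Q i t y k\<bar> \<le> \<epsilon> / 2"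
      using Q_osc[OF e2, of "\<bar>x\<bar> + 1"] by blast
    then have \<delta>: "\<delta> > 0" "\<And>y h k. 0 < h \<Longrightarrow> h \<le> \<delta> \<Longrightarrow> 0 < k \<Longrightarrow> k \<le> \<delta> \<Longrightarrow> \<bar>x - y\<bar> \<le> \<delta> \<Longrightarrow> \<bar>y\<bar> \<le> \<bar>x\<bar> + 1 \<Longrightarrow> \<bar>Q i t x h - Q i t y k\<bar> \<le> \<epsilon> / 2"
      using t by auto
    have near: "\<bar>L - Q i t y k\<bar> \<le> \<epsilon> / 2" if "0 < k" "k \<le> \<delta>" "\<bar>x - y\<bar> \<le> \<delta>" "\<bar>y\<bar> \<le> \<bar>x\<bar> + 1" for y k
    proof (rule tendsto_upperbound)
      show "(\<lambda>n. \<bar>a n - Q i t y k\<bar>) \<longlonglongrightarrow> \<bar>L - Q i t y k\<bar>" by (intro tendsto_intros L)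
      show "\<forall>\<^sub>F n in sequentially. \<bar>a n - Q i t y k\<bar> \<le> \<epsilon> / 2"
        using inverse_Suc_le[OF \<delta>(1)] by (rule eventually_mono) (use \<delta>(2) that in \<open>auto simp: a_def\<close>)
    qed simp
    show "\<exists>r>0. \<forall>h. h \<noteq> 0 \<and> norm (h - 0) < r \<longrightarrow> norm ((W i t (x + h) - W i t x) / h - L) < \<epsilon>"
    proof (intro exI[of _ "min \<delta> 1"] conjI allI impI)
      fix h :: real assume h: "h \<noteq> 0 \<and> norm (h - 0) < min \<delta> 1"
      show "norm ((W i t (x + h) - W i t x) / h - L) < \<epsilon>"
      proof (cases "h > 0")
        case True
        then show ?thesis using near[of h x] h e by (auto simp: Q_def abs_minus_commute)
      next
        case False
        then have "\<bar>L - Q i t (x + h) (- h)\<bar> \<le> \<epsilon> / 2" using h by (intro near) auto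
        moreover have "Q i t (x + h) (- h) = (W i t (x + h) - W i t x) / h"
          using False h by (simp add: Q_def field_simps)
        ultimately show ?thesis using e by (simp add: abs_minus_commute)
      qed
    qed (use \<delta> in auto)
  qed
  then show ?thesis unfolding Wx_def by (simp add: DERIV_imp_deriv)
qed

lemma Q_Wx:
  assumes "\<epsilon> > 0"
  obtains \<delta> where "\<delta> > 0" "\<And>i t x. 0 \<le> t \<Longrightarrow> t \<le> T \<Longrightarrow> \<bar>x\<bar> \<le> R \<Longrightarrow> \<bar>Q i t x \<delta> - Wx i t x\<bar> \<le> \<epsilon>"
proof -
  obtain \<delta> where \<delta>: "\<delta> > 0" "\<And>i t x y h k. 0 \<le> t \<Longrightarrow> t \<le> T \<Longrightarrow> 0 < h \<Longrightarrow> h \<le> \<delta> \<Longrightarrow> 0 < k \<Longrightarrow> k \<le> \<delta> \<Longrightarrow>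
    \<bar>x - y\<bar> \<le> \<delta> \<Longrightarrow> \<bar>x\<bar> \<le> R \<Longrightarrow> \<bar>y\<bar> \<le> R \<Longrightarrow> \<bar>Q i t x h - Q i t y k\<bar> \<le> \<epsilon>"
    using Q_osc[OF assms, of R] by blast
  have "\<bar>Q i t x \<delta> - Wx i t x\<bar> \<le> \<epsilon>" if t: "0 \<le> t" "t \<le> T" "\<bar>x\<bar> \<le> R" for i t x
  proof (rule tendsto_upperbound)
    have "(\<lambda>n. Q i t x (inverse (real (Suc n)))) \<longlonglongrightarrow> Wx i t x"
      unfolding Q_def
      by (rule filterlim_compose[OF W_deriv[OF t(1,2), unfolded DERIV_def]])
         (use LIMSEQ_inverse_real_of_nat in \<open>auto simp: filterlim_at\<close>)
    then show "(\<lambda>n. \<bar>Q i t x \<delta> - Q i t x (inverse (real (Suc n)))\<bar>) \<longlonglongrightarrow> \<bar>Q i t x \<delta> - Wx i t x\<bar>"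
      by (intro tendsto_intros)
    show "\<forall>\<^sub>F n in sequentially. \<bar>Q i t x \<delta> - Q i t x (inverse (real (Suc n)))\<bar> \<le> \<epsilon>"
      using inverse_Suc_le[OF \<delta>(1)] by (rule eventually_mono) (use \<delta> t in auto)
  qed simp
  then show thesis using that[OF \<delta>(1)] by blast
qed

lemma Wx_bound: "0 \<le> t \<Longrightarrow> t \<le> T \<Longrightarrow> \<bar>Wx i t x\<bar> \<le> B"
  using lipschitz_imp_deriv_bound[OF W_deriv] adm_WD(2)[OF W] by blast

text \<open>At a fixed small step the quotients of \<open>W\<close> are continuous in (t, x), and
  they approximate \<open>Wx\<close> uniformly in t and locally uniformly in x.\<close>

lemma Wx_continuous: "continuous_on ({0..T} \<times> UNIV) (\<lambda>(t,x). Wx i t x)"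
  unfolding continuous_on_iff
proof (intro ballI allI impI)
  fix p :: "real \<times> real" and \<epsilon> :: real assume p: "p \<in> {0..T} \<times> UNIV" and e: "\<epsilon> > 0"
  obtain t x where tx: "p = (t,x)" by (cases p)
  have t: "0 \<le> t" "t \<le> T" using p tx by auto
  obtain \<delta> where \<delta>: "\<delta> > 0" "\<And>i t y. 0 \<le> t \<Longrightarrow> t \<le> T \<Longrightarrow> \<bar>y\<bar> \<le> \<bar>x\<bar> + 1 \<Longrightarrow> \<bar>Q i t y \<delta> - Wx i t y\<bar> \<le> \<epsilon> / 4"
    using Q_Wx[of "\<epsilon> / 4" "\<bar>x\<bar> + 1"] e by (metis zero_less_divide_iff zero_less_numeral)
  have "continuous_on ({0..T} \<times> UNIV) (\<lambda>(t,x). Q i t x \<delta>)"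
  proof -
    have c: "continuous_on ({0..T} \<times> UNIV) (\<lambda>p. W i (fst p) (snd p))"
      using adm_W_continuous[OF W, of i] by (simp add: case_prod_unfold)
    have "continuous_on ({0..T} \<times> UNIV) (\<lambda>p. W i (fst (fst p, snd p + \<delta>)) (snd (fst p, snd p + \<delta>)))"
      by (rule continuous_on_compose2[OF c]) (auto intro!: continuous_intros)
    then show ?thesis using c \<delta>(1) unfolding Q_def case_prod_unfold by (intro continuous_intros) auto
  qed
  then obtain d where d: "d > 0" "\<And>q. q \<in> {0..T} \<times> UNIV \<Longrightarrow> dist q p < d \<Longrightarrow>
      dist (case q of (t,x) \<Rightarrow> Q i t x \<delta>) (case p of (t,x) \<Rightarrow> Q i t x \<delta>) < \<epsilon> / 4"
    using e p unfolding continuous_on_iff by (metis zero_less_divide_iff zero_less_numeral)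
  show "\<exists>d>0. \<forall>q\<in>{0..T} \<times> UNIV. dist q p < d \<longrightarrow>
      dist (case q of (t,x) \<Rightarrow> Wx i t x) (case p of (t,x) \<Rightarrow> Wx i t x) < \<epsilon>"
  proof (intro exI[of _ "min d 1"] conjI ballI impI)
    fix q assume q: "q \<in> {0..T} \<times> (UNIV :: real set)" "dist q p < min d 1"
    obtain s y where sy: "q = (s,y)" by (cases q)
    have s: "0 \<le> s" "s \<le> T" using q sy by auto
    have "\<bar>y - x\<bar> < 1" using q(2) dist_snd_le[of q p] by (simp add: sy tx dist_real_def)
    then have "\<bar>Q i s y \<delta> - Wx i s y\<bar> \<le> \<epsilon> / 4" by (intro \<delta>(2) s) auto
    moreover have "\<bar>Q i t x \<delta> - Wx i t x\<bar> \<le> \<epsilon> / 4" by (intro \<delta>(2) t) auto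
    moreover have "\<bar>Q i s y \<delta> - Q i t x \<delta>\<bar> < \<epsilon> / 4" using d(2)[OF q(1)] q(2) by (simp add: sy tx dist_real_def)
    ultimately have "\<bar>Wx i s y - Wx i t x\<bar> < \<epsilon>" using e by linarith
    then show "dist (case q of (t,x) \<Rightarrow> Wx i t x) (case p of (t,x) \<Rightarrow> Wx i t x) < \<epsilon>"
      by (simp add: sy tx dist_real_def)
  qed (use d in auto)
qed

lemma coeff_state_continuous:
  assumes "continuous_on UNIV F" shows "continuous_on ({0..T} \<times> UNIV) (\<lambda>(t,x). F (state W t x))"
proof -
  have "continuous_on ({0..T} \<times> UNIV) (\<lambda>p. state W (fst p) (snd p))"
    unfolding state_def
    by (intro continuous_on_vec_lambda) (use adm_W_continuous[OF W] in \<open>simp add: case_prod_unfold\<close>)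
  from continuous_on_compose2[OF assms this] show ?thesis by (simp add: case_prod_unfold)
qed

text \<open>The equation dictates this value, and in this form its continuity is immediate;
  \<open>W_deriv_t\<close> then identifies it as the actual time derivative.\<close>

definition "Wt i t x = G i (state W t x) - lam i (state W t x) * Wx i t x"

lemma Wt_continuous: "continuous_on ({0..T} \<times> UNIV) (\<lambda>(t,x). Wt i t x)"
  using coeff_state_continuous[OF lam_cont, of i] coeff_state_continuous[OF G_cont, of i] Wx_continuous[of i]
  unfolding Wt_def case_prod_unfold by (intro continuous_intros)

lemma near_of_continuous:
  assumes "continuous_on ({0..T} \<times> UNIV) (\<lambda>(t,x). g t x)" "0 \<le> t" "t \<le> T" "\<epsilon> > (0::real)"
  obtains d where "d > 0" "\<And>s y. 0 \<le> s \<Longrightarrow> s \<le> T \<Longrightarrow> \<bar>s - t\<bar> < d \<Longrightarrow> \<bar>y - x\<bar> < d \<Longrightarrow> \<bar>g s y - g t x\<bar> \<le> (\<epsilon>::real)"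
proof -
  obtain d where d: "d > 0" "\<And>q. q \<in> {0..T} \<times> UNIV \<Longrightarrow> dist q (t,x) < d \<Longrightarrow> dist (case q of (t,x) \<Rightarrow> g t x) (g t x) < \<epsilon>"
    using assms unfolding continuous_on_iff by fastforce
  show thesis
  proof (rule that[of "d / 2"])
    fix s y assume a: "0 \<le> s" "s \<le> T" "\<bar>s - t\<bar> < d / 2" "\<bar>y - x\<bar> < d / 2"
    have "dist (s,y) (t,x) \<le> \<bar>s - t\<bar> + \<bar>y - x\<bar>"
      using norm_Pair_le[of "s - t" "y - x"] by (simp add: dist_norm)
    then show "\<bar>g s y - g t x\<bar> \<le> \<epsilon>" using d(2)[of "(s,y)"] a by (auto simp: dist_real_def)
  qed (use d in auto)
qed

text \<open>Going back from (b, x) along the characteristic to time a changes \<open>W\<close> by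
  the source integral; the foot is off \<open>x\<close> by the speed integral, which the mean value
  theorem converts with \<open>Wx\<close>. The errors are 1 from the source, \<open>B\<close> from
  the speed times \<open>Wx\<close>, and \<open>C\<close> from the variation of \<open>Wx\<close>.
  Both a and b vary, so one estimate covers increments on either side of \<open>t\<close>.\<close>

lemma increment_estimate:
  assumes t: "0 \<le> t" "t \<le> T" and e: "\<epsilon> > 0"
  obtains d where "d > 0" "\<And>a b. 0 \<le> a \<Longrightarrow> a \<le> b \<Longrightarrow> b \<le> T \<Longrightarrow> \<bar>a - t\<bar> < d \<Longrightarrow> \<bar>b - t\<bar> < d \<Longrightarrow>
     \<bar>W i b x - W i a x - (b - a) * Wt i t x\<bar> \<le> (b - a) * ((1 + B + C) * \<epsilon>)"
proof -
  let ?l = "lam i (state W t x)"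
  obtain d1 where d1: "d1 > 0" "\<And>s y. 0 \<le> s \<Longrightarrow> s \<le> T \<Longrightarrow> \<bar>s - t\<bar> < d1 \<Longrightarrow> \<bar>y - x\<bar> < d1 \<Longrightarrow> \<bar>lam i (state W s y) - ?l\<bar> \<le> \<epsilon>"
    using near_of_continuous[OF coeff_state_continuous[OF lam_cont] t e] by blast
  obtain d2 where d2: "d2 > 0" "\<And>s y. 0 \<le> s \<Longrightarrow> s \<le> T \<Longrightarrow> \<bar>s - t\<bar> < d2 \<Longrightarrow> \<bar>y - x\<bar> < d2 \<Longrightarrow> \<bar>G i (state W s y) - G i (state W t x)\<bar> \<le> \<epsilon>"
    using near_of_continuous[OF coeff_state_continuous[OF G_cont] t e] by blast
  obtain d3 where d3: "d3 > 0" "\<And>s y. 0 \<le> s \<Longrightarrow> s \<le> T \<Longrightarrow> \<bar>s - t\<bar> < d3 \<Longrightarrow> \<bar>y - x\<bar> < d3 \<Longrightarrow> \<bar>Wx i s y - Wx i t x\<bar> \<le> \<epsilon>"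
    using near_of_continuous[OF Wx_continuous t e] by blast
  define D where "D = Min {d1, d2, d3}"
  have D: "D > 0" "D \<le> d1" "D \<le> d2" "D \<le> d3" using d1 d2 d3 by (auto simp: D_def)
  \<comment> \<open>On a time interval shorter than 2 d a characteristic moves by less than
    \<open>D\<close>, and d itself is at most \<open>D\<close>.\<close>
  define d where "d = D / (2 * (C + 1))"
  have Cd: "C * (2 * d) \<le> D" "d \<le> D" "d > 0"
  proof -
    have "(2 * (C + 1)) * d = D" using C by (simp add: d_def)
    moreover show "d > 0" using D C by (simp add: d_def)
    ultimately show "C * (2 * d) \<le> D" "d \<le> D"
      using C mult_nonneg_nonneg[OF C less_imp_le[OF \<open>d > 0\<close>]] by (auto simp: algebra_simps)
  qed
  show thesis
  proof (rule that[OF Cd(3)])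
    fix a b assume ab: "0 \<le> a" "a \<le> b" "b \<le> T" "\<bar>a - t\<bar> < d" "\<bar>b - t\<bar> < d"
    have near: "\<bar>X i q b x - x\<bar> < D" if "a \<le> q" "q \<le> b" for q
    proof -
      have "\<bar>X i q b x - x\<bar> \<le> C * (b - q)" by (rule X_speed) (use ab that in auto)
      moreover have "C * (b - q) \<le> C * (b - a)" using C that by (intro mult_left_mono) auto
      moreover have "C * (b - a) < D"
      proof (cases "C = 0")
        case False
        then have "C * (b - a) < C * (2 * d)" using C ab by (intro mult_strict_left_mono) auto
        then show ?thesis using Cd by linarith
      qed (use D in simp)
      ultimately show ?thesis by linarith
    qed
    have coef: "\<bar>integral {a..b} (\<lambda>q. F (state W q (X i q b x))) - (b - a) * F (state W t x)\<bar> \<le> \<epsilon> * (b - a)"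
      if F: "coeff F E" and n: "\<And>q. q \<in> {a..b} \<Longrightarrow> \<bar>F (state W q (X i q b x)) - F (state W t x)\<bar> \<le> \<epsilon>" for F E
    proof -
      have "\<bar>integral {a..b} (\<lambda>q. F (state W q (X i q b x))) - integral {a..b} (\<lambda>q. F (state W t x))\<bar> \<le> \<epsilon> * (b - a)"
        by (rule integral_diff_bound[OF along_continuous[OF F W X]]) (use ab n in auto)
      then show ?thesis using ab by simp
    qed
    have I1: "\<bar>integral {a..b} (\<lambda>q. lam i (state W q (X i q b x))) - (b - a) * ?l\<bar> \<le> \<epsilon> * (b - a)"
      by (rule coef[OF coeff_lam d1(2)]) (use ab near D Cd in force)+
    have I2: "\<bar>integral {a..b} (\<lambda>q. G i (state W q (X i q b x))) - (b - a) * G i (state W t x)\<bar> \<le> \<epsilon> * (b - a)"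
      by (rule coef[OF coeff_G d2(2)]) (use ab near D Cd in force)+
    let ?y = "X i a b x"
    have y: "?y = x - integral {a..b} (\<lambda>q. lam i (state W q (X i q b x)))"
      using X_eq[of a b i x] ab by (simp add: FX_def)
    obtain z where z: "\<bar>z - x\<bar> \<le> \<bar>?y - x\<bar>" "W i a ?y - W i a x = Wx i a z * (?y - x)"
    proof (cases "?y = x")
      case True then show thesis using that[of x] by simp
    next
      case False
      have "a \<le> T" using ab by simp
      note der = W_deriv[OF ab(1) this]
      show thesis
      proof (cases "?y < x")
        case True
        then obtain z where "?y < z" "z < x" "W i a x - W i a ?y = (x - ?y) * Wx i a z"
          using MVT2[OF True, of "W i a" "Wx i a"] der by blast
        then show thesis using that[of z] by (auto simp: algebra_simps)
      next
        case F: False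
        then have "x < ?y" using False by simp
        from MVT2[OF this, of "W i a" "Wx i a"] der
        obtain z where "x < z" "z < ?y" "W i a ?y - W i a x = (?y - x) * Wx i a z" by blast
        then show thesis using that[of z] by (auto simp: algebra_simps)
      qed
    qed
    have zn: "\<bar>Wx i a z - Wx i t x\<bar> \<le> \<epsilon>" using z(1) near[of a] ab D Cd by (intro d3(2)) auto
    have aT: "a \<le> T" using ab by simp
    have "W i b x = W i a ?y + integral {a..b} (\<lambda>q. G i (state W q (X i q b x)))"
      by (rule W_transport) (use ab in auto)
    then have split: "W i b x - W i a x - (b - a) * Wt i t x =
       (integral {a..b} (\<lambda>q. G i (state W q (X i q b x))) - (b - a) * G i (state W t x))
       - Wx i a z * (integral {a..b} (\<lambda>q. lam i (state W q (X i q b x))) - (b - a) * ?l)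
       - (Wx i a z - Wx i t x) * ((b - a) * ?l)"
      using z(2) unfolding y Wt_def by (simp add: algebra_simps)
    have m1: "\<bar>Wx i a z * (integral {a..b} (\<lambda>q. lam i (state W q (X i q b x))) - (b - a) * ?l)\<bar> \<le> B * (\<epsilon> * (b - a))"
      unfolding abs_mult[of "Wx i a z"] by (rule mult_mono'[OF Wx_bound[OF ab(1) aT] I1]) auto
    have l: "\<bar>(b - a) * ?l\<bar> \<le> (b - a) * C"
      unfolding abs_mult using ab coeff_bound[OF coeff_lam W t] by (intro mult_mono') auto
    have m2: "\<bar>(Wx i a z - Wx i t x) * ((b - a) * ?l)\<bar> \<le> \<epsilon> * ((b - a) * C)"
      unfolding abs_mult[of "Wx i a z - Wx i t x"] by (rule mult_mono'[OF zn l]) auto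
    have tri: "\<bar>p - q - r\<bar> \<le> u + v + w" if "\<bar>p\<bar> \<le> u" "\<bar>q\<bar> \<le> v" "\<bar>r\<bar> \<le> w" for p q r u v w :: real
      using that by linarith
    have "\<epsilon> * (b - a) + B * (\<epsilon> * (b - a)) + \<epsilon> * ((b - a) * C) = (b - a) * ((1 + B + C) * \<epsilon>)"
      by (simp add: algebra_simps)
    with tri[OF I2 m1 m2] show "\<bar>W i b x - W i a x - (b - a) * Wt i t x\<bar> \<le> (b - a) * ((1 + B + C) * \<epsilon>)"
      unfolding split by simp
  qed
qed

lemma W_deriv_t:
  assumes t: "0 \<le> t" "t \<le> T"
  shows "((\<lambda>s. W i s x) has_real_derivative Wt i t x) (at t within {0..T})"
  unfolding has_field_derivative_iff
proof (rule tendstoI)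
  fix e :: real assume e: "e > 0"
  define \<epsilon> where "\<epsilon> = e / (2 * (1 + B + C))"
  have pos: "1 + B + C > 0" using C small_consequences(5) by simp
  have "(1 + B + C) * \<epsilon> = e / 2" using pos by (simp add: \<epsilon>_def field_simps)
  then have \<epsilon>: "\<epsilon> > 0" "(1 + B + C) * \<epsilon> < e" using e pos by (auto simp: \<epsilon>_def)
  obtain d where d: "d > 0" "\<And>a b. 0 \<le> a \<Longrightarrow> a \<le> b \<Longrightarrow> b \<le> T \<Longrightarrow> \<bar>a - t\<bar> < d \<Longrightarrow> \<bar>b - t\<bar> < d \<Longrightarrow>
     \<bar>W i b x - W i a x - (b - a) * Wt i t x\<bar> \<le> (b - a) * ((1 + B + C) * \<epsilon>)"
    using increment_estimate[OF t \<epsilon>(1)] by blast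
  have "\<bar>(W i s x - W i t x) / (s - t) - Wt i t x\<bar> < e" if s: "s \<in> {0..T}" "s \<noteq> t" "\<bar>s - t\<bar> < d" for s
  proof -
    have "\<bar>W i s x - W i t x - (s - t) * Wt i t x\<bar> \<le> \<bar>s - t\<bar> * ((1 + B + C) * \<epsilon>)"
    proof (cases "t \<le> s")
      case True
      then show ?thesis using d(2)[of t s] s t d(1) by simp
    next
      case False
      then have "\<bar>W i t x - W i s x - (t - s) * Wt i t x\<bar> \<le> (t - s) * ((1 + B + C) * \<epsilon>)"
        using s t d(1) by (intro d(2)) auto
      moreover have "W i s x - W i t x - (s - t) * Wt i t x = - (W i t x - W i s x - (t - s) * Wt i t x)"
        by (simp add: algebra_simps)
      ultimately show ?thesis using False by simp
    qed
    then have "\<bar>W i s x - W i t x - (s - t) * Wt i t x\<bar> / \<bar>s - t\<bar> \<le> (1 + B + C) * \<epsilon>"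
      using s by (simp add: divide_le_eq mult.commute)
    moreover have "(W i s x - W i t x - (s - t) * Wt i t x) / (s - t) = (W i s x - W i t x) / (s - t) - Wt i t x"
      using s by (simp add: diff_divide_distrib)
    ultimately show ?thesis using \<epsilon>(2) by (simp flip: abs_divide)
  qed
  then show "\<forall>\<^sub>F s in at t within {0..T}. dist ((W i s x - W i t x) / (s - t)) (Wt i t x) < e"
    unfolding eventually_at dist_real_def using d(1) by (intro exI[of _ d]) auto
qed

lemma W_diagonal_solution: "diagonal_solution lam G T W Wt Wx"
  unfolding diagonal_solution_def
proof (intro conjI allI impI)
  fix i
  have sub: "strip T \<subseteq> {0..T} \<times> UNIV" by (auto simp: strip_def)
  show "C1_strip_with T (W i) (Wt i) (Wx i)"
  proof (rule C1_strip_withI)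
    show "((\<lambda>s. W i s x) has_real_derivative Wt i t x) (at t within {0..<T})" if "0 \<le> t" "t < T" for t x
      by (rule DERIV_subset[OF W_deriv_t]) (use that in auto)
    show "(W i t has_real_derivative Wx i t x) (at x)" if "0 \<le> t" "t < T" for t x
      by (rule W_deriv) (use that in auto)
  qed (use continuous_on_subset[OF Wt_continuous sub] continuous_on_subset[OF Wx_continuous sub] in auto)
qed (simp add: Wt_def)

end

text \<open>\<open>T\<close> is fixed before the data: it depends on the coefficients and on
  \<open>A\<close> alone. This uniform lifespan is what a restart near the end of an existence
  interval requires.\<close>

lemma diagonal_local_existence:
  fixes lam G :: "'n::finite \<Rightarrow> real ^ 'n \<Rightarrow> real"
  assumes lam: "\<And>i. c11 (lam i)" and G: "\<And>i. c11 (G i)" and A: "A \<ge> 0"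
  shows "\<exists>T>0. \<forall>W0 W0'. (\<forall>i x. \<bar>W0 i x\<bar> \<le> A \<and> (W0 i has_real_derivative W0' i x) (at x) \<and> \<bar>W0' i x\<bar> \<le> A) \<longrightarrow>
      (\<forall>i. continuous_on UNIV (W0' i)) \<longrightarrow>
      (\<exists>W Wt Wx K. diagonal_solution lam G T W Wt Wx \<and> (\<forall>i x. W i 0 x = W0 i x) \<and>
         (\<forall>i t x. 0 \<le> t \<longrightarrow> t < T \<longrightarrow> \<bar>W i t x\<bar> \<le> K \<and> \<bar>Wx i t x\<bar> \<le> K))"
proof -
  define N where "N = real CARD('n)"
  define B where "B = 2 * A + 1"
  obtain Dl where "\<forall>R. \<exists>C\<ge>0. \<forall>i. c11_with (lam i) (Dl i) R C" using c11_family[of lam] lam by blast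
  then obtain C1 where C1: "C1 \<ge> 0" "\<And>i. c11_with (lam i) (Dl i) (N * (A + 1)) C1" by blast
  obtain DG where "\<forall>R. \<exists>C\<ge>0. \<forall>i. c11_with (G i) (DG i) R C" using c11_family[of G] G by blast
  then obtain C2 where C2: "C2 \<ge> 0" "\<And>i. c11_with (G i) (DG i) (N * (A + 1)) C2" by blast
  define C where "C = max C1 C2"
  have C0: "C \<ge> 0" using C1 by (simp add: C_def)
  define K where "K = C * N * (1 + B) * (A + 1)"
  have K: "K \<ge> 0" using C0 A by (simp add: K_def N_def B_def)
  define T where "T = 1 / (8 * (K + 1))"
  have T: "T > 0" "T * K \<le> 1 / 8" using K by (auto simp: T_def field_simps)
  show ?thesis
  proof (intro exI[of _ T] conjI allI impI)
    fix W0 W0' :: "'n \<Rightarrow> real \<Rightarrow> real"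
    assume W0: "\<forall>i x. \<bar>W0 i x\<bar> \<le> A \<and> (W0 i has_real_derivative W0' i x) (at x) \<and> \<bar>W0' i x\<bar> \<le> A"
      and W0': "\<forall>i. continuous_on UNIV (W0' i)"
    interpret diagonal_cauchy_problem lam G Dl DG W0 W0' A B C N T
    proof
      show "T * C * N * (1 + B) * (A + 1) \<le> 1 / 8" using T(2) by (simp add: K_def mult.assoc)
      show "c11_with (lam i) (Dl i) (N * (A + 1)) C" "c11_with (G i) (DG i) (N * (A + 1)) C" for i
        by (rule c11_with_mono[OF C1(2)], simp add: C_def, rule c11_with_mono[OF C2(2)], simp add: C_def)
      show "continuous_on UNIV (lam i)" "continuous_on UNIV (G i)" for i
        by (rule c11_continuous[OF lam], rule c11_continuous[OF G])
    qed (use A C0 T W0 W0' in \<open>auto simp: N_def B_def\<close>)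
    obtain X W where XW: "adm_X X" "adm_W W"
      "\<And>i s t x. 0 \<le> s \<Longrightarrow> s \<le> t \<Longrightarrow> t \<le> T \<Longrightarrow> X i s t x = FX X W i s t x"
      "\<And>i t x. 0 \<le> t \<Longrightarrow> t \<le> T \<Longrightarrow> W i t x = FW X W i t x"
      using fixpoint_exists by metis
    interpret fp: diagonal_fixpoint lam G Dl DG W0 W0' A B C N T X W
      by standard (use XW in auto)
    show "\<exists>W Wt Wx K. diagonal_solution lam G T W Wt Wx \<and> (\<forall>i x. W i 0 x = W0 i x) \<and>
         (\<forall>i t x. 0 \<le> t \<longrightarrow> t < T \<longrightarrow> \<bar>W i t x\<bar> \<le> K \<and> \<bar>Wx i t x\<bar> \<le> K)"
    proof (rule exI[of _ W], rule exI[of _ fp.Wt], rule exI[of _ fp.Wx], rule exI[of _ "max (A + 1) B"], intro conjI allI impI)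
      fix i t x assume "0 \<le> t" "t < T"
      then show "\<bar>W i t x\<bar> \<le> max (A + 1) B" "\<bar>fp.Wx i t x\<bar> \<le> max (A + 1) B"
        using adm_WD(1)[OF XW(2), of t i x] fp.Wx_bound[of t i x] by auto
    qed (use fp.W_diagonal_solution fp.W_initial in auto)
  qed (use T in auto)
qed

section \<open>A maximum principle and its consequences\<close>

lemma deriv_nonneg_of_left_max:
  fixes f :: "real \<Rightarrow> real"
  assumes "(f has_real_derivative D) (at t within {0..b})" "0 < t" "t \<le> b" "\<And>s. 0 \<le> s \<Longrightarrow> s \<le> t \<Longrightarrow> f s \<le> f t"
  shows "D \<ge> 0"
proof (rule ccontr)
  assume "\<not> D \<ge> 0"
  then obtain d where d: "d > 0" "\<And>h. h > 0 \<Longrightarrow> t - h \<in> {0..b} \<Longrightarrow> h < d \<Longrightarrow> f t < f (t - h)"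
    using has_real_derivative_neg_dec_left[OF assms(1)] by (metis not_le)
  define h where "h = min (d / 2) t"
  have "f t < f (t - h)" by (rule d(2)) (use d(1) assms in \<open>auto simp: h_def\<close>)
  then show False using assms(4)[of "t - h"] d(1) assms(2) by (auto simp: h_def min_def split: if_splits)
qed

lemma has_derivative_sqrt_one_plus:
  fixes z :: "'a::real_inner" assumes "c > 0"
  shows "((\<lambda>z. sqrt (c + z \<bullet> z)) has_derivative (\<lambda>h. (z \<bullet> h) / sqrt (c + z \<bullet> z))) (at z)"
proof -
  have p: "c + z \<bullet> z > 0" using assms by (simp add: add_pos_nonneg)
  have "((\<lambda>z. c + z \<bullet> z) has_derivative (\<lambda>h. 2 * (z \<bullet> h))) (at z)"
    by (auto intro!: derivative_eq_intros simp: inner_commute)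
  from has_derivative_real_sqrt[OF p this] show ?thesis by (simp add: field_simps)
qed

text \<open>The penalty \<open>\<epsilon> (sqrt (1 + z \<bullet> z) + (K + 1) t)\<close> forces a maximum to be attained and dominates
  the transport term. Only indices realizing the pointwise maximum need to satisfy the differential
  inequality, which makes the principle applicable to weakly coupled systems.\<close>

lemma transport_maximum_principle:
  fixes \<Psi> :: "'i::finite \<Rightarrow> real \<Rightarrow> 'a::euclidean_space \<Rightarrow> real"
  assumes cont: "\<And>i. continuous_on ({0..b} \<times> UNIV) (\<lambda>(t,z). \<Psi> i t z)"
    and bdd: "\<And>i t z. 0 \<le> t \<Longrightarrow> t \<le> b \<Longrightarrow> \<Psi> i t z \<le> M"
    and init: "\<And>i z. \<Psi> i 0 z \<le> 0"
    and dt: "\<And>i t z. 0 < t \<Longrightarrow> t \<le> b \<Longrightarrow> ((\<lambda>s. \<Psi> i s z) has_real_derivative \<Psi>t i t z) (at t within {0..b})"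
    and dz: "\<And>i t z. 0 < t \<Longrightarrow> t \<le> b \<Longrightarrow> (\<Psi> i t has_derivative D i t z) (at z)"
    and a: "\<And>i t z. 0 < t \<Longrightarrow> t \<le> b \<Longrightarrow> norm (a i t z) \<le> K"
    and ineq: "\<And>i t z. 0 < t \<Longrightarrow> t \<le> b \<Longrightarrow> \<Psi> i t z > 0 \<Longrightarrow> (\<And>j. \<Psi> j t z \<le> \<Psi> i t z) \<Longrightarrow>
       \<Psi>t i t z + D i t z (a i t z) \<le> C * \<Psi> i t z"
    and s: "0 \<le> s" "s \<le> b"
  shows "\<Psi> i s x \<le> 0"
proof (rule ccontr)
  assume "\<not> \<Psi> i s x \<le> 0"
  then have pos: "\<Psi> i s x > 0" by simp
  have "s \<noteq> 0" using init[of i x] pos by auto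
  then have K: "K \<ge> 0" using order_trans[OF norm_ge_zero a[of s i x]] s by auto
  define r where "r z = sqrt (1 + z \<bullet> z)" for z :: 'a
  have r: "norm z \<le> r z" "r z > 0" for z
  proof -
    show "norm z \<le> r z" unfolding r_def norm_eq_sqrt_inner by simp
    have "1 + z \<bullet> z > 0" by (simp add: add_pos_nonneg)
    then show "r z > 0" by (simp add: r_def)
  qed
  \<comment> \<open>Chosen so that at (s, x) the penalty eats exactly half of the weighted value,
    leaving \<Theta> positive there.\<close>
  define \<epsilon> where "\<epsilon> = exp (- C * s) * \<Psi> i s x / (2 * (r x + (K + 1) * s))"
  have den: "r x + (K + 1) * s > 0" using r(2)[of x] K s by (simp add: add_pos_nonneg)
  have \<epsilon>: "\<epsilon> > 0" using pos den by (simp add: \<epsilon>_def)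
  define \<Theta> where "\<Theta> i t z = exp (- C * t) * \<Psi> i t z - \<epsilon> * (r z + (K + 1) * t)" for i t z
  have \<Theta>pos: "\<Theta> i s x > 0"
  proof -
    have "p / (2 * y) * y = p / 2" if "y > 0" for p y :: real using that by simp
    from this[OF den] have "\<epsilon> * (r x + (K + 1) * s) = exp (- C * s) * \<Psi> i s x / 2" unfolding \<epsilon>_def .
    moreover have "exp (- C * s) * \<Psi> i s x > 0" using pos by simp
    ultimately show ?thesis unfolding \<Theta>_def by linarith
  qed
  define M' where "M' = exp (\<bar>C\<bar> * b) * \<bar>M\<bar>"
  have M': "exp (- C * t) * \<Psi> i t z \<le> M'" if "0 \<le> t" "t \<le> b" for i t z
  proof -
    have "- C * t \<le> \<bar>C\<bar> * t" "\<bar>C\<bar> * t \<le> \<bar>C\<bar> * b"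
      using that mult_right_mono[of "- C" "\<bar>C\<bar>" t] mult_left_mono[of t b "\<bar>C\<bar>"] by auto
    then have "- C * t \<le> \<bar>C\<bar> * b" by linarith
    then have "exp (- C * t) * \<bar>M\<bar> \<le> M'" unfolding M'_def by (intro mult_right_mono) auto
    moreover have "exp (- C * t) * \<Psi> i t z \<le> exp (- C * t) * \<bar>M\<bar>"
      using bdd[OF that, of i z] by (intro mult_left_mono) auto
    ultimately show ?thesis by linarith
  qed
  define R where "R = M' / \<epsilon>"
  \<comment> \<open>The penalty grows at least like |z| while the weighted values are bounded above,
    so \<Theta> is positive only in a fixed ball, and a maximum over a compact set is a global
    one.\<close>
  have out: "norm z \<le> R" if "0 \<le> t" "t \<le> b" "\<Theta> i t z > 0" for i t z
  proof -
    have "\<epsilon> * r z + \<epsilon> * ((K + 1) * t) < M'" using that M'[OF that(1,2), of i z] by (simp add: \<Theta>_def distrib_left)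
    moreover have "\<epsilon> * ((K + 1) * t) \<ge> 0" using \<epsilon> K that by simp
    ultimately have "r z < R" using \<epsilon> by (simp add: R_def less_divide_eq mult.commute)
    then show ?thesis using r(1)[of z] by linarith
  qed
  define S where "S = {0..b} \<times> cball (0::'a) R"
  have S: "compact S" "(s,x) \<in> S"
    using out[OF s \<Theta>pos] s by (auto simp: S_def intro!: compact_Times)
  have cont\<Theta>: "continuous_on S (\<lambda>p. \<Theta> j (fst p) (snd p))" for j
  proof -
    have "continuous_on S (\<lambda>p. \<Psi> j (fst p) (snd p))"
      using continuous_on_subset[OF cont[of j], of S] by (auto simp: S_def case_prod_unfold)
    then show ?thesis unfolding \<Theta>_def r_def by (intro continuous_intros)
  qed
  have "\<exists>p\<in>S. \<forall>q\<in>S. \<Theta> j (fst q) (snd q) \<le> \<Theta> j (fst p) (snd p)" for j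
    by (rule continuous_attains_sup[OF S(1) _ cont\<Theta>]) (use S in auto)
  then obtain p where p: "\<And>j. p j \<in> S" "\<And>j q. q \<in> S \<Longrightarrow> \<Theta> j (fst q) (snd q) \<le> \<Theta> j (fst (p j)) (snd (p j))" by metis
  obtain k where k: "\<And>j. \<Theta> j (fst (p j)) (snd (p j)) \<le> \<Theta> k (fst (p k)) (snd (p k))"
  proof -
    let ?g = "\<lambda>j. \<Theta> j (fst (p j)) (snd (p j))"
    have "Max (range ?g) \<in> range ?g" by (rule Max_in) auto
    then obtain k where k: "Max (range ?g) = ?g k" by (rule imageE)
    have "?g j \<le> ?g k" for j unfolding k[symmetric] by (rule Max_ge) auto
    then show thesis by (rule that)
  qed
  define t z where "t = fst (p k)" and "z = snd (p k)"
  have tz: "0 \<le> t" "t \<le> b" using p(1)[of k] by (auto simp: t_def S_def)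
  have \<Theta>k: "\<Theta> k t z > 0" using p(2)[OF S(2), of i] k[of i] \<Theta>pos by (simp add: t_def z_def)
  have max: "\<Theta> j q y \<le> \<Theta> k t z" if "0 \<le> q" "q \<le> b" for j q y
  proof (cases "\<Theta> j q y > 0")
    case True
    then have "(q,y) \<in> S" using out[OF that True] that by (simp add: S_def)
    from p(2)[OF this, of j] show ?thesis using k[of j] by (simp add: t_def z_def)
  qed (use \<Theta>k in auto)
  have pen: "\<epsilon> * (r z + (K + 1) * t) \<ge> 0" using \<epsilon> r(2)[of z] K tz by simp
  then have "exp (- C * t) * \<Psi> k t z > 0" using \<Theta>k unfolding \<Theta>_def by linarith
  then have \<Psi>k: "\<Psi> k t z > 0" by (simp add: zero_less_mult_iff)
  then have t0: "t > 0" using init[of k z] tz by (cases "t = 0") auto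
  \<comment> \<open>The penalty is the same for all indices, so the index maximizing \<Theta> also
    realizes the pointwise maximum of \<Psi>, as \<open>ineq\<close> demands.\<close>
  have top: "\<Psi> j t z \<le> \<Psi> k t z" for j
    using max[OF tz, of j z] by (simp add: \<Theta>_def)
  \<comment> \<open>At the maximum the time derivative of \<Theta> is nonnegative, also if t = b,
    and the gradient of the weighted \<Psi> equals that of the penalty, so the transport term is at
    least - \<epsilon> K. The time part of the penalty supplies \<epsilon> (K + 1); the surplus
    \<epsilon> contradicts \<open>ineq\<close>.\<close>
  have "exp (- C * t) * \<Psi>t k t z + exp (- C * t) * (- C) * \<Psi> k t z - \<epsilon> * (K + 1) \<ge> 0"
  proof (rule deriv_nonneg_of_left_max[OF _ t0 tz(2)])
    show "((\<lambda>s. \<Theta> k s z) has_real_derivative exp (- C * t) * \<Psi>t k t z + exp (- C * t) * (- C) * \<Psi> k t z - \<epsilon> * (K + 1)) (at t within {0..b})"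
      unfolding \<Theta>_def by (auto intro!: derivative_eq_intros dt[OF t0 tz(2)])
  qed (use max tz in auto)
  moreover have "(\<lambda>h. exp (- C * t) * D k t z h - \<epsilon> * ((z \<bullet> h) / r z)) = (\<lambda>h. 0)"
  proof (rule differential_zero_maxmin[of z UNIV])
    show "(\<Theta> k t has_derivative (\<lambda>h. exp (- C * t) * D k t z h - \<epsilon> * ((z \<bullet> h) / r z))) (at z)"
      unfolding \<Theta>_def r_def
      by (intro has_derivative_diff has_derivative_mult_right has_derivative_add_const dz[OF t0 tz(2)]
          has_derivative_sqrt_one_plus zero_less_one)
  qed (use max tz in auto)
  then have "exp (- C * t) * D k t z (a k t z) = \<epsilon> * ((z \<bullet> a k t z) / r z)" by (metis eq_iff_diff_eq_0)
  moreover have "\<epsilon> * ((z \<bullet> a k t z) / r z) \<ge> \<epsilon> * (- K)"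
  proof -
    have "\<bar>z \<bullet> a k t z\<bar> \<le> norm z * norm (a k t z)" by (rule Cauchy_Schwarz_ineq2)
    also have "\<dots> \<le> r z * K" using r[of z] a[OF t0 tz(2), of k z] by (intro mult_mono) auto
    finally have "(z \<bullet> a k t z) / r z \<ge> - K" using r(2)[of z] by (simp add: le_divide_eq mult.commute)
    then show ?thesis using \<epsilon> by (intro mult_left_mono) auto
  qed
  moreover have "exp (- C * t) * (\<Psi>t k t z + D k t z (a k t z) - C * \<Psi> k t z) \<le> 0"
    using ineq[OF t0 tz(2) \<Psi>k top] by (simp add: mult_le_0_iff)
  ultimately show False using \<epsilon> by (simp add: algebra_simps)
qed

section \<open>Uniqueness for diagonal systems and propagation of Lipschitz bounds\<close>

lemma diagonal_solution_C1: "diagonal_solution lam G T W Wt Wx \<Longrightarrow> C1_strip_with T (W i) (Wt i) (Wx i)"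
  by (simp add: diagonal_solution_def)

lemma diagonal_solution_eq:
  "diagonal_solution lam G T W Wt Wx \<Longrightarrow> 0 \<le> t \<Longrightarrow> t < T \<Longrightarrow> Wt i t x = G i (state W t x) - lam i (state W t x) * Wx i t x"
  unfolding diagonal_solution_def by (metis add_diff_cancel_right')

lemma strip_subset: "b < T \<Longrightarrow> {0..b} \<times> UNIV \<subseteq> strip T"
  by (auto simp: strip_def)

text \<open>The maximum principle is applied to the differences of all components with both signs,
  whose pointwise maximum is that of the |W i - V i|. At an index that realizes it, every other
  difference is bounded by \<Psi>, which closes the coupling.\<close>

lemma diagonal_uniqueness:
  fixes lam G :: "'n::finite \<Rightarrow> real ^ 'n \<Rightarrow> real"
  assumes lam: "\<And>i. c11 (lam i)" and G: "\<And>i. c11 (G i)"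
    and W: "diagonal_solution lam G T W Wt Wx" and V: "diagonal_solution lam G T V Vt Vx"
    and bd: "\<And>i t x. 0 \<le> t \<Longrightarrow> t < T \<Longrightarrow> \<bar>W i t x\<bar> \<le> K \<and> \<bar>V i t x\<bar> \<le> K \<and> \<bar>Vx i t x\<bar> \<le> K"
    and init: "\<And>i x. W i 0 x = V i 0 x"
    and b: "0 \<le> b" "b < T"
  shows "W i b x = V i b x"
proof -
  define N where "N = real CARD('n)"
  obtain Dl where "\<forall>R. \<exists>C\<ge>0. \<forall>i. c11_with (lam i) (Dl i) R C" using c11_family[of lam] lam by blast
  then obtain C1 where C1: "C1 \<ge> 0" "\<And>i. c11_with (lam i) (Dl i) (N * K) C1" by blast
  obtain DG where "\<forall>R. \<exists>C\<ge>0. \<forall>i. c11_with (G i) (DG i) R C" using c11_family[of G] G by blast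
  then obtain C2 where C2: "C2 \<ge> 0" "\<And>i. c11_with (G i) (DG i) (N * K) C2" by blast
  have K: "K \<ge> 0" using bd[of b undefined x] b by linarith
  have nW: "norm (state W t x) \<le> N * K" and nV: "norm (state V t x) \<le> N * K" if "0 \<le> t" "t < T" for t x
    unfolding N_def by (rule vec_norm_le_of_components, use bd that in simp)+
  define sg :: "bool \<Rightarrow> real" where "sg s = (if s then 1 else -1)" for s
  have sg: "\<bar>sg s\<bar> = 1" for s by (simp add: sg_def)
  let ?\<Psi> = "\<lambda>(i,s) t x. sg s * (W i t x - V i t x)"
  have "?\<Psi> is b x \<le> 0" for "is" x
  proof (rule transport_maximum_principle[where \<Psi> = ?\<Psi> and b = b and M = "2 * K" and K = C1
        and \<Psi>t = "\<lambda>(i,s) t x. sg s * (Wt i t x - Vt i t x)" and D = "\<lambda>(i,s) t x h. sg s * (Wx i t x - Vx i t x) * h"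
        and a = "\<lambda>(i,s) t x. lam i (state W t x)" and C = "(C2 + C1 * K) * N"])
    fix k :: "'n \<times> bool"
    obtain i s where k: "k = (i,s)" by (cases k)
    have "continuous_on ({0..b} \<times> UNIV) (\<lambda>(t,x). W i t x)" "continuous_on ({0..b} \<times> UNIV) (\<lambda>(t,x). V i t x)"
      using C1_strip_with_continuous(1)[OF diagonal_solution_C1[OF W]] C1_strip_with_continuous(1)[OF diagonal_solution_C1[OF V]]
        strip_subset[OF b(2)] continuous_on_subset by blast+
    then show "continuous_on ({0..b} \<times> UNIV) (\<lambda>(t,x). ?\<Psi> k t x)"
      unfolding k case_prod_unfold by (auto intro!: continuous_intros)
    show "?\<Psi> k 0 x \<le> 0" for x using init by (simp add: k)
    fix t x :: real
    show "?\<Psi> k t x \<le> 2 * K" if "0 \<le> t" "t \<le> b"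
      using bd[of t i x] that b by (auto simp: k sg_def)
    assume t: "0 < t" "t \<le> b"
    then have tT: "0 \<le> t" "t < T" using b by auto
    note l = c11_withD(2)[OF C1(2) nV[OF tT] nW[OF tT], of i x x] and g = c11_withD(2)[OF C2(2) nV[OF tT] nW[OF tT], of i x x]
    show "((\<lambda>t. ?\<Psi> k t x) has_real_derivative (case k of (i,s) \<Rightarrow> \<lambda>t x. sg s * (Wt i t x - Vt i t x)) t x) (at t within {0..b})"
      unfolding k using b tT
      by (auto intro!: derivative_eq_intros DERIV_subset[OF C1_strip_with_t[OF diagonal_solution_C1[OF W]]]
          DERIV_subset[OF C1_strip_with_t[OF diagonal_solution_C1[OF V]]])
    show "(?\<Psi> k t has_derivative (case k of (i,s) \<Rightarrow> \<lambda>t x h. sg s * (Wx i t x - Vx i t x) * h) t x) (at x)"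
    proof -
      have "((\<lambda>x. sg s * (W i t x - V i t x)) has_real_derivative sg s * (Wx i t x - Vx i t x)) (at x)"
        by (intro derivative_intros DERIV_cmult C1_strip_with_x[OF diagonal_solution_C1[OF W] tT] C1_strip_with_x[OF diagonal_solution_C1[OF V] tT])
      then show ?thesis by (simp add: k has_field_derivative_def)
    qed
    show "norm ((case k of (i,s) \<Rightarrow> \<lambda>t x. lam i (state W t x)) t x) \<le> C1"
      using c11_withD(1)[OF C1(2) nW[OF tT] nW[OF tT]] by (simp add: k)
    assume p: "?\<Psi> k t x > 0" and top: "\<And>j. ?\<Psi> j t x \<le> ?\<Psi> k t x"
    let ?d = "norm (state W t x - state V t x)" and ?P = "?\<Psi> k t x"
    have d: "?d \<le> N * ?P" unfolding N_def
    proof (rule vec_norm_le_of_components)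
      fix j show "\<bar>(state W t x - state V t x) $ j\<bar> \<le> ?P"
        using top[of "(j,True)"] top[of "(j,False)"] by (auto simp: sg_def)
    qed
    let ?L = "lam i (state W t x)"
    \<comment> \<open>The difference is transported with the speed of \<open>W\<close>; the mismatch
      of speeds multiplies \<open>Vx\<close>, whose bound turns it into a term of order
      zero.\<close>
    have "Wt i t x - Vt i t x + (Wx i t x - Vx i t x) * ?L
       = (G i (state W t x) - G i (state V t x)) - (?L - lam i (state V t x)) * Vx i t x"
      using diagonal_solution_eq[OF W tT, of i x] diagonal_solution_eq[OF V tT, of i x] by (simp add: algebra_simps)
    moreover have "\<bar>(?L - lam i (state V t x)) * Vx i t x\<bar> \<le> (C1 * ?d) * K"
      unfolding abs_mult by (rule mult_mono'[OF l]) (use bd[OF tT] in auto)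
    ultimately have "\<bar>Wt i t x - Vt i t x + (Wx i t x - Vx i t x) * ?L\<bar> \<le> C2 * ?d + C1 * ?d * K"
      using g by linarith
    also have "\<dots> = (C2 + C1 * K) * ?d" by (simp add: algebra_simps)
    also have "\<dots> \<le> (C2 + C1 * K) * (N * ?P)" using d C1(1) C2(1) K by (intro mult_left_mono) auto
    finally have "\<bar>sg s * (Wt i t x - Vt i t x + (Wx i t x - Vx i t x) * ?L)\<bar> \<le> (C2 + C1 * K) * N * ?P"
      by (simp add: abs_mult sg mult.assoc)
    then show "(case k of (i,s) \<Rightarrow> \<lambda>t x. sg s * (Wt i t x - Vt i t x)) t x
        + (case k of (i,s) \<Rightarrow> \<lambda>t x h. sg s * (Wx i t x - Vx i t x) * h) t x ((case k of (i,s) \<Rightarrow> \<lambda>t x. lam i (state W t x)) t x)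
        \<le> (C2 + C1 * K) * N * ?P"
      by (simp add: k algebra_simps)
  qed (use b in auto)
  from this[of "(i,True)" x] this[of "(i,False)" x] show ?thesis by (simp add: sg_def)
qed

text \<open>Doubling of variables: the modulus is compared with the regularized cone
  \<open>sqrt (\<theta>\<^sup>2 + (x - y)\<^sup>2)\<close>, so no derivative of the source in \<open>x\<close> is needed.\<close>

lemma transport_lipschitz:
  assumes g: "C1_strip_with T g gt gx"
    and pde: "\<And>t x. 0 \<le> t \<Longrightarrow> t < T \<Longrightarrow> gt t x + a t x * gx t x = H t x"
    and bd: "\<And>t x. 0 \<le> t \<Longrightarrow> t < T \<Longrightarrow> \<bar>g t x\<bar> \<le> K \<and> \<bar>a t x\<bar> \<le> K"
    and a: "\<And>t x y. 0 \<le> t \<Longrightarrow> t < T \<Longrightarrow> \<bar>a t x - a t y\<bar> \<le> M * \<bar>x - y\<bar>"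
    and H: "\<And>t x y. 0 \<le> t \<Longrightarrow> t < T \<Longrightarrow> \<bar>H t x - H t y\<bar> \<le> C * (\<bar>x - y\<bar> + \<bar>g t x - g t y\<bar>)"
    and init: "\<And>x y. \<bar>g 0 x - g 0 y\<bar> \<le> L * \<bar>x - y\<bar>"
    and M: "M \<ge> 0" and C: "C \<ge> 0"
  shows "\<exists>L'. \<forall>t x y. 0 \<le> t \<longrightarrow> t < T \<longrightarrow> \<bar>g t x - g t y\<bar> \<le> L' * \<bar>x - y\<bar>"
proof -
  \<comment> \<open>The growth rate of the barrier: the source needs one \<open>C\<close> for |x -
    y| and one for the part of |g x - g y| that is not \<Psi>, and \<open>M\<close> pays for the
    speed difference between the two points.\<close>
  define \<kappa> where "\<kappa> = 2 * C + M"
  \<comment> \<open>At least 1, so that |x - y| \<le> S \<le> \<Lambda> S.\<close>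
  define L1 where "L1 = \<bar>L\<bar> + 1"
  define \<Lambda> where "\<Lambda> t = L1 * exp (\<kappa> * t)" for t
  have \<kappa>: "\<kappa> \<ge> 0" using M C by (simp add: \<kappa>_def)
  have \<Lambda>1: "\<Lambda> t \<ge> 1" if "t \<ge> 0" for t
    unfolding \<Lambda>_def using \<kappa> that mult_mono[of 1 L1 1 "exp (\<kappa> * t)"] by (simp add: L1_def)
  have est: "g b x - g b y \<le> \<Lambda> b * sqrt (\<theta> + (x - y)\<^sup>2)" if b: "0 \<le> b" "b < T" and \<theta>: "\<theta> > 0" for b x y \<theta>
  proof -
    define S where "S z = sqrt (\<theta> + (fst z - snd z)\<^sup>2)" for z :: "real \<times> real"
    have Sp: "S z > 0" "\<bar>fst z - snd z\<bar> \<le> S z" for z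
    proof -
      have "\<theta> + (fst z - snd z)\<^sup>2 > 0" using \<theta> by (simp add: add_pos_nonneg)
      then show "S z > 0" by (simp add: S_def)
      have "sqrt ((fst z - snd z)\<^sup>2) \<le> S z" unfolding S_def using \<theta> by (intro real_sqrt_le_mono) simp
      then show "\<bar>fst z - snd z\<bar> \<le> S z" by simp
    qed
    have Sd: "(S has_derivative (\<lambda>h. (fst z - snd z) * (fst h - snd h) / S z)) (at z)" for z
    proof -
      have p: "\<theta> + (fst z - snd z)\<^sup>2 > 0" using \<theta> by (simp add: add_pos_nonneg)
      have h: "((\<lambda>z. \<theta> + (fst z - snd z)\<^sup>2) has_derivative (\<lambda>h. 2 * (fst z - snd z) * (fst h - snd h))) (at z)"
        by (auto intro!: derivative_eq_intros simp: fun_eq_iff algebra_simps)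
      have gen: "2 * d * k * (inverse s / 2) = d * k / s" for d k s :: real
        by (simp add: field_simps)
      show ?thesis unfolding S_def
        by (rule has_derivative_eq_rhs[OF has_derivative_real_sqrt[OF p h]]) (intro ext gen)
    qed
    define \<Psi> where "\<Psi> (i::unit) t z = g t (fst z) - g t (snd z) - \<Lambda> t * S z" for i t z
    have "\<Psi> () b (x,y) \<le> 0"
    proof (rule transport_maximum_principle[where \<Psi> = \<Psi> and b = b and M = "2 * K" and K = "2 * K" and C = C
          and \<Psi>t = "\<lambda>i t z. gt t (fst z) - gt t (snd z) - \<kappa> * \<Lambda> t * S z"
          and D = "\<lambda>i t z h. gx t (fst z) * fst h - gx t (snd z) * snd h - \<Lambda> t * ((fst z - snd z) * (fst h - snd h) / S z)"
          and a = "\<lambda>i t z. (a t (fst z), a t (snd z))"])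
      fix i :: unit
      have c: "continuous_on ({0..b} \<times> UNIV) (\<lambda>p. g (fst p) (snd p))"
        using continuous_on_subset[OF C1_strip_with_continuous(1)[OF g] strip_subset[OF b(2)]] by (simp add: case_prod_unfold)
      have "continuous_on ({0..b} \<times> (UNIV :: (real \<times> real) set)) (\<lambda>p. g (fst (fst p, fst (snd p))) (snd (fst p, fst (snd p))))"
           "continuous_on ({0..b} \<times> (UNIV :: (real \<times> real) set)) (\<lambda>p. g (fst (fst p, snd (snd p))) (snd (fst p, snd (snd p))))"
        by (rule continuous_on_compose2[OF c]; auto intro!: continuous_intros)+
      then show "continuous_on ({0..b} \<times> UNIV) (\<lambda>(t,z). \<Psi> i t z)"
        unfolding \<Psi>_def \<Lambda>_def S_def case_prod_unfold by (auto intro!: continuous_intros)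
      show "\<Psi> i 0 z \<le> 0" for z
      proof -
        have "g 0 (fst z) - g 0 (snd z) \<le> L * \<bar>fst z - snd z\<bar>" using init[of "fst z" "snd z"] by linarith
        also have "\<dots> \<le> L1 * S z" using Sp[of z] by (intro mult_mono) (auto simp: L1_def)
        finally show ?thesis by (simp add: \<Psi>_def \<Lambda>_def)
      qed
      fix t :: real and z :: "real \<times> real"
      show "\<Psi> i t z \<le> 2 * K" if "0 \<le> t" "t \<le> b"
      proof -
        have "\<Lambda> t * S z \<ge> 0" using \<Lambda>1[OF that(1)] Sp(1)[of z] by simp
        then show ?thesis using bd[of t "fst z"] bd[of t "snd z"] that b by (auto simp: \<Psi>_def abs_le_iff)
      qed
      assume t: "0 < t" "t \<le> b"
      then have tT: "0 \<le> t" "t < T" using b by auto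
      show "((\<lambda>s. \<Psi> i s z) has_real_derivative gt t (fst z) - gt t (snd z) - \<kappa> * \<Lambda> t * S z) (at t within {0..b})"
        unfolding \<Psi>_def \<Lambda>_def using b
        by (auto intro!: derivative_eq_intros DERIV_subset[OF C1_strip_with_t[OF g tT]])
      have gd: "((\<lambda>z. g t (p z)) has_derivative (\<lambda>h. gx t (p z) * p h)) (at z)" if "bounded_linear p" for p :: "real \<times> real \<Rightarrow> real"
        using has_derivative_compose[OF bounded_linear_imp_has_derivative[OF that], of "g t" "(*) (gx t (p z))" z UNIV]
          C1_strip_with_x[OF g tT, of "p z"] by (simp add: has_field_derivative_def)
      show "(\<Psi> i t has_derivative (\<lambda>h. gx t (fst z) * fst h - gx t (snd z) * snd h - \<Lambda> t * ((fst z - snd z) * (fst h - snd h) / S z))) (at z)"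
        unfolding \<Psi>_def
        by (intro has_derivative_diff has_derivative_mult_right Sd gd bounded_linear_fst bounded_linear_snd)
      show "norm (a t (fst z), a t (snd z)) \<le> 2 * K"
        using norm_Pair_le[of "a t (fst z)" "a t (snd z)"] bd[OF tT, of "fst z"] bd[OF tT, of "snd z"] by auto
      assume p: "\<Psi> i t z > 0"
      let ?x = "fst z" and ?y = "snd z"
      let ?D = "g t ?x - g t ?y"
      have \<Lambda>S: "\<Lambda> t * S z > 0" "S z \<le> \<Lambda> t * S z" using \<Lambda>1[OF tT(1)] Sp(1)[of z] by (auto simp: mult_le_cancel_right1)
      have D: "\<bar>?D\<bar> = \<Psi> i t z + \<Lambda> t * S z" using p \<Lambda>S by (simp add: \<Psi>_def)
      have "H t ?x - H t ?y \<le> C * (\<bar>?x - ?y\<bar> + \<bar>?D\<bar>)" using H[OF tT, of ?x ?y] by linarith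
      also have "\<dots> \<le> C * (\<Lambda> t * S z + (\<Psi> i t z + \<Lambda> t * S z))"
        unfolding D using order_trans[OF Sp(2)[of z] \<Lambda>S(2)] C by (intro mult_left_mono add_mono order_refl) auto
      finally have h1: "H t ?x - H t ?y \<le> C * (2 * (\<Lambda> t * S z)) + C * \<Psi> i t z" by (simp add: algebra_simps)
      have "- ((?x - ?y) * (a t ?x - a t ?y)) \<le> \<bar>?x - ?y\<bar> * (M * \<bar>?x - ?y\<bar>)"
        using mult_left_mono[OF a[OF tT, of ?x ?y], of "\<bar>?x - ?y\<bar>"] by (simp flip: abs_mult)
      also have "\<dots> \<le> S z * (M * S z)" using Sp[of z] M by (intro mult_mono mult_left_mono) auto
      finally have "- ((?x - ?y) * (a t ?x - a t ?y)) / S z \<le> M * S z"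
        using Sp(1)[of z] by (subst pos_divide_le_eq) (auto simp: ac_simps)
      then have "\<Lambda> t * (- ((?x - ?y) * (a t ?x - a t ?y)) / S z) \<le> \<Lambda> t * (M * S z)"
        using \<Lambda>1[OF tT(1)] by (intro mult_left_mono) auto
      then have h2: "- (\<Lambda> t * ((?x - ?y) * (a t ?x - a t ?y) / S z)) \<le> M * (\<Lambda> t * S z)" by (simp add: ac_simps)
      have "gt t ?x - gt t ?y - \<kappa> * \<Lambda> t * S z + (gx t ?x * a t ?x - gx t ?y * a t ?y - \<Lambda> t * ((?x - ?y) * (a t ?x - a t ?y) / S z))
        = (H t ?x - H t ?y) - \<kappa> * (\<Lambda> t * S z) - \<Lambda> t * ((?x - ?y) * (a t ?x - a t ?y) / S z)"
        using pde[OF tT, of ?x] pde[OF tT, of ?y] by (simp add: algebra_simps)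
      also have "\<dots> \<le> C * \<Psi> i t z"
      proof -
        have "\<kappa> * (\<Lambda> t * S z) = C * (2 * (\<Lambda> t * S z)) + M * (\<Lambda> t * S z)" by (simp add: \<kappa>_def algebra_simps)
        then show ?thesis using h1 h2 by linarith
      qed
      finally show "gt t ?x - gt t ?y - \<kappa> * \<Lambda> t * S z + (gx t ?x * fst (a t ?x, a t ?y) - gx t ?y * snd (a t ?x, a t ?y)
          - \<Lambda> t * ((?x - ?y) * (fst (a t ?x, a t ?y) - snd (a t ?x, a t ?y)) / S z)) \<le> C * \<Psi> i t z" by simp
    qed (use b in auto)
    then show ?thesis by (simp add: \<Psi>_def S_def)
  qed
  have "\<bar>g t x - g t y\<bar> \<le> (2 * (L1 * exp (\<kappa> * T))) * \<bar>x - y\<bar>" if t: "0 \<le> t" "t < T" for t x y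
  proof (cases "x = y")
    case False
    have le: "\<Lambda> t \<le> L1 * exp (\<kappa> * T)" unfolding \<Lambda>_def using t \<kappa> by (intro mult_left_mono) (auto simp: L1_def mult_left_mono)
    \<comment> \<open>The regularization is not sent to 0: the choice \<theta> = (x - y)^2 costs a
      factor sqrt 2, rounded up to 2.\<close>
    have "sqrt ((x - y)\<^sup>2 + (x - y)\<^sup>2) \<le> sqrt ((2 * \<bar>x - y\<bar>)\<^sup>2)"
      by (intro real_sqrt_le_mono) (simp add: power_mult_distrib)
    then have s: "sqrt ((x - y)\<^sup>2 + (x - y)\<^sup>2) \<le> 2 * \<bar>x - y\<bar>" unfolding real_sqrt_abs abs_mult abs_abs abs_numeral .
    have "\<Lambda> t * sqrt ((x - y)\<^sup>2 + (x - y)\<^sup>2) \<le> (L1 * exp (\<kappa> * T)) * (2 * \<bar>x - y\<bar>)"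
      using s le \<Lambda>1[OF t(1)] by (intro mult_mono) auto
    moreover have "(x - y)\<^sup>2 > 0" "(y - x)\<^sup>2 = (x - y)\<^sup>2" using False by (auto simp: power2_commute)
    then have "g t x - g t y \<le> \<Lambda> t * sqrt ((x - y)\<^sup>2 + (x - y)\<^sup>2)"
      "g t y - g t x \<le> \<Lambda> t * sqrt ((x - y)\<^sup>2 + (x - y)\<^sup>2)"
      using est[OF t, of "(x - y)\<^sup>2" x y] est[OF t, of "(x - y)\<^sup>2" y x] by simp_all
    ultimately have "g t x - g t y \<le> (L1 * exp (\<kappa> * T)) * (2 * \<bar>x - y\<bar>)"
      "g t y - g t x \<le> (L1 * exp (\<kappa> * T)) * (2 * \<bar>x - y\<bar>)" by linarith+
    then show ?thesis by (simp add: abs_le_iff ac_simps)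
  qed simp
  then show ?thesis by blast
qed

section \<open>Spatial averages and the vanishing of the defect\<close>

lemma strip_compose_continuous:
  assumes "continuous_on (strip T) (\<lambda>(t,x). g t x)" "continuous_on S p" "continuous_on S q"
    "\<And>z. z \<in> S \<Longrightarrow> 0 \<le> p z \<and> p z < T"
  shows "continuous_on S (\<lambda>z. g (p z) (q z))"
proof -
  have "continuous_on S (\<lambda>z. (p z, q z))" using assms by (intro continuous_intros)
  moreover have "(\<lambda>z. (p z, q z)) ` S \<subseteq> strip T" using assms(4) by (auto simp: strip_def)
  ultimately have "continuous_on S (\<lambda>z. case (p z, q z) of (t,x) \<Rightarrow> g t x)"
    using continuous_on_compose2[OF assms(1), of S "\<lambda>z. (p z, q z)"] by blast
  then show ?thesis by simp
qed

lemma integral_segment_derivative: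
  fixes F :: "real \<Rightarrow> real"
  assumes "\<And>y. (F has_real_derivative F' y) (at y)" "h \<noteq> 0"
  shows "integral {0..1} (\<lambda>s. F' (x + s * h)) = (F (x + h) - F x) / h"
proof -
  have "((\<lambda>s. F' (x + s * h)) has_integral (F (x + 1 * h) / h - F (x + 0 * h) / h)) {0..1}"
  proof (rule fundamental_theorem_of_calculus)
    fix s :: real
    have "((\<lambda>s. F (x + s * h)) has_real_derivative F' (x + s * h) * h) (at s within {0..1})"
      by (rule DERIV_chain2[OF assms(1)]) (auto intro!: derivative_eq_intros)
    from DERIV_cdivide[OF this, of h] assms(2)
    have "((\<lambda>s. F (x + s * h) / h) has_real_derivative F' (x + s * h)) (at s within {0..1})" by simp
    then show "((\<lambda>s. F (x + s * h) / h) has_vector_derivative F' (x + s * h)) (at s within {0..1})"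
      by (simp add: has_real_derivative_iff_has_vector_derivative)
  qed simp
  then show ?thesis by (simp add: integral_unique diff_divide_distrib)
qed

lemma segment_average_limit:
  fixes k :: "real \<Rightarrow> real"
  assumes k: "continuous_on UNIV k"
  shows "((\<lambda>h. integral {0..1} (\<lambda>s. k (x + s * h))) \<longlongrightarrow> k x) (at_right (0::real))"
proof (rule tendstoI)
  fix e :: real assume e: "e > 0"
  have "isCont k x" using k by (simp add: continuous_on_eq_continuous_at)
  then obtain d where d: "d > 0" "\<And>y. \<bar>y - x\<bar> < d \<Longrightarrow> \<bar>k y - k x\<bar> < e / 2"
    using half_gt_zero[OF e] unfolding continuous_at_eps_delta dist_real_def by blast
  have "\<bar>integral {0..1} (\<lambda>s. k (x + s * h)) - k x\<bar> < e" if h: "0 < h" "h < d" for h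
  proof -
    have near: "\<bar>k (x + s * h) - k x\<bar> \<le> e / 2" if "s \<in> {0..1}" for s
    proof -
      have "s * h \<le> 1 * h" "s * h \<ge> 0" using that h by (auto intro!: mult_right_mono)
      then have "\<bar>x + s * h - x\<bar> < d" using h by linarith
      then show ?thesis using d(2) by (simp add: less_imp_le)
    qed
    have "\<bar>integral {0..1} (\<lambda>s. k (x + s * h)) - integral {0..1} (\<lambda>s::real. k x)\<bar> \<le> e / 2 * (1 - 0)"
    proof (rule integral_diff_bound)
      show "continuous_on {0..1} (\<lambda>s. k (x + s * h))"
        by (rule continuous_on_compose2[OF k]) (auto intro!: continuous_intros)
    qed (use near in auto)
    then show ?thesis using e by simp
  qed
  then show "\<forall>\<^sub>F h in at_right 0. dist (integral {0..1} (\<lambda>s. k (x + s * h))) (k x) < e"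
    unfolding eventually_at_right_field dist_real_def using d(1) by blast
qed

text \<open>With \<open>\<delta> = u\<^sub>x + g\<close>, the hypotheses say \<open>\<delta>\<^sub>t + (u \<delta>)\<^sub>x = O(\<delta>)\<close> in integrated form; \<open>\<delta>\<close> itself is
  merely continuous. The averages of \<open>\<delta>\<close> over \<open>[x, x + h]\<close> are differentiable and obey a
  transport equation, to which the maximum principle applies uniformly in \<open>h\<close>.\<close>

lemma conservation_law_zero:
  assumes u: "C1_strip_with T u ut ux" and g: "C1_strip_with T g gt gx"
    and P: "\<And>t x. 0 \<le> t \<Longrightarrow> t < T \<Longrightarrow> (P t has_real_derivative Px t x) (at x)"
    and Px: "continuous_on (strip T) (\<lambda>(t,x). Px t x)"
    and bal1: "\<And>t x. 0 \<le> t \<Longrightarrow> t < T \<Longrightarrow> ut t x + P t x = - (u t x * (ux t x + g t x))"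
    and bal2: "\<And>t x. 0 \<le> t \<Longrightarrow> t < T \<Longrightarrow> \<bar>gt t x - Px t x\<bar> \<le> Kc * \<bar>ux t x + g t x\<bar>"
    and bd: "\<And>t x. 0 \<le> t \<Longrightarrow> t < T \<Longrightarrow> \<bar>u t x\<bar> \<le> K \<and> \<bar>ux t x\<bar> \<le> K \<and> \<bar>ux t x + g t x\<bar> \<le> K"
    and Kc: "Kc \<ge> 0" and init: "\<And>x. ux 0 x + g 0 x = 0"
    and b: "0 \<le> b" "b < T"
  shows "ux b x + g b x = 0"
proof -
  define \<delta> where "\<delta> t x = ux t x + g t x" for t x
  \<comment> \<open>With this rate the derivative of \<open>S / 2 * exp (\<kappa> * t)\<close>
    equals (K + Kc) S exp (\<kappa> t), the size of the errors in the transport equation of the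
    averages when |\<delta>| \<le> S exp (\<kappa> t).\<close>
  define \<kappa> where "\<kappa> = 2 * (K + Kc)"
  have K: "K \<ge> 0" using bd[of b x] b by linarith
  note uc = C1_strip_with_continuous[OF u] and gc = C1_strip_with_continuous[OF g]
  note comp = strip_compose_continuous[OF uc(1)] strip_compose_continuous[OF uc(3)]
    strip_compose_continuous[OF gc(1)] strip_compose_continuous[OF gc(2)] strip_compose_continuous[OF gc(3)]
  have \<delta>c: "continuous_on (strip T) (\<lambda>(t,x). \<delta> t x)"
    unfolding \<delta>_def case_prod_unfold
    by (intro continuous_on_add comp continuous_intros) (auto simp: strip_def)
  note \<delta>comp = strip_compose_continuous[OF \<delta>c]
  have improve: "\<bar>\<delta> t x\<bar> \<le> S / 2 * exp (\<kappa> * t)"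
    if S: "\<And>t x. 0 \<le> t \<Longrightarrow> t \<le> b \<Longrightarrow> \<bar>\<delta> t x\<bar> \<le> S * exp (\<kappa> * t)" and t: "0 \<le> t" "t \<le> b" for S t x
  proof -
    have S0: "S \<ge> 0" using S[of 0 x] b by simp
    have avg: "\<bar>integral {0..1} (\<lambda>s. \<delta> q (x + s * h))\<bar> \<le> S / 2 * exp (\<kappa> * q)"
      if q: "0 \<le> q" "q \<le> b" and h: "h > 0" for q x h
    proof -
      \<comment> \<open>The average of \<delta> over [x, x + h], with the integral of
        \<open>ux\<close> evaluated as a difference quotient of \<open>u\<close>; in this form it is
        differentiable in t and x.\<close>
      define N where "N t x = (u t (x + h) - u t x) / h + integral {0..1} (\<lambda>s. g t (x + s * h))" for t x
      have cont: "continuous_on {0..1} (\<lambda>s. k t (x + s * h))"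
        if "continuous_on (strip T) (\<lambda>(t,x). k t x)" "0 \<le> t" "t \<le> b" for k t x
        by (rule strip_compose_continuous[OF that(1)]) (use that b in \<open>auto intro!: continuous_intros\<close>)
      have N: "N t x = integral {0..1} (\<lambda>s. \<delta> t (x + s * h))" if "0 \<le> t" "t \<le> b" for t x
      proof -
        have "integral {0..1} (\<lambda>s. \<delta> t (x + s * h)) = integral {0..1} (\<lambda>s. ux t (x + s * h)) + integral {0..1} (\<lambda>s. g t (x + s * h))"
          unfolding \<delta>_def
          by (intro Henstock_Kurzweil_Integration.integral_add integrable_continuous_real cont[OF uc(3)] cont[OF gc(1)] that)
        also have "integral {0..1} (\<lambda>s. ux t (x + s * h)) = (u t (x + h) - u t x) / h"
          by (rule integral_segment_derivative[OF C1_strip_with_x[OF u]]) (use that b h in auto)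
        finally show ?thesis by (simp add: N_def)
      qed
      define sg :: "bool \<Rightarrow> real" where "sg s = (if s then 1 else -1)" for s
      have sg: "\<bar>sg s\<bar> = 1" for s by (simp add: sg_def)
      define Nt where "Nt t x = (ut t (x + h) - ut t x) / h + integral {0..1} (\<lambda>s. gt t (x + s * h))" for t x
      define Nx where "Nx t x = (ux t (x + h) - ux t x) / h + integral {0..1} (\<lambda>s. gx t (x + s * h))" for t x
      define \<Psi> where "\<Psi> s t x = sg s * N t x - S / 2 * exp (\<kappa> * t)" for s t x
      have "\<Psi> s q x \<le> 0" for s
      proof (rule transport_maximum_principle[where \<Psi> = \<Psi> and b = b and M = K and K = K and C = 0
            and \<Psi>t = "\<lambda>s t x. sg s * Nt t x - S / 2 * (\<kappa> * exp (\<kappa> * t))"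
            and D = "\<lambda>s t x k. sg s * Nx t x * k" and a = "\<lambda>s t x. u t x"])
        fix s
        show "continuous_on ({0..b} \<times> UNIV) (\<lambda>(t,x). \<Psi> s t x)"
        proof -
          have "continuous_on ({0..b} \<times> UNIV) (\<lambda>z::real\<times>real. integral (cbox 0 1) (\<lambda>s. g (fst z) (snd z + s * h)))"
            by (rule integral_continuous_on_param)
              (unfold case_prod_unfold, intro comp continuous_intros, use b in auto)
          then have "continuous_on ({0..b} \<times> UNIV) (\<lambda>z::real\<times>real. N (fst z) (snd z))"
            unfolding N_def using h
            by (intro continuous_on_add continuous_on_divide continuous_on_diff comp continuous_intros) (use b in auto)
          then show ?thesis unfolding \<Psi>_def case_prod_unfold by (intro continuous_intros)
        qed
        have N0: "N 0 x = 0" for x using N[of 0 x] b by (simp add: \<delta>_def init)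
        then show "\<Psi> s 0 x \<le> 0" for x using S0 by (simp add: \<Psi>_def)
        fix t x :: real
        show "\<Psi> s t x \<le> K" if t: "0 \<le> t" "t \<le> b"
        proof -
          have "\<bar>integral {0..1} (\<lambda>s. \<delta> t (x + s * h))\<bar> \<le> K * (1 - 0)"
            by (rule integral_abs_bound[OF cont[OF \<delta>c t]]) (use bd t b in \<open>auto simp: \<delta>_def\<close>)
          then have "\<bar>sg s * N t x\<bar> \<le> K" by (simp add: N[OF t] abs_mult sg)
          moreover have "S / 2 * exp (\<kappa> * t) \<ge> 0" using S0 by simp
          ultimately show ?thesis unfolding \<Psi>_def by linarith
        qed
        assume t: "0 < t" "t \<le> b"
        then have tb: "0 \<le> t" "t \<le> b" and tT: "0 \<le> t" "t < T" using b by auto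
        have dN: "((\<lambda>t. N t x) has_real_derivative Nt t x) (at t within {0..b})"
        proof -
          have "((\<lambda>t. integral (cbox 0 1) (\<lambda>s. g t (x + s * h))) has_real_derivative integral (cbox 0 1) (\<lambda>s. gt t (x + s * h))) (at t within {0..b})"
          proof (rule leibniz_rule_field_derivative)
            show "((\<lambda>t. g t (x + s * h)) has_real_derivative gt t (x + s * h)) (at t within {0..b})" if "t \<in> {0..b}" for t s
              by (rule DERIV_subset[OF C1_strip_with_t[OF g]]) (use that b in auto)
            show "(\<lambda>s. g t (x + s * h)) integrable_on cbox 0 1" if "t \<in> {0..b}" for t
              using cont[OF gc(1), of t x] that by (auto intro!: integrable_continuous_real)
            show "continuous_on ({0..b} \<times> cbox 0 1) (\<lambda>(t,s). gt t (x + s * h))"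
              unfolding case_prod_unfold by (intro comp continuous_intros) (use b in auto)
          qed (use t in auto)
          moreover have "((\<lambda>t. u t y) has_real_derivative ut t y) (at t within {0..b})" for y
            by (rule DERIV_subset[OF C1_strip_with_t[OF u tT]]) (use b in auto)
          ultimately show ?thesis unfolding N_def Nt_def by (intro DERIV_add DERIV_cdivide DERIV_diff) auto
        qed
        show "((\<lambda>t. \<Psi> s t x) has_real_derivative sg s * Nt t x - S / 2 * (\<kappa> * exp (\<kappa> * t))) (at t within {0..b})"
          unfolding \<Psi>_def by (auto intro!: derivative_eq_intros dN)
        have dNx: "(N t has_real_derivative Nx t x) (at x)"
        proof -
          have "((\<lambda>x. integral (cbox 0 1) (\<lambda>s. g t (x + s * h))) has_real_derivative integral (cbox 0 1) (\<lambda>s. gx t (x + s * h))) (at x within UNIV)"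
          proof (rule leibniz_rule_field_derivative)
            show "((\<lambda>x. g t (x + s * h)) has_real_derivative gx t (x + s * h)) (at x within UNIV)" for x s
              using C1_strip_with_x[OF g tT, of "x + s * h"] by (simp add: DERIV_shift)
            show "(\<lambda>s. g t (x + s * h)) integrable_on cbox 0 1" for x
              using cont[OF gc(1) tb] by (auto intro!: integrable_continuous_real)
            show "continuous_on (UNIV \<times> cbox 0 1) (\<lambda>(x,s). gx t (x + s * h))"
              unfolding case_prod_unfold by (intro comp continuous_intros) (use tT in auto)
          qed auto
          moreover have "((\<lambda>x. u t (x + h)) has_real_derivative ux t (x + h)) (at x)"
            using C1_strip_with_x[OF u tT, of "x + h"] by (simp add: DERIV_shift)
          ultimately show ?thesis
            unfolding N_def Nx_def by (intro DERIV_add DERIV_cdivide DERIV_diff C1_strip_with_x[OF u tT]) auto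
        qed
        show "(\<Psi> s t has_derivative (\<lambda>k. sg s * Nx t x * k)) (at x)"
          using DERIV_diff[OF DERIV_cmult[OF dNx, of "sg s"] DERIV_const[of "S / 2 * exp (\<kappa> * t)"]]
          by (simp add: \<Psi>_def[abs_def] has_field_derivative_def)
        show "norm (u t x) \<le> K" using bd tT by simp
        let ?I = "integral {0..1} (\<lambda>s. gt t (x + s * h) - Px t (x + s * h))"
        let ?E = "S * exp (\<kappa> * t)"
        have I: "\<bar>?I\<bar> \<le> Kc * ?E * (1 - 0)"
        proof (rule integral_abs_bound)
          show "continuous_on {0..1} (\<lambda>s. gt t (x + s * h) - Px t (x + s * h))"
            by (intro continuous_on_diff cont[OF gc(2)] cont[OF Px] tb)
          fix s :: real
          have "\<bar>gt t (x + s * h) - Px t (x + s * h)\<bar> \<le> Kc * \<bar>\<delta> t (x + s * h)\<bar>" using bal2[OF tT] by (simp add: \<delta>_def)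
          also have "\<dots> \<le> Kc * ?E" using S[OF tb] Kc by (intro mult_left_mono) auto
          finally show "\<bar>gt t (x + s * h) - Px t (x + s * h)\<bar> \<le> Kc * ?E" .
        qed simp
        have "?I = integral {0..1} (\<lambda>s. gt t (x + s * h)) - integral {0..1} (\<lambda>s. Px t (x + s * h))"
          by (intro Henstock_Kurzweil_Integration.integral_diff integrable_continuous_real cont[OF gc(2)] cont[OF Px] tb)
        also have "integral {0..1} (\<lambda>s. Px t (x + s * h)) = (P t (x + h) - P t x) / h"
          by (rule integral_segment_derivative[OF P[OF tT]]) (use h in auto)
        finally have It: "integral {0..1} (\<lambda>s. gt t (x + s * h)) = ?I + (P t (x + h) - P t x) / h" by simp
        have Ix: "integral {0..1} (\<lambda>s. gx t (x + s * h)) = (g t (x + h) - g t x) / h"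
          by (rule integral_segment_derivative[OF C1_strip_with_x[OF g tT]]) (use h in auto)
        have Pe: "P t y = - (u t y * \<delta> t y) - ut t y" for y using bal1[OF tT, of y] by (simp add: \<delta>_def)
        \<comment> \<open>The balance laws make the time derivative \<open>?I\<close> minus the
          difference quotient of u \<delta>. The discrete product rule splits off the transport term
          and leaves \<delta> at \<open>x + h\<close> undifferentiated.\<close>
        have e1: "Nt t x + Nx t x * u t x = ?I - (u t (x + h) - u t x) / h * \<delta> t (x + h)"
          unfolding Nt_def Nx_def It Ix Pe using h by (simp add: \<delta>_def field_simps)
        have e2: "\<bar>(u t (x + h) - u t x) / h * \<delta> t (x + h)\<bar> \<le> K * ?E"
        proof -
          have "\<bar>u t (x + h) - u t x\<bar> \<le> K * \<bar>x + h - x\<bar>"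
            using field_differentiable_bound[of UNIV "u t" "ux t" K "x + h" x] C1_strip_with_x[OF u tT] bd[OF tT] by auto
          then have "\<bar>(u t (x + h) - u t x) / h\<bar> \<le> K" using h by (simp add: divide_le_eq)
          then show ?thesis unfolding abs_mult by (rule mult_mono') (use S[OF tb] in auto)
        qed
        have "\<bar>Nt t x + Nx t x * u t x\<bar> \<le> Kc * ?E * (1 - 0) + K * ?E"
          unfolding e1 by (rule order_trans[OF abs_triangle_ineq4 add_mono[OF I e2]])
        then have "\<bar>Nt t x + Nx t x * u t x\<bar> \<le> (K + Kc) * ?E" by (simp add: algebra_simps)
        then have "\<bar>sg s * (Nt t x + Nx t x * u t x)\<bar> \<le> (K + Kc) * ?E" by (simp add: abs_mult sg)
        moreover have "S / 2 * (\<kappa> * exp (\<kappa> * t)) = (K + Kc) * ?E" by (simp add: \<kappa>_def)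
        moreover have "sg s * Nt t x + sg s * Nx t x * u t x = sg s * (Nt t x + Nx t x * u t x)" by (simp add: algebra_simps)
        ultimately show "sg s * Nt t x - S / 2 * (\<kappa> * exp (\<kappa> * t)) + sg s * Nx t x * u t x \<le> 0 * \<Psi> s t x"
          by linarith
      qed (use q in auto)
      from this[of True] this[of False] show ?thesis
        by (simp add: \<Psi>_def sg_def N[OF q] abs_le_iff)
    qed
    have "continuous_on UNIV (\<delta> t)"
      by (intro \<delta>comp continuous_intros) (use t b in auto)
    then have lim: "((\<lambda>h. \<bar>integral {0..1} (\<lambda>s. \<delta> t (x + s * h))\<bar>) \<longlongrightarrow> \<bar>\<delta> t x\<bar>) (at_right 0)"
      by (intro tendsto_rabs segment_average_limit)
    show ?thesis
      by (rule tendsto_upperbound[OF lim])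
        (use avg[OF t] in \<open>auto simp: eventually_at_right_field intro!: exI[of _ 1]\<close>)
  qed
  \<comment> \<open>The bounds of this weighted defect are the numbers S that \<open>improve\<close>
    halves, so absorption with K = 0 makes it vanish.\<close>
  define \<phi> where "\<phi> p = \<bar>\<delta> (fst p) (snd p)\<bar> * exp (- \<kappa> * fst p)" for p
  have iff: "\<phi> (t,x) \<le> S \<longleftrightarrow> \<bar>\<delta> t x\<bar> \<le> S * exp (\<kappa> * t)" for t x S
    by (simp add: \<phi>_def exp_minus field_simps)
  have "\<phi> (b,x) \<le> 2 * 0"
  proof (rule le_double_if_half_improving[where S = "{0..b} \<times> UNIV" and \<phi> = \<phi> and s = "(b,x)"])
    fix p :: "real \<times> real" assume p: "p \<in> {0..b} \<times> UNIV"
    have "\<kappa> \<ge> 0" using K Kc by (simp add: \<kappa>_def)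
    then have "exp (- \<kappa> * fst p) \<le> 1" using p by auto
    moreover have "\<bar>\<delta> (fst p) (snd p)\<bar> \<le> K" using bd[of "fst p" "snd p"] p b by (auto simp: \<delta>_def)
    ultimately have "\<phi> p \<le> K * 1" unfolding \<phi>_def using K by (intro mult_mono) auto
    then show "\<phi> p \<le> K" by simp
  next
    fix S and p :: "real \<times> real" assume S: "\<And>s. s \<in> {0..b} \<times> UNIV \<Longrightarrow> \<phi> s \<le> S" and p: "p \<in> {0..b} \<times> UNIV"
    have "\<bar>\<delta> t x\<bar> \<le> S * exp (\<kappa> * t)" if "0 \<le> t" "t \<le> b" for t x
      using S[of "(t,x)"] that iff by auto
    from improve[OF this, of "fst p" "snd p"] p show "\<phi> p \<le> 0 + S / 2"
      using iff[of "fst p" "snd p" "S / 2"] by auto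
  qed (use b in auto)
  then show ?thesis by (simp add: \<phi>_def \<delta>_def mult_le_0_iff)
qed

section \<open>Continuation of diagonal solutions\<close>

lemma C1_strip_with_cong:
  assumes g: "C1_strip_with T g gt gx" and eq: "\<And>t x. 0 \<le> t \<Longrightarrow> t < T \<Longrightarrow> g' t x = g t x"
  shows "C1_strip_with T g' gt gx"
  unfolding C1_strip_with_def
proof (intro conjI allI impI)
  fix t x assume t: "0 \<le> t \<and> t < T"
  show "((\<lambda>(s,y). g' s y) has_derivative (\<lambda>(h,k). gt t x * h + gx t x * k)) (at (t,x) within strip T)"
    by (rule has_derivative_transform[where f = "\<lambda>(s,y). g s y"])
       (use g t eq in \<open>auto simp: strip_def C1_strip_with_def\<close>)
qed (use g in \<open>auto simp: C1_strip_with_def\<close>)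

lemma diagonal_solution_restrict:
  assumes W: "diagonal_solution lam G T W Wt Wx" and "T' \<le> T"
  shows "diagonal_solution lam G T' W Wt Wx"
  unfolding diagonal_solution_def
proof (intro conjI allI impI)
  fix i
  have sub: "strip T' \<subseteq> strip T" using assms(2) by (auto simp: strip_def)
  show "C1_strip_with T' (W i) (Wt i) (Wx i)"
    unfolding C1_strip_with_def
  proof (intro conjI allI impI)
    fix t x assume t: "0 \<le> t \<and> t < T'"
    then have "((\<lambda>(s,y). W i s y) has_derivative (\<lambda>(h,k). Wt i t x * h + Wx i t x * k)) (at (t,x) within strip T)"
      using diagonal_solution_C1[OF W, of i] assms(2) unfolding C1_strip_with_def by auto
    then show "((\<lambda>(s,y). W i s y) has_derivative (\<lambda>(h,k). Wt i t x * h + Wx i t x * k)) (at (t,x) within strip T')"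
      by (rule has_derivative_subset[OF _ sub])
  qed (use C1_strip_with_continuous[OF diagonal_solution_C1[OF W]] continuous_on_subset[OF _ sub] in blast)+
qed (use W assms(2) in \<open>auto simp: diagonal_solution_def\<close>)

lemma diagonal_solution_shift:
  assumes W: "diagonal_solution lam G T W Wt Wx" and t0: "0 \<le> t0" "t0 < T"
  shows "diagonal_solution lam G (T - t0) (\<lambda>i t. W i (t0 + t)) (\<lambda>i t. Wt i (t0 + t)) (\<lambda>i t. Wx i (t0 + t))"
  unfolding diagonal_solution_def
proof (intro conjI allI impI)
  fix i
  note C1 = diagonal_solution_C1[OF W, of i]
  show "C1_strip_with (T - t0) (\<lambda>t. W i (t0 + t)) (\<lambda>t. Wt i (t0 + t)) (\<lambda>t. Wx i (t0 + t))"
  proof (rule C1_strip_withI)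
    fix t x assume t: "0 \<le> t" "t < T - t0"
    have "((\<lambda>s. W i s x) has_real_derivative Wt i (t0 + t) x) (at (t0 + t) within (+) t0 ` {0..<T - t0})"
      by (rule DERIV_subset[OF C1_strip_with_t[OF C1]]) (use t t0 in auto)
    then show "((\<lambda>s. W i (t0 + s) x) has_real_derivative Wt i (t0 + t) x) (at t within {0..<T - t0})"
      by (simp only: DERIV_at_within_shift)
    show "(W i (t0 + t) has_real_derivative Wx i (t0 + t) x) (at x)"
      by (rule C1_strip_with_x[OF C1]) (use t t0 in auto)
  next
    show "continuous_on (strip (T - t0)) (\<lambda>(t,x). Wt i (t0 + t) x)" "continuous_on (strip (T - t0)) (\<lambda>(t,x). Wx i (t0 + t) x)"
      unfolding case_prod_unfold
      by (rule strip_compose_continuous[OF C1_strip_with_continuous(2)[OF C1]] strip_compose_continuous[OF C1_strip_with_continuous(3)[OF C1]];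
          use t0 in \<open>auto intro!: continuous_intros simp: strip_def\<close>)+
  qed
next
  fix i t x assume t: "0 \<le> t" "t < T - t0"
  have "state (\<lambda>i t. W i (t0 + t)) t x = state W (t0 + t) x" by (simp add: state_def)
  then show "Wt i (t0 + t) x + lam i (state (\<lambda>i t. W i (t0 + t)) t x) * Wx i (t0 + t) x = G i (state (\<lambda>i t. W i (t0 + t)) t x)"
    using diagonal_solution_eq[OF W, of "t0 + t" i x] t t0 by simp
qed

text \<open>The pieces agree on an overlap of positive length, so near every time one of them alone
  describes the glued function. At \<open>T1\<close> that is \<open>V\<close>, for which
  \<open>T1 - t0\<close> is an interior time.\<close>

lemma C1_strip_with_glue:
  assumes W: "C1_strip_with T1 W Wt Wx" and V: "C1_strip_with \<tau> V Vt Vx"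
    and t0: "0 \<le> t0" "t0 < T1" "T1 < t0 + \<tau>"
    and eq: "\<And>t x. t0 \<le> t \<Longrightarrow> t < T1 \<Longrightarrow> W t x = V (t - t0) x \<and> Wt t x = Vt (t - t0) x \<and> Wx t x = Vx (t - t0) x"
  shows "C1_strip_with (t0 + \<tau>) (\<lambda>t. if t < T1 then W t else V (t - t0))
      (\<lambda>t. if t < T1 then Wt t else Vt (t - t0)) (\<lambda>t. if t < T1 then Wx t else Vx (t - t0))"
proof -
  have glue: "continuous_on (strip (t0 + \<tau>)) (\<lambda>(t,x). (if t < T1 then w t else v (t - t0)) x)"
    if w: "continuous_on (strip T1) (\<lambda>(t,x). w t x)" and v: "continuous_on (strip \<tau>) (\<lambda>(t,x). v t x)"
      and wv: "\<And>t x. t0 \<le> t \<Longrightarrow> t < T1 \<Longrightarrow> w t x = v (t - t0) x" for w v :: "real \<Rightarrow> real \<Rightarrow> real"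
  proof -
    let ?f = "\<lambda>(t,x). (if t < T1 then w t else v (t - t0)) x"
    let ?B = "{t0<..<t0 + \<tau>} \<times> (UNIV :: real set)"
    have un: "strip (t0 + \<tau>) = strip T1 \<union> ?B" using t0 by (auto simp: strip_def)
    have "strip T1 = strip (t0 + \<tau>) \<inter> {..<T1} \<times> UNIV" "?B = strip (t0 + \<tau>) \<inter> {t0<..} \<times> UNIV"
      using t0 by (auto simp: strip_def)
    then have op: "openin (top_of_set (strip T1 \<union> ?B)) (strip T1)" "openin (top_of_set (strip T1 \<union> ?B)) ?B"
      unfolding un[symmetric] by (metis openin_open_Int open_Times open_UNIV open_lessThan open_greaterThan)+
    have "continuous_on (strip T1) ?f"
      by (rule continuous_on_eq[OF w]) (auto simp: strip_def)
    moreover have "continuous_on ?B ?f"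
    proof (rule continuous_on_eq)
      show "continuous_on ?B (\<lambda>p. v (fst p - t0) (snd p))"
        by (rule strip_compose_continuous[OF v]) (use t0 in \<open>auto intro!: continuous_intros\<close>)
      show "v (fst p - t0) (snd p) = ?f p" if "p \<in> ?B" for p
        using that wv[of "fst p" "snd p"] by (auto simp: case_prod_unfold)
    qed
    ultimately show ?thesis unfolding un by (intro continuous_on_Un_local_open op)
  qed
  show ?thesis
  proof (rule C1_strip_withI)
    fix t x assume t: "0 \<le> t" "t < t0 + \<tau>"
    show "((\<lambda>s. (if s < T1 then W s else V (s - t0)) x) has_real_derivative (if t < T1 then Wt t else Vt (t - t0)) x) (at t within {0..<t0 + \<tau>})"
    proof (cases "t < T1")
      case True
      have "((\<lambda>s. (if s < T1 then W s else V (s - t0)) x) has_real_derivative Wt t x) (at t within {0..<T1})"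
        using C1_strip_with_t[OF W t(1) True, of x] unfolding has_field_derivative_def
        by (rule has_derivative_transform[rotated 2]) (use t True in auto)
      moreover have "at t within {0..<T1} = at t within {0..<t0 + \<tau>}"
        by (rule at_within_nhd[of t "{..<T1}"]) (use True t0 in auto)
      ultimately show ?thesis using True by simp
    next
      case False
      have "at (t - t0) within {0..<\<tau>} = at (t - t0)"
        by (rule at_within_interior) (use False t t0 in \<open>auto simp: interior_atLeastLessThan\<close>)
      then have "((\<lambda>s. V s x) has_real_derivative Vt (t - t0) x) (at (t + (- t0)))"
        using C1_strip_with_t[OF V, of "t - t0" x] False t t0 by simp
      then have "((\<lambda>s. V (s + (- t0)) x) has_real_derivative Vt (t - t0) x) (at t)" by (simp only: DERIV_shift)
      then have "((\<lambda>s. (if s < T1 then W s else V (s - t0)) x) has_real_derivative Vt (t - t0) x) (at t)"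
        by (rule has_field_derivative_transform_within_open[of _ _ _ "{t0<..}"]) (use False t0 eq in auto)
      then show ?thesis using False by (auto intro: has_field_derivative_at_within)
    qed
    show "((if t < T1 then W t else V (t - t0)) has_real_derivative (if t < T1 then Wx t else Vx (t - t0)) x) (at x)"
      using C1_strip_with_x[OF W t(1)] C1_strip_with_x[OF V, of "t - t0"] t t0 by simp
  qed (use glue[OF C1_strip_with_continuous(2)[OF W] C1_strip_with_continuous(2)[OF V]]
        glue[OF C1_strip_with_continuous(3)[OF W] C1_strip_with_continuous(3)[OF V]] eq in auto)
qed

lemma diagonal_continuation:
  fixes lam G :: "'n::finite \<Rightarrow> real ^ 'n \<Rightarrow> real"
  assumes lam: "\<And>i. c11 (lam i)" and G: "\<And>i. c11 (G i)" and T1: "T1 > 0"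
    and W: "diagonal_solution lam G T1 W Wt Wx"
    and bd: "\<And>i t x. 0 \<le> t \<Longrightarrow> t < T1 \<Longrightarrow> \<bar>W i t x\<bar> \<le> A \<and> \<bar>Wx i t x\<bar> \<le> A"
  shows "\<exists>T2>T1. \<exists>Z Zt Zx K. diagonal_solution lam G T2 Z Zt Zx \<and>
     (\<forall>i t x. t < T1 \<longrightarrow> Z i t x = W i t x \<and> Zx i t x = Wx i t x) \<and>
     (\<forall>i t x. 0 \<le> t \<longrightarrow> t < T2 \<longrightarrow> \<bar>Z i t x\<bar> \<le> K \<and> \<bar>Zx i t x\<bar> \<le> K)"
proof -
  have A: "A \<ge> 0" using bd[of 0 undefined 0] T1 by linarith
  obtain \<tau> where \<tau>: "\<tau> > 0" and ex: "\<And>W0 W0' :: 'n \<Rightarrow> real \<Rightarrow> real.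
     (\<forall>i x. \<bar>W0 i x\<bar> \<le> A \<and> (W0 i has_real_derivative W0' i x) (at x) \<and> \<bar>W0' i x\<bar> \<le> A) \<Longrightarrow>
      (\<forall>i. continuous_on UNIV (W0' i)) \<Longrightarrow>
      (\<exists>W Wt Wx K. diagonal_solution lam G \<tau> W Wt Wx \<and> (\<forall>i x. W i 0 x = W0 i x) \<and>
         (\<forall>i t x. 0 \<le> t \<longrightarrow> t < \<tau> \<longrightarrow> \<bar>W i t x\<bar> \<le> K \<and> \<bar>Wx i t x\<bar> \<le> K))"
    using diagonal_local_existence[of lam G A] lam G A by blast
  \<comment> \<open>Half a lifespan before \<open>T1\<close>, or half of \<open>T1\<close> if that
    is shorter: the restart time is nonnegative and the new solution reaches beyond
    \<open>T1\<close>.\<close>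
  define t0 where "t0 = T1 - min \<tau> T1 / 2"
  have t0: "0 \<le> t0" "t0 < T1" "T1 < t0 + \<tau>" using \<tau> T1 by (auto simp: t0_def min_def)
  have "\<exists>V Vt Vx K. diagonal_solution lam G \<tau> V Vt Vx \<and> (\<forall>i x. V i 0 x = W i t0 x) \<and>
         (\<forall>i t x. 0 \<le> t \<longrightarrow> t < \<tau> \<longrightarrow> \<bar>V i t x\<bar> \<le> K \<and> \<bar>Vx i t x\<bar> \<le> K)"
  proof (rule ex; intro allI conjI)
    fix i x
    show "\<bar>W i t0 x\<bar> \<le> A" "\<bar>Wx i t0 x\<bar> \<le> A" using bd t0 by auto
    show "(W i t0 has_real_derivative Wx i t0 x) (at x)"
      by (rule C1_strip_with_x[OF diagonal_solution_C1[OF W]]) (use t0 in auto)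
    show "continuous_on UNIV (Wx i t0)"
      by (rule strip_compose_continuous[OF C1_strip_with_continuous(3)[OF diagonal_solution_C1[OF W]]])
         (use t0 in \<open>auto intro!: continuous_intros\<close>)
  qed
  then obtain V Vt Vx K where V: "diagonal_solution lam G \<tau> V Vt Vx" "\<And>i x. V i 0 x = W i t0 x"
    "\<And>i t x. 0 \<le> t \<Longrightarrow> t < \<tau> \<Longrightarrow> \<bar>V i t x\<bar> \<le> K \<and> \<bar>Vx i t x\<bar> \<le> K" by blast
  have V': "diagonal_solution lam G (T1 - t0) V Vt Vx"
    by (rule diagonal_solution_restrict[OF V(1)]) (use t0 in auto)
  have eqs: "W i (t0 + s) x = V i s x" if s: "0 \<le> s" "s < T1 - t0" for i s x
  proof (rule diagonal_uniqueness[OF lam G diagonal_solution_shift[OF W t0(1,2)] V', of "max A K"])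
    fix i t x assume t: "0 \<le> t" "t < T1 - t0"
    have "\<bar>W i (t0 + t) x\<bar> \<le> A" using bd[of "t0 + t" i x] t t0 by simp
    moreover have "\<bar>V i t x\<bar> \<le> K \<and> \<bar>Vx i t x\<bar> \<le> K" using V(3)[of t i x] t t0 by simp
    ultimately show "\<bar>W i (t0 + t) x\<bar> \<le> max A K \<and> \<bar>V i t x\<bar> \<le> max A K \<and> \<bar>Vx i t x\<bar> \<le> max A K" by auto
  qed (use V(2) s in auto)
  have eq: "W i t x = V i (t - t0) x" if "t0 \<le> t" "t < T1" for i t x
    using eqs[of "t - t0" i x] that by simp
  have eqx: "Wx i t x = Vx i (t - t0) x" if t: "t0 \<le> t" "t < T1" for i t x
  proof -
    have "W i t = V i (t - t0)" using eq[OF t] by blast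
    moreover have "(W i t has_real_derivative Wx i t x) (at x)"
      by (rule C1_strip_with_x[OF diagonal_solution_C1[OF W]]) (use t t0 in auto)
    moreover have "(V i (t - t0) has_real_derivative Vx i (t - t0) x) (at x)"
      by (rule C1_strip_with_x[OF diagonal_solution_C1[OF V(1)]]) (use t t0 in auto)
    ultimately show ?thesis using DERIV_unique by metis
  qed
  \<comment> \<open>The equation expresses time derivatives through values and x-derivatives, so
    they agree as well, without comparing one-sided derivatives at \<open>t0\<close>.\<close>
  have eqt: "Wt i t x = Vt i (t - t0) x" if t: "t0 \<le> t" "t < T1" for i t x
  proof -
    have "state W t x = state V (t - t0) x" using eq[OF t] by (simp add: state_def)
    then show ?thesis
      using diagonal_solution_eq[OF W, of t i x] diagonal_solution_eq[OF V(1), of "t - t0" i x] eqx[OF t, of i x] t t0 by simp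
  qed
  define Z where "Z i t = (if t < T1 then W i t else V i (t - t0))" for i t
  define Zt where "Zt i t = (if t < T1 then Wt i t else Vt i (t - t0))" for i t
  define Zx where "Zx i t = (if t < T1 then Wx i t else Vx i (t - t0))" for i t
  show ?thesis
  proof (rule exI[of _ "t0 + \<tau>"], rule conjI[OF t0(3)], rule exI[of _ Z], rule exI[of _ Zt], rule exI[of _ Zx],
      rule exI[of _ "max A K"], intro conjI allI impI)
    show "diagonal_solution lam G (t0 + \<tau>) Z Zt Zx"
      unfolding diagonal_solution_def
    proof (intro conjI allI impI)
      show "C1_strip_with (t0 + \<tau>) (Z i) (Zt i) (Zx i)" for i
        unfolding Z_def[abs_def] Zt_def[abs_def] Zx_def[abs_def]
        by (rule C1_strip_with_glue[OF diagonal_solution_C1[OF W] diagonal_solution_C1[OF V(1)] t0]) (use eq eqt eqx in auto)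
      fix i t x assume t: "0 \<le> t" "t < t0 + \<tau>"
      have "state Z t x = (if t < T1 then state W t x else state V (t - t0) x)" by (simp add: state_def Z_def)
      then show "Zt i t x + lam i (state Z t x) * Zx i t x = G i (state Z t x)"
        using diagonal_solution_eq[OF W t(1), of i x] diagonal_solution_eq[OF V(1), of "t - t0" i x] t t0
        by (simp add: Zt_def Zx_def)
    qed
  next
    fix i t x assume t: "0 \<le> t" "t < t0 + \<tau>"
    show "\<bar>Z i t x\<bar> \<le> max A K" "\<bar>Zx i t x\<bar> \<le> max A K"
      using bd[of t i x] V(3)[of "t - t0" i x] t t0 by (auto simp: Z_def Zx_def)
  qed (auto simp: Z_def Zx_def)
qed

section \<open>The system with general flux\<close>

text \<open>The x-quotient of \<open>u\<close> is an average of \<open>ux\<close>, which can be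
  differentiated in t under the integral because \<open>ux\<close> is C^1. As h tends to 0 from the
  right, the quotient of \<open>ut\<close> tends to \<open>D\<close> and the average of
  \<open>vt\<close> to \<open>vt t x\<close>.\<close>

lemma mixed_partials:
  assumes u: "C1_strip_with T u ut ux" and v: "C1_strip_with T ux vt vx"
    and ut: "(ut t has_real_derivative D) (at x)" and t: "0 \<le> t" "t < T"
  shows "vt t x = D"
proof -
  \<comment> \<open>A compact time interval inside the half-open strip that reaches past
    \<open>t\<close>, for the Leibniz rule and the uniqueness of derivatives within it.\<close>
  define b where "b = (t + T) / 2"
  have b: "t < b" "b < T" "0 < b" using t by (auto simp: b_def)
  have eq: "(ut t (x + h) - ut t x) / h = integral {0..1} (\<lambda>s. vt t (x + s * h))" if h: "h > 0" for h
  proof -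
    have "((\<lambda>q. integral (cbox 0 1) (\<lambda>s. ux q (x + s * h))) has_real_derivative integral (cbox 0 1) (\<lambda>s. vt t (x + s * h))) (at t within {0..b})"
    proof (rule leibniz_rule_field_derivative)
      show "((\<lambda>q. ux q (x + s * h)) has_real_derivative vt q (x + s * h)) (at q within {0..b})" if "q \<in> {0..b}" for q s
        by (rule DERIV_subset[OF C1_strip_with_t[OF v]]) (use that b in auto)
      show "(\<lambda>s. ux q (x + s * h)) integrable_on cbox 0 1" if "q \<in> {0..b}" for q
        by (rule integrable_continuous, rule strip_compose_continuous[OF C1_strip_with_continuous(1)[OF v]])
          (use that b in \<open>auto intro!: continuous_intros\<close>)
      show "continuous_on ({0..b} \<times> cbox 0 1) (\<lambda>(q,s). vt q (x + s * h))"
        unfolding case_prod_unfold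
        by (rule strip_compose_continuous[OF C1_strip_with_continuous(2)[OF v]]) (use b in \<open>auto intro!: continuous_intros\<close>)
    qed (use t b in auto)
    moreover have "((\<lambda>q. (u q (x + h) - u q x) / h) has_real_derivative (ut t (x + h) - ut t x) / h) (at t within {0..b})"
      by (intro DERIV_cdivide DERIV_diff DERIV_subset[OF C1_strip_with_t[OF u t]]) (use b in auto)
    moreover have "integral (cbox 0 1) (\<lambda>s. ux q (x + s * h)) = (u q (x + h) - u q x) / h" if "q \<in> {0..b}" for q
      using integral_segment_derivative[OF C1_strip_with_x[OF u], of q h x] that h b by simp
    ultimately have "((\<lambda>q. (u q (x + h) - u q x) / h) has_vector_derivative integral (cbox 0 1) (\<lambda>s. vt t (x + s * h))) (at t within cbox 0 b)"
      "((\<lambda>q. (u q (x + h) - u q x) / h) has_vector_derivative (ut t (x + h) - ut t x) / h) (at t within cbox 0 b)"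
      using t b has_vector_derivative_transform[of t "cbox 0 b" "\<lambda>q. (u q (x + h) - u q x) / h" "\<lambda>q. integral (cbox 0 1) (\<lambda>s. ux q (x + s * h))"]
      by (auto simp: has_real_derivative_iff_has_vector_derivative)
    then show ?thesis using vector_derivative_unique_within_closed_interval[of 0 b t] t b by fastforce
  qed
  have "((\<lambda>h. (ut t (x + h) - ut t x) / h) \<longlongrightarrow> D) (at_right 0)"
    using ut unfolding DERIV_def by (rule filterlim_mono) (auto simp: at_le)
  moreover have "((\<lambda>h. (ut t (x + h) - ut t x) / h) \<longlongrightarrow> vt t x) (at_right 0)"
  proof (rule Lim_transform_eventually[OF segment_average_limit[where k = "vt t" and x = x]])
    show "continuous_on UNIV (vt t)"
      by (rule strip_compose_continuous[OF C1_strip_with_continuous(2)[OF v]]) (use t in auto)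
    show "\<forall>\<^sub>F h in at_right 0. integral {0..1} (\<lambda>s. vt t (x + s * h)) = (ut t (x + h) - ut t x) / h"
      using eq by (auto simp: eventually_at_right_field intro!: exI[of _ 1])
  qed
  ultimately show ?thesis using tendsto_unique[OF trivial_limit_at_right_real] by blast
qed

section \<open>Equivalence of the system with its diagonal form\<close>

datatype component = Dens | Vel | Expn

lemma UNIV_component: "UNIV = {Dens, Vel, Expn}"
  by (auto intro: component.exhaust)

instance component :: finite
  by standard (unfold UNIV_component, simp)

definition speed :: "(real \<Rightarrow> real \<Rightarrow> real) \<Rightarrow> (real \<Rightarrow> real \<Rightarrow> real) \<Rightarrow> component \<Rightarrow> real ^ component \<Rightarrow> real" where
  "speed f fr i w = (case i of
     Dens \<Rightarrow> f (w $ Dens) (w $ Vel) + w $ Dens * fr (w $ Dens) (w $ Vel) | Vel \<Rightarrow> w $ Vel | Expn \<Rightarrow> w $ Vel)"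

text \<open>The derivative u_x is eliminated as \<open>w $ Expn - w $ Dens\<close>: it stems from -
  \<rho> f_u u_x in the density equation and from - e u_x in the equation of e. No derivative of the
  unknowns remains.\<close>

definition source :: "(real \<Rightarrow> real \<Rightarrow> real) \<Rightarrow> (real \<Rightarrow> real \<Rightarrow> real) \<Rightarrow> component \<Rightarrow> real ^ component \<Rightarrow> real" where
  "source f fu i w = (case i of
     Dens \<Rightarrow> - (w $ Dens * fu (w $ Dens) (w $ Vel) * (w $ Expn - w $ Dens))
   | Vel \<Rightarrow> w $ Dens * (f (w $ Dens) (w $ Vel) - w $ Vel)
   | Expn \<Rightarrow> - (w $ Expn * (w $ Expn - w $ Dens)))"

definition triple :: "'a \<Rightarrow> 'a \<Rightarrow> 'a \<Rightarrow> component \<Rightarrow> 'a" where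
  "triple r u e i = (case i of Dens \<Rightarrow> r | Vel \<Rightarrow> u | Expn \<Rightarrow> e)"

lemma triple_simps [simp]: "triple r u e Dens = r" "triple r u e Vel = u" "triple r u e Expn = e"
  by (simp_all add: triple_def)

lemma all_component: "(\<forall>i. P i) \<longleftrightarrow> P Dens \<and> P Vel \<and> P Expn"
  by (metis component.exhaust)

lemma smooth2_compose_continuous:
  assumes "smooth2 f" "continuous_on S a" "continuous_on S b"
  shows "continuous_on S (\<lambda>z. f (a z) (b z))"
proof -
  have "continuous_on S (\<lambda>z. (a z, b z))" using assms(2,3) by (intro continuous_intros)
  from continuous_on_compose2[OF smooth2_continuous[OF assms(1)] this] show ?thesis by simp
qed

locale smooth_flux =
  fixes f fr fu :: "real \<Rightarrow> real \<Rightarrow> real"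
  assumes f: "smooth2 f" and fr: "smooth2 fr" and fu: "smooth2 fu"
    and f_deriv: "((\<lambda>(x,y). f x y) has_derivative (\<lambda>(h,k). fr a b * h + fu a b * k)) (at (a,b))"
begin

lemma speed_c11: "c11 (speed f fr i)"
  using smooth2_c11_nth[OF f, of Dens Vel] smooth2_c11_nth[OF fr, of Dens Vel]
  by (cases i) (auto simp: speed_def[abs_def] intro!: c11_add c11_mult c11_nth)

lemma source_c11: "c11 (source f fu i)"
  using smooth2_c11_nth[OF f, of Dens Vel] smooth2_c11_nth[OF fu, of Dens Vel]
  by (cases i) (auto simp: source_def[abs_def] intro!: c11_minus c11_diff c11_mult c11_nth)

lemma chain:
  assumes "(p has_real_derivative p') (at x)" "(q has_real_derivative q') (at x)"
  shows "((\<lambda>y. f (p y) (q y)) has_real_derivative fr (p x) (q x) * p' + fu (p x) (q x) * q') (at x)"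
proof -
  have 1: "((\<lambda>y. (p y, q y)) has_derivative (\<lambda>h. (p' * h, q' * h))) (at x)"
    using assms unfolding has_field_derivative_def by (rule has_derivative_Pair)
  have 2: "((\<lambda>(x,y). f x y) has_derivative (\<lambda>(h,k). fr (p x) (q x) * h + fu (p x) (q x) * k)) (at (p x, q x))"
    by (rule f_deriv)
  have "(\<lambda>h. case (p' * h, q' * h) of (h,k) \<Rightarrow> fr (p x) (q x) * h + fu (p x) (q x) * k)
      = (*) (fr (p x) (q x) * p' + fu (p x) (q x) * q')"
    by (simp add: fun_eq_iff algebra_simps)
  with has_derivative_compose[OF 1 2] show ?thesis unfolding has_field_derivative_def by simp
qed

lemma flux_chain:
  assumes "(p has_real_derivative p') (at x)" "(q has_real_derivative q') (at x)"
  shows "((\<lambda>y. p y * f (p y) (q y)) has_real_derivative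
     p' * f (p x) (q x) + p x * (fr (p x) (q x) * p' + fu (p x) (q x) * q')) (at x)"
  using DERIV_mult[OF assms(1) chain[OF assms]] by (simp add: algebra_simps)

lemma diagonal_equations:
  fixes x :: real
  assumes W: "diagonal_solution (speed f fr) (source f fu) T W Wt Wx" and t: "0 \<le> t" "t < T"
  defines "r \<equiv> W Dens t x" and "u \<equiv> W Vel t x" and "e \<equiv> W Expn t x"
  shows "Wt Dens t x = - (r * fu r u * (e - r)) - (f r u + r * fr r u) * Wx Dens t x"
    "Wt Vel t x = r * (f r u - u) - u * Wx Vel t x"
    "Wt Expn t x = - (e * (e - r)) - u * Wx Expn t x"
  using diagonal_solution_eq[OF W t, of _ x] by (simp_all add: speed_def source_def r_def u_def e_def)

text \<open>Here \<open>W Expn\<close> is an independent unknown, and the defect \<delta> = u_x +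
  \<rho> - e vanishes initially. Formally \<delta>_t + (u \<delta>)_x = (\<rho> f_u - e) \<delta>;
  as u_x has no time derivative a priori, this is exploited through
  \<open>conservation_law_zero\<close>.\<close>

lemma diagonal_imp_classical:
  assumes W: "diagonal_solution (speed f fr) (source f fu) T W Wt Wx"
    and bd: "\<And>i t x. 0 \<le> t \<Longrightarrow> t < T \<Longrightarrow> \<bar>W i t x\<bar> \<le> K \<and> \<bar>Wx i t x\<bar> \<le> K"
    and init: "\<And>x. W Dens 0 x = rho0 x" "\<And>x. W Vel 0 x = u0 x" "\<And>x. Wx Vel 0 x + W Dens 0 x = W Expn 0 x"
    and T: "T > 0"
  shows "classical_sol f rho0 u0 T (W Dens) (W Vel)" "C1_strip T (e_of (W Dens) (W Vel))"
proof -
  note C1 = diagonal_solution_C1[OF W]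
  note cont = C1_strip_with_continuous[OF C1]
  note X = C1_strip_with_x[OF C1]
  note E = diagonal_equations[OF W]
  have K: "K \<ge> 0" using bd[of 0 undefined 0] T by linarith
  let ?r = "W Dens" and ?u = "W Vel" and ?e = "W Expn"
  let ?rx = "Wx Dens" and ?ux = "Wx Vel" and ?ex = "Wx Expn"
  \<comment> \<open>The factor of the defect in its conservation law. It is bounded on the ball of
    radius \<open>3 * K\<close>, which contains all states since three components are bounded by
    \<open>K\<close>.\<close>
  define c where "c w = w $ Dens * fu (w $ Dens) (w $ Vel) - w $ Expn" for w :: "real ^ component"
  have "c11 c" unfolding c_def[abs_def]
    by (intro c11_diff c11_mult c11_nth smooth2_c11_nth fu) simp
  then obtain D Kc where Kc: "Kc \<ge> 0" "c11_with c D (3 * K) Kc" using c11_obtain by metis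
  have cb: "\<bar>?r t x * fu (?r t x) (?u t x) - ?e t x\<bar> \<le> Kc" if t: "0 \<le> t" "t < T" for t x
  proof -
    have "CARD(component) = 3" unfolding UNIV_component by simp
    then have n: "norm (state W t x) \<le> 3 * K"
      using vec_norm_le_of_components[of "state W t x" K] bd[OF t] by simp
    from c11_withD(1)[OF Kc(2) n n] show ?thesis by (simp add: c_def)
  qed
  \<comment> \<open>Chosen so that u_t + P = - u \<delta> by the velocity equation, while (\<rho> -
    e)_t - P_x is a multiple of \<delta> by the other two.\<close>
  define P where "P t x = - (?r t x * f (?r t x) (?u t x)) + ?u t x * ?e t x" for t x
  define Px where "Px t x = - (?rx t x * f (?r t x) (?u t x) + ?r t x * (fr (?r t x) (?u t x) * ?rx t x + fu (?r t x) (?u t x) * ?ux t x))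
     + (?ux t x * ?e t x + ?ex t x * ?u t x)" for t x
  have constraint: "?ux t x + (?r t x - ?e t x) = 0" if t: "0 \<le> t" "t < T" for t x
  proof (rule conservation_law_zero[where g = "\<lambda>t x. ?r t x - ?e t x" and P = P and Px = Px and K = "3 * K" and Kc = Kc])
    show "C1_strip_with T ?u (Wt Vel) ?ux" by (rule C1)
    show "C1_strip_with T (\<lambda>t x. ?r t x - ?e t x) (\<lambda>t x. Wt Dens t x - Wt Expn t x) (\<lambda>t x. ?rx t x - ?ex t x)"
      by (rule C1_strip_withI)
        (use cont in \<open>auto intro!: DERIV_diff C1_strip_with_t[OF C1] X continuous_intros simp: case_prod_unfold\<close>)
    show "continuous_on (strip T) (\<lambda>(t,x). Px t x)"
    proof -
      have c: "continuous_on (strip T) (\<lambda>p. W i (fst p) (snd p))" "continuous_on (strip T) (\<lambda>p. Wx i (fst p) (snd p))" for i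
        using cont(1,3)[of i] by (simp_all add: case_prod_unfold)
      show ?thesis unfolding Px_def case_prod_unfold
        by (intro continuous_on_add continuous_on_mult continuous_on_minus c smooth2_compose_continuous[OF f]
            smooth2_compose_continuous[OF fr] smooth2_compose_continuous[OF fu])
    qed
    fix t x assume t: "0 \<le> t" "t < T"
    show "(P t has_real_derivative Px t x) (at x)"
      unfolding P_def[abs_def] Px_def
      by (intro DERIV_add DERIV_minus flux_chain DERIV_mult X t)
    show "Wt Vel t x + P t x = - (?u t x * (?ux t x + (?r t x - ?e t x)))"
      unfolding E(2)[OF t] P_def by (simp add: algebra_simps)
    have "(Wt Dens t x - Wt Expn t x) - Px t x = (?r t x * fu (?r t x) (?u t x) - ?e t x) * (?ux t x + (?r t x - ?e t x))"
      unfolding E(1)[OF t] E(3)[OF t] Px_def by (simp add: algebra_simps)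
    then show "\<bar>(Wt Dens t x - Wt Expn t x) - Px t x\<bar> \<le> Kc * \<bar>?ux t x + (?r t x - ?e t x)\<bar>"
      using cb[OF t, of x] by (simp add: abs_mult mult_right_mono)
    show "\<bar>?u t x\<bar> \<le> 3 * K \<and> \<bar>?ux t x\<bar> \<le> 3 * K \<and> \<bar>?ux t x + (?r t x - ?e t x)\<bar> \<le> 3 * K"
      using bd[OF t, of Vel x] bd[OF t, of Dens x] bd[OF t, of Expn x] K by auto
  qed (use Kc init(3) t in \<open>auto simp: algebra_simps\<close>)
  have ux: "?ux t x = ?e t x - ?r t x" if "0 \<le> t" "t < T" for t x
    using constraint[OF that, of x] by linarith
  show "classical_sol f rho0 u0 T ?r ?u"
    unfolding classical_sol_def
  proof (rule exI[of _ "Wt Dens"], rule exI[of _ ?rx], rule exI[of _ "Wt Vel"], rule exI[of _ ?ux], intro conjI allI impI)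
    fix t x assume t: "0 \<le> t \<and> t < T"
    then have t': "0 \<le> t" "t < T" by auto
    have "?rx t x * f (?r t x) (?u t x) + ?r t x * (fr (?r t x) (?u t x) * ?rx t x + fu (?r t x) (?u t x) * ?ux t x) = - Wt Dens t x"
      unfolding E(1)[OF t'] ux[OF t'] by (simp add: algebra_simps)
    then show "((\<lambda>y. ?r t y * f (?r t y) (?u t y)) has_real_derivative - Wt Dens t x) (at x)"
      using flux_chain[OF X[OF t', of Dens] X[OF t', of Vel], of x] by simp
    show "Wt Vel t x + ?u t x * ?ux t x = ?r t x * (f (?r t x) (?u t x) - ?u t x)"
      unfolding E(2)[OF t'] by simp
  next
    fix t' assume "0 \<le> t' \<and> t' < T"
    then show "\<exists>M. \<forall>t x. 0 \<le> t \<and> t \<le> t' \<longrightarrow> \<bar>?r t x\<bar> \<le> M \<and> \<bar>?u t x\<bar> \<le> M \<and> \<bar>?rx t x\<bar> \<le> M \<and> \<bar>?ux t x\<bar> \<le> M"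
      using bd by (intro exI[of _ K]) auto
  qed (use C1 init in auto)
  have "e_of ?r ?u t x = ?e t x" if t: "0 \<le> t" "t < T" for t x
    using DERIV_imp_deriv[OF X[OF t, of Vel x]] ux[OF t, of x] by (simp add: e_of_def)
  from C1_strip_with_cong[OF C1[of Expn] this] show "C1_strip T (e_of ?r ?u)"
    unfolding C1_strip_def by blast
qed

text \<open>As e is C^1, so is u_x = e - \<rho>, and the velocity equation may be differentiated in
  x with mixed derivatives exchanged. The density equation supplies the x-derivative of the flux
  term.\<close>

lemma classical_imp_diagonal:
  assumes sol: "classical_sol f rho0 u0 T rho u" and e: "C1_strip T (e_of rho u)"
  shows "\<exists>Wt Wx. diagonal_solution (speed f fr) (source f fu) T (triple rho u (e_of rho u)) Wt Wx \<and>
     (\<forall>t x. 0 \<le> t \<longrightarrow> t < T \<longrightarrow> Wx Vel t x = e_of rho u t x - rho t x)"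
proof -
  obtain rhot rhox ut ux where r: "C1_strip_with T rho rhot rhox" and u: "C1_strip_with T u ut ux"
    and pde: "\<forall>t x. 0 \<le> t \<and> t < T \<longrightarrow>
           ((\<lambda>y. rho t y * f (rho t y) (u t y)) has_real_derivative (- rhot t x)) (at x) \<and>
           ut t x + u t x * ux t x = rho t x * (f (rho t x) (u t x) - u t x)"
    using sol unfolding classical_sol_def by (elim exE conjE) (rule that)
  then have er: "\<And>t x. 0 \<le> t \<Longrightarrow> t < T \<Longrightarrow> ((\<lambda>y. rho t y * f (rho t y) (u t y)) has_real_derivative (- rhot t x)) (at x)"
    and eu: "\<And>t x. 0 \<le> t \<Longrightarrow> t < T \<Longrightarrow> ut t x + u t x * ux t x = rho t x * (f (rho t x) (u t x) - u t x)"
    by auto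
  obtain et ex where e: "C1_strip_with T (e_of rho u) et ex" using e unfolding C1_strip_def by blast
  have eo: "e_of rho u t x = ux t x + rho t x" if "0 \<le> t" "t < T" for t x
    using DERIV_imp_deriv[OF C1_strip_with_x[OF u that]] by (simp add: e_of_def)
  have "C1_strip_with T (\<lambda>t x. e_of rho u t x - rho t x) (\<lambda>t x. et t x - rhot t x) (\<lambda>t x. ex t x - rhox t x)"
    by (rule C1_strip_withI)
      (use C1_strip_with_continuous[OF r] C1_strip_with_continuous[OF e] in
        \<open>auto intro!: DERIV_diff C1_strip_with_t[OF e] C1_strip_with_t[OF r] C1_strip_with_x[OF e] C1_strip_with_x[OF r] continuous_intros simp: case_prod_unfold\<close>)
  then have v: "C1_strip_with T ux (\<lambda>t x. et t x - rhot t x) (\<lambda>t x. ex t x - rhox t x)"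
    by (rule C1_strip_with_cong) (simp add: eo)
  have rt: "rhot t x = - (rhox t x * f (rho t x) (u t x) + rho t x * (fr (rho t x) (u t x) * rhox t x + fu (rho t x) (u t x) * ux t x))"
    if t: "0 \<le> t" "t < T" for t x
    using DERIV_unique[OF er[OF t] flux_chain[OF C1_strip_with_x[OF r t] C1_strip_with_x[OF u t]], of x] by simp
  have et: "et t x = - (e_of rho u t x * ux t x) - u t x * ex t x" if t: "0 \<le> t" "t < T" for t x
  proof -
    note rx = C1_strip_with_x[OF r t] and ux = C1_strip_with_x[OF u t] and vx = C1_strip_with_x[OF v t]
    \<comment> \<open>Solved for u_t, the velocity equation shows that u_t is differentiable in x,
      which is what \<open>mixed_partials\<close> asks for.\<close>
    have "ut t = (\<lambda>y. rho t y * f (rho t y) (u t y) - rho t y * u t y - u t y * ux t y)"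
      using eu[OF t] by (auto simp: algebra_simps eq_diff_eq)
    moreover have "((\<lambda>y. rho t y * f (rho t y) (u t y) - rho t y * u t y - u t y * ux t y) has_real_derivative
        - rhot t x - (rhox t x * u t x + ux t x * rho t x) - (ux t x * ux t x + (ex t x - rhox t x) * u t x)) (at x)"
      by (intro DERIV_diff DERIV_mult er[OF t] rx ux vx)
    ultimately have "et t x - rhot t x = - rhot t x - (rhox t x * u t x + ux t x * rho t x) - (ux t x * ux t x + (ex t x - rhox t x) * u t x)"
      using mixed_partials[OF u v _ t] by simp
    then show ?thesis using eo[OF t, of x] by (simp add: algebra_simps)
  qed
  show ?thesis
  proof (rule exI[of _ "triple rhot ut et"], rule exI[of _ "triple rhox ux ex"], rule conjI)
    show "diagonal_solution (speed f fr) (source f fu) T (triple rho u (e_of rho u)) (triple rhot ut et) (triple rhox ux ex)"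
    proof -
      have "rhot t x + (f (rho t x) (u t x) + rho t x * fr (rho t x) (u t x)) * rhox t x
          = - (rho t x * fu (rho t x) (u t x) * (e_of rho u t x - rho t x))"
        "et t x + u t x * ex t x = - (e_of rho u t x * (e_of rho u t x - rho t x))"
        if "0 \<le> t" "t < T" for t x
        unfolding rt[OF that] et[OF that] eo[OF that] by (simp_all add: algebra_simps)
      then show ?thesis
        unfolding diagonal_solution_def all_component using r u e eu by (simp add: speed_def source_def)
    qed
    show "\<forall>t x. 0 \<le> t \<longrightarrow> t < T \<longrightarrow> triple rhox ux ex Vel t x = e_of rho u t x - rho t x"
      using eo by simp
  qed
qed

end

section \<open>Initial data, local existence and continuation\<close>

lemma Ckb_1D:
  assumes "Ckb 1 g"
  shows "(g has_real_derivative deriv g x) (at x)" "continuous_on UNIV (deriv g)"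
    "\<exists>M. \<forall>x. \<bar>g x\<bar> \<le> M \<and> \<bar>deriv g x\<bar> \<le> M"
proof -
  have "g differentiable (at x)" and c: "continuous_on UNIV (deriv g)" and b: "\<forall>j\<le>1. bounded (range ((deriv ^^ j) g))"
    using assms by (auto simp: Ckb_def)
  then show "(g has_real_derivative deriv g x) (at x)" "continuous_on UNIV (deriv g)"
    by (auto simp: DERIV_deriv_iff_real_differentiable)
  have "bounded (range g)" "bounded (range (deriv g))" using b[rule_format, of 0] b[rule_format, of 1] by auto
  then obtain M1 M2 where "\<forall>x. \<bar>g x\<bar> \<le> M1" "\<forall>x. \<bar>deriv g x\<bar> \<le> M2"
    unfolding bounded_iff by auto
  then show "\<exists>M. \<forall>x. \<bar>g x\<bar> \<le> M \<and> \<bar>deriv g x\<bar> \<le> M"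
    by (intro exI[of _ "max M1 M2"]) (auto simp: le_max_iff_disj)
qed

lemma Ckb_2D:
  assumes "Ckb 2 g"
  shows "Ckb 1 g" "Ckb 1 (deriv g)"
proof -
  have d: "\<forall>x. g differentiable (at x)" "\<forall>x. deriv g differentiable (at x)"
    and c: "continuous_on UNIV (deriv (deriv g))" and b: "\<forall>j\<le>2. bounded (range ((deriv ^^ j) g))"
    using assms unfolding Ckb_def by (auto simp: numeral_2_eq_2 All_less_Suc)
  have b': "bounded (range g)" "bounded (range (deriv g))" "bounded (range (deriv (deriv g)))"
    using b[rule_format, of 0] b[rule_format, of 1] b[rule_format, of 2] by (auto simp: numeral_2_eq_2)
  have le1: "j \<le> Suc 0 \<longleftrightarrow> j = 0 \<or> j = Suc 0" for j :: nat by auto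
  have "continuous_on UNIV (deriv g)"
    using d(2) by (intro continuous_at_imp_continuous_on) (auto intro: differentiable_imp_continuous_within)
  then show "Ckb 1 g" "Ckb 1 (deriv g)"
    using d c b' by (auto simp: Ckb_def le1)
qed

context smooth_flux
begin

lemma local_existence:
  assumes rho0: "Ckb 1 rho0" and u0: "Ckb 2 u0"
  shows "\<exists>T>0. \<exists>rho u. classical_sol f rho0 u0 T rho u \<and> C1_strip T (e_of rho u)"
proof -
  note u0' = Ckb_2D[OF u0]
  note r = Ckb_1D[OF rho0] and u = Ckb_1D[OF u0'(1)] and v = Ckb_1D[OF u0'(2)]
  obtain M1 M2 M3 where M: "\<And>x. \<bar>rho0 x\<bar> \<le> M1 \<and> \<bar>deriv rho0 x\<bar> \<le> M1" "\<And>x. \<bar>u0 x\<bar> \<le> M2 \<and> \<bar>deriv u0 x\<bar> \<le> M2"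
    "\<And>x. \<bar>deriv u0 x\<bar> \<le> M3 \<and> \<bar>deriv (deriv u0) x\<bar> \<le> M3"
    using r(3) u(3) v(3) by blast
  define A where "A = M1 + M2 + M3"
  have pos: "M1 \<ge> 0" "M2 \<ge> 0" "M3 \<ge> 0" using M(1)[of 0] M(2)[of 0] M(3)[of 0] by linarith+
  \<comment> \<open>The third unknown starts from u0' + rho0; two bounded derivatives of
    \<open>u0\<close> make its slope bounded and continuous.\<close>
  define W0 where "W0 = triple rho0 u0 (\<lambda>x. deriv u0 x + rho0 x)"
  define W0' where "W0' = triple (deriv rho0) (deriv u0) (\<lambda>x. deriv (deriv u0) x + deriv rho0 x)"
  have "A \<ge> 0" using pos by (simp add: A_def)
  from diagonal_local_existence[of "speed f fr" "source f fu", OF speed_c11 source_c11 this]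
  obtain T where T: "T > 0" and ex: "\<forall>W0 W0'. (\<forall>i x. \<bar>W0 i x\<bar> \<le> A \<and> (W0 i has_real_derivative W0' i x) (at x) \<and> \<bar>W0' i x\<bar> \<le> A) \<longrightarrow>
      (\<forall>i. continuous_on UNIV (W0' i)) \<longrightarrow>
      (\<exists>W Wt Wx K. diagonal_solution (speed f fr) (source f fu) T W Wt Wx \<and> (\<forall>i x. W i 0 x = W0 i x) \<and>
         (\<forall>i t x. 0 \<le> t \<longrightarrow> t < T \<longrightarrow> \<bar>W i t x\<bar> \<le> K \<and> \<bar>Wx i t x\<bar> \<le> K))"
    by (elim exE conjE) (rule that)
  have h1: "\<forall>i x. \<bar>W0 i x\<bar> \<le> A \<and> (W0 i has_real_derivative W0' i x) (at x) \<and> \<bar>W0' i x\<bar> \<le> A"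
    unfolding all_component W0_def W0'_def triple_simps
  proof (intro conjI allI)
    fix x
    show "\<bar>rho0 x\<bar> \<le> A" "\<bar>deriv rho0 x\<bar> \<le> A" "\<bar>u0 x\<bar> \<le> A" "\<bar>deriv u0 x\<bar> \<le> A"
      "\<bar>deriv u0 x + rho0 x\<bar> \<le> A" "\<bar>deriv (deriv u0) x + deriv rho0 x\<bar> \<le> A"
      using M(1)[of x] M(2)[of x] M(3)[of x] pos by (auto simp: A_def)
  qed (intro r(1) u(1) v(1) DERIV_add)+
  have h2: "\<forall>i. continuous_on UNIV (W0' i)"
    unfolding all_component W0'_def triple_simps using r(2) u(2) v(2) by (auto intro: continuous_on_add)
  obtain W Wt Wx K where W: "diagonal_solution (speed f fr) (source f fu) T W Wt Wx"
    and init: "\<And>i x. W i 0 x = W0 i x" and bd: "\<And>i t x. 0 \<le> t \<Longrightarrow> t < T \<Longrightarrow> \<bar>W i t x\<bar> \<le> K \<and> \<bar>Wx i t x\<bar> \<le> K"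
    using ex[THEN spec, THEN spec, THEN mp, THEN mp, OF h1 h2] by blast
  \<comment> \<open>Compatibility at time 0: the x-derivative of the constructed velocity is u0', so
    the defect vanishes initially.\<close>
  have "W Vel 0 = u0" using init[of Vel] by (auto simp: W0_def)
  then have "Wx Vel 0 x = deriv u0 x" for x
    using DERIV_unique[OF C1_strip_with_x[OF diagonal_solution_C1[OF W], of 0 Vel x]] u(1) T by auto
  then have "Wx Vel 0 x + W Dens 0 x = W Expn 0 x" for x by (simp add: init W0_def)
  from diagonal_imp_classical[OF W bd _ _ this T, of rho0 u0] init T show ?thesis by (auto simp: W0_def)
qed

lemma continuation:
  assumes rho0: "Ckb 1 rho0" and u0: "Ckb 2 u0" and T1: "T1 > 0"
    and sol: "classical_sol f rho0 u0 T1 rho u" "C1_strip T1 (e_of rho u)"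
    and M: "\<And>t x. 0 \<le> t \<Longrightarrow> t < T1 \<Longrightarrow> \<bar>rho t x\<bar> \<le> M \<and> \<bar>u t x\<bar> \<le> M \<and>
      \<bar>deriv (\<lambda>y. rho t y) x\<bar> \<le> M \<and> \<bar>deriv (\<lambda>y. u t y) x\<bar> \<le> M"
  shows "\<exists>T2>T1. \<exists>rho' u'. classical_sol f rho0 u0 T2 rho' u' \<and> C1_strip T2 (e_of rho' u') \<and>
    (\<forall>t x. 0 \<le> t \<and> t < T1 \<longrightarrow> rho' t x = rho t x \<and> u' t x = u t x)"
proof -
  let ?e = "e_of rho u"
  obtain Wt Wx where W: "diagonal_solution (speed f fr) (source f fu) T1 (triple rho u ?e) Wt Wx"
    and ux: "\<And>t x. 0 \<le> t \<Longrightarrow> t < T1 \<Longrightarrow> Wx Vel t x = ?e t x - rho t x"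
    using classical_imp_diagonal[OF sol] by blast
  note X = C1_strip_with_x[OF diagonal_solution_C1[OF W]]
  have init: "rho 0 x = rho0 x" "u 0 x = u0 x" for x using sol(1) unfolding classical_sol_def by auto
  have M0: "M \<ge> 0" using M[of 0 0] T1 by linarith
  have bd: "\<bar>rho t x\<bar> \<le> M" "\<bar>u t x\<bar> \<le> M" "\<bar>?e t x - rho t x\<bar> \<le> M" "\<bar>?e t x\<bar> \<le> 2 * M"
    "\<bar>Wx Dens t x\<bar> \<le> M" "\<bar>Wx Vel t x\<bar> \<le> M" if t: "0 \<le> t" "t < T1" for t x
  proof -
    show *: "\<bar>rho t x\<bar> \<le> M" "\<bar>u t x\<bar> \<le> M" "\<bar>?e t x - rho t x\<bar> \<le> M" using M[OF t, of x] by (auto simp: e_of_def)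
    then show "\<bar>?e t x\<bar> \<le> 2 * M" "\<bar>Wx Vel t x\<bar> \<le> M" using ux[OF t] by auto
    show "\<bar>Wx Dens t x\<bar> \<le> M" using M[OF t, of x] DERIV_imp_deriv[OF X[OF t, of Dens x]] by simp
  qed
  have lip: "\<bar>rho t x - rho t y\<bar> \<le> M * \<bar>x - y\<bar>" "\<bar>u t x - u t y\<bar> \<le> M * \<bar>x - y\<bar>" if t: "0 \<le> t" "t < T1" for t x y
    using field_differentiable_bound[of UNIV "rho t" "Wx Dens t" M x y] X[OF t, of Dens] bd(5)[OF t]
      field_differentiable_bound[of UNIV "u t" "Wx Vel t" M x y] X[OF t, of Vel] bd(6)[OF t] by auto
  obtain L where L: "\<And>x y. \<bar>?e 0 x - ?e 0 y\<bar> \<le> L * \<bar>x - y\<bar>"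
  proof -
    note u0' = Ckb_2D[OF u0]
    note r = Ckb_1D[OF rho0] and v = Ckb_1D[OF u0'(2)]
    obtain M1 M3 where M: "\<And>x. \<bar>deriv rho0 x\<bar> \<le> M1" "\<And>x. \<bar>deriv (deriv u0) x\<bar> \<le> M3"
      using r(3) v(3) by blast
    have "?e 0 = (\<lambda>x. deriv u0 x + rho0 x)" using init by (auto simp: e_of_def)
    moreover have "((\<lambda>x. deriv u0 x + rho0 x) has_real_derivative deriv (deriv u0) x + deriv rho0 x) (at x)" for x
      by (intro DERIV_add r(1) v(1))
    moreover have "\<bar>deriv (deriv u0) x + deriv rho0 x\<bar> \<le> M1 + M3" for x using M(1)[of x] M(2)[of x] by linarith
    ultimately have "\<bar>?e 0 x - ?e 0 y\<bar> \<le> (M1 + M3) * \<bar>x - y\<bar>" for x y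
      using field_differentiable_bound[of UNIV "?e 0" "\<lambda>x. deriv (deriv u0) x + deriv rho0 x" "M1 + M3" x y] by auto
    then show thesis by (rule that)
  qed
  \<comment> \<open>Of the bounds that \<open>diagonal_continuation\<close> asks for, the slope of e
    is the one still missing. The source - e (e - \<rho>) is Lipschitz in x up to the increment of e
    itself, which \<open>transport_lipschitz\<close> allows.\<close>
  have "\<exists>L'. \<forall>t x y. 0 \<le> t \<longrightarrow> t < T1 \<longrightarrow> \<bar>?e t x - ?e t y\<bar> \<le> L' * \<bar>x - y\<bar>"
  proof (rule transport_lipschitz[where a = u and H = "\<lambda>t x. - (?e t x * (?e t x - rho t x))" and K = "2 * M" and M = M
        and C = "3 * M + 2 * M * M" and L = L])
    show "C1_strip_with T1 ?e (Wt Expn) (Wx Expn)" using diagonal_solution_C1[OF W, of Expn] by simp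
    fix t x y assume t: "0 \<le> t" "t < T1"
    show "Wt Expn t x + u t x * Wx Expn t x = - (?e t x * (?e t x - rho t x))"
      using diagonal_equations(3)[OF W t, of x] by simp
    show "\<bar>?e t x\<bar> \<le> 2 * M \<and> \<bar>u t x\<bar> \<le> 2 * M" using bd(2,4)[OF t, of x] M0 by auto
    have "\<bar>(?e t x - rho t x) - (?e t y - rho t y)\<bar> \<le> M * \<bar>x - y\<bar> + \<bar>?e t x - ?e t y\<bar>"
      using lip(1)[OF t, of x y] by linarith
    \<comment> \<open>With |e - \<rho>| = |u_x| \<le> M and |e| \<le> 2 M, the product changes by at
      most 3 M times the increment of e plus 2 M^2 |x - y|; the constant
      \<open>3 * M + 2 * M * M\<close> covers both.\<close>
    from abs_prod_diff_le[OF order_refl bd(3)[OF t, of x] bd(4)[OF t, of y] this, of "?e t x"]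
    have "\<bar>?e t x * (?e t x - rho t x) - ?e t y * (?e t y - rho t y)\<bar>
        \<le> \<bar>?e t x - ?e t y\<bar> * M + 2 * M * (M * \<bar>x - y\<bar> + \<bar>?e t x - ?e t y\<bar>)" .
    also have "\<dots> = 2 * M * M * \<bar>x - y\<bar> + 3 * M * \<bar>?e t x - ?e t y\<bar>" by (simp add: algebra_simps)
    also have "\<dots> \<le> (3 * M + 2 * M * M) * \<bar>x - y\<bar> + (3 * M + 2 * M * M) * \<bar>?e t x - ?e t y\<bar>"
      using M0 by (intro add_mono mult_right_mono) auto
    finally show "\<bar>- (?e t x * (?e t x - rho t x)) - - (?e t y * (?e t y - rho t y))\<bar>
        \<le> (3 * M + 2 * M * M) * (\<bar>x - y\<bar> + \<bar>?e t x - ?e t y\<bar>)"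
      by (simp add: distrib_left abs_minus_commute)
  qed (use lip(2) L M0 in auto)
  then obtain L' where L': "\<And>t x y. 0 \<le> t \<Longrightarrow> t < T1 \<Longrightarrow> \<bar>?e t x - ?e t y\<bar> \<le> L' * \<bar>x - y\<bar>" by blast
  have ex: "\<bar>Wx Expn t x\<bar> \<le> L'" if t: "0 \<le> t" "t < T1" for t x
    using lipschitz_imp_deriv_bound[OF X[OF t, of Expn x]] L'[OF t] by simp
  define A where "A = 2 * M + \<bar>L'\<bar>"
  have "\<bar>rho t x\<bar> \<le> A \<and> \<bar>Wx Dens t x\<bar> \<le> A" "\<bar>u t x\<bar> \<le> A \<and> \<bar>Wx Vel t x\<bar> \<le> A" "\<bar>?e t x\<bar> \<le> A \<and> \<bar>Wx Expn t x\<bar> \<le> A"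
    if t: "0 \<le> t" "t < T1" for t x
    using bd(1)[OF t, of x] bd(2)[OF t, of x] bd(4)[OF t, of x] bd(5)[OF t, of x] bd(6)[OF t, of x] ex[OF t, of x]
      abs_ge_self[of L'] M0 unfolding A_def by (intro conjI; linarith)+
  then have "\<forall>i. \<forall>t x. 0 \<le> t \<longrightarrow> t < T1 \<longrightarrow> \<bar>triple rho u ?e i t x\<bar> \<le> A \<and> \<bar>Wx i t x\<bar> \<le> A"
    unfolding all_component triple_simps by blast
  then have "\<exists>T2>T1. \<exists>Z Zt Zx K. diagonal_solution (speed f fr) (source f fu) T2 Z Zt Zx \<and>
     (\<forall>i t x. t < T1 \<longrightarrow> Z i t x = triple rho u ?e i t x \<and> Zx i t x = Wx i t x) \<and>
     (\<forall>i t x. 0 \<le> t \<longrightarrow> t < T2 \<longrightarrow> \<bar>Z i t x\<bar> \<le> K \<and> \<bar>Zx i t x\<bar> \<le> K)"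
    by (intro diagonal_continuation[of "speed f fr" "source f fu", OF speed_c11 source_c11 T1 W, of A]) blast
  then obtain T2 Z Zt Zx K where T2: "T2 > T1" and Z: "diagonal_solution (speed f fr) (source f fu) T2 Z Zt Zx"
    and Zeq: "\<And>i t x. t < T1 \<Longrightarrow> Z i t x = triple rho u ?e i t x \<and> Zx i t x = Wx i t x"
    and Zbd: "\<And>i t x. 0 \<le> t \<Longrightarrow> t < T2 \<Longrightarrow> \<bar>Z i t x\<bar> \<le> K \<and> \<bar>Zx i t x\<bar> \<le> K" by blast
  have "classical_sol f rho0 u0 T2 (Z Dens) (Z Vel)" "C1_strip T2 (e_of (Z Dens) (Z Vel))"
    by (rule diagonal_imp_classical[OF Z Zbd]; use T1 T2 Zeq[OF T1] init ux[of 0] in simp)+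
  then show ?thesis using T2 Zeq[of _ Dens] Zeq[of _ Vel]
    by (intro exI[of _ T2] conjI exI[of _ "Z Dens"] exI[of _ "Z Vel"]) auto
qed

end

theorem theorem2:
  fixes f :: "real \<Rightarrow> real \<Rightarrow> real" and rho0 u0 :: "real \<Rightarrow> real"
  assumes "smooth2 f" and "Ckb 1 rho0" and "Ckb 2 u0" and "\<And>x. rho0 x \<ge> 0"
  shows "(\<exists>T>0. \<exists>rho u. classical_sol f rho0 u0 T rho u \<and> C1_strip T (e_of rho u))
    \<and> (\<forall>T1 rho u. 0 < T1 \<and> classical_sol f rho0 u0 T1 rho u \<and> C1_strip T1 (e_of rho u) \<and>
         (\<exists>M. \<forall>t x. 0 \<le> t \<and> t < T1 \<longrightarrow>
            \<bar>rho t x\<bar> \<le> M \<and> \<bar>u t x\<bar> \<le> M \<and>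
            \<bar>deriv (\<lambda>y. rho t y) x\<bar> \<le> M \<and> \<bar>deriv (\<lambda>y. u t y) x\<bar> \<le> M)
       \<longrightarrow> (\<exists>T2>T1. \<exists>rho' u'. classical_sol f rho0 u0 T2 rho' u' \<and> C1_strip T2 (e_of rho' u') \<and>
              (\<forall>t x. 0 \<le> t \<and> t < T1 \<longrightarrow> rho' t x = rho t x \<and> u' t x = u t x)))"
proof -
  obtain fr fu where fl: "smooth2 fr" "smooth2 fu"
    "\<And>a b. ((\<lambda>(x,y). f x y) has_derivative (\<lambda>(h,k). fr a b * h + fu a b * k)) (at (a,b))"
    using smooth2_obtain[OF assms(1)] by metis
  interpret smooth_flux f fr fu by standard (use assms(1) fl in auto)
  show ?thesis
  proof (intro conjI allI impI)
    show "\<exists>T>0. \<exists>rho u. classical_sol f rho0 u0 T rho u \<and> C1_strip T (e_of rho u)"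
      by (rule local_existence[OF assms(2,3)])
    fix T1 rho u
    assume a: "0 < T1 \<and> classical_sol f rho0 u0 T1 rho u \<and> C1_strip T1 (e_of rho u) \<and>
         (\<exists>M. \<forall>t x. 0 \<le> t \<and> t < T1 \<longrightarrow>
            \<bar>rho t x\<bar> \<le> M \<and> \<bar>u t x\<bar> \<le> M \<and>
            \<bar>deriv (\<lambda>y. rho t y) x\<bar> \<le> M \<and> \<bar>deriv (\<lambda>y. u t y) x\<bar> \<le> M)"
    then obtain M where M: "\<And>t x. 0 \<le> t \<Longrightarrow> t < T1 \<Longrightarrow> \<bar>rho t x\<bar> \<le> M \<and> \<bar>u t x\<bar> \<le> M \<and>
            \<bar>deriv (\<lambda>y. rho t y) x\<bar> \<le> M \<and> \<bar>deriv (\<lambda>y. u t y) x\<bar> \<le> M" by blast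
    show "\<exists>T2>T1. \<exists>rho' u'. classical_sol f rho0 u0 T2 rho' u' \<and> C1_strip T2 (e_of rho' u') \<and>
              (\<forall>t x. 0 \<le> t \<and> t < T1 \<longrightarrow> rho' t x = rho t x \<and> u' t x = u t x)"
      by (rule continuation[OF assms(2,3)]) (use a M in auto)
  qed
qed

end
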